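(* Let $T>0$, $g\in C^2(\mathbb{R},\mathbb{R})$, $u_0\in H^1(\mathbb{T})$, $v_0\in L^2(\mathbb{T})$, and assume that the solution $u$ to the nonlinear wave equation $$\partial_t^2u-\partial_x^2u=g(u)\quad\text{on }[0,T]\times\mathbb{T},\qquad u(0)=u_0,\quad \partial_tu(0)=v_0,$$ satisfies $(u(t),\partial_tu(t))\in H^1(\mathbb{T})\times L^2(\mathbb{T})$ for all $t\in[0,T]$. For a step size $\tau>0$ let $(u_n,v_n)_{n\ge0}$ be defined recursively, starting from $(u_0,v_0)$, by $$\begin{pmatrix}u_{n+1} \\ v_{n+1}\end{pmatrix}=e^{\tau A}\left[\begin{pmatrix}u_n \\ v_n\end{pmatrix}+\tau\begin{pmatrix}0 \\ g(u_n)\end{pmatrix}+\tau^2\varphi_2(-2\tau A)\begin{pmatrix}-g(u_n) \\ g'(u_n)v_n\end{pmatrix}\right].$$ Then there are a constant $C>0$ and a maximum step size $\tau_0>0$, depending only on $g$, $T$, $\|u\|_{L^\infty([0,T],H^1(\mathbb{T}))}$ and $\|\partial_tu\|_{L^\infty([0,T],L^2(\mathbb{T}))}$, such that $$\|u(n\tau)-u_n\|_{H^1(\mathbb{T})}+\|\partial_tu(n\tau)-v_n\|_{L^2(\mathbb{T})}\le C\tau^2$$ for all $\tau\in(0,\tau_0]$ and all integers $n\ge0$ with $n\tau\le T$.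
   Context: $\mathbb{T}=\mathbb{R}/\mathbb{Z}$ is the one-dimensional torus; $u$ is real-valued. $A$ is the wave operator $A(u,v)^\top=(v,\partial_x^2u)^\top$, and $e^{tA}$, $t\in\mathbb{R}$, is the group it generates on $H^1(\mathbb{T})\times L^2(\mathbb{T})$, i.e. the solution operator $(\phi(0),\partial_t\phi(0))\mapsto(\phi(t),\partial_t\phi(t))$ of the linear wave equation $\partial_t^2\phi-\partial_x^2\phi=0$. The operator $\varphi_2(-2\tau A)$ is defined for $w\in H^1(\mathbb{T})\times L^2(\mathbb{T})$ by $$\varphi_2(-2\tau A)w=\frac1{\tau^2}\int_0^\tau(\tau-s)e^{-2sA}w\,\mathrm{d}s.$$ A solution $u$ is understood in the sense that $(u,\partial_tu)\in C([0,T],H^1(\mathbb{T})\times L^2(\mathbb{T}))\cap C^1([0,T],L^2(\mathbb{T})\times H^{-1}(\mathbb{T}))$, the equation holds in $H^{-1}(\mathbb{T})$ for all $t\in[0,T]$, and the initial conditions hold. *)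

theory Defs
  imports "HOL-Analysis.Analysis" "HOL-Probability.Essential_Supremum"
begin

section \<open>Functions on the torus\<close>

text \<open>Functions on the torus are 1-periodic functions on the line; integrals over the torus are
  integrals over the fundamental domain.\<close>

abbreviation torus :: "real measure" where
  "torus \<equiv> restrict_space lborel {0..<1}"

definition smooth_periodic :: "(real \<Rightarrow> real) \<Rightarrow> bool" where
  "smooth_periodic \<phi> \<longleftrightarrow>
     (\<forall>x. \<phi> (x + 1) = \<phi> x) \<and> (\<forall>n. (deriv ^^ n) \<phi> differentiable_on UNIV)"

text \<open>Trigonometric polynomials; only used to show that weak derivatives are unique.\<close>

inductive trig_fun :: "(real \<Rightarrow> real) \<Rightarrow> bool" where
  trig_const: "trig_fun (\<lambda>x. c)"
| trig_cos: "trig_fun (\<lambda>x. cos (2 * pi * x))"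
| trig_sin: "trig_fun (\<lambda>x. sin (2 * pi * x))"
| trig_add: "trig_fun f \<Longrightarrow> trig_fun g \<Longrightarrow> trig_fun (\<lambda>x. f x + g x)"
| trig_mult: "trig_fun f \<Longrightarrow> trig_fun g \<Longrightarrow> trig_fun (\<lambda>x. f x * g x)"

lemma trig_fun_deriv:
  assumes "trig_fun f"
  shows "\<exists>f'. trig_fun f' \<and> (\<forall>x. (f has_real_derivative f' x) (at x))"
  using assms
proof induction
  case (trig_const c)
  show ?case
    by (rule exI[of _ "\<lambda>x. 0"]) (auto intro: trig_fun.intros)
next
  case trig_cos
  have "trig_fun (\<lambda>x. (- (2 * pi)) * sin (2 * pi * x))"
    by (intro trig_fun.intros)
  then show ?case
    by (rule_tac x = "\<lambda>x. (- (2 * pi)) * sin (2 * pi * x)" in exI)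
       (auto intro!: derivative_eq_intros)
next
  case trig_sin
  have "trig_fun (\<lambda>x. (2 * pi) * cos (2 * pi * x))"
    by (intro trig_fun.intros)
  then show ?case
    by (rule_tac x = "\<lambda>x. (2 * pi) * cos (2 * pi * x)" in exI)
       (auto intro!: derivative_eq_intros)
next
  case (trig_add f g)
  then obtain f' g' where
    "trig_fun f'" "\<And>x. (f has_real_derivative f' x) (at x)"
    "trig_fun g'" "\<And>x. (g has_real_derivative g' x) (at x)"
    by auto
  then show ?case
    by (intro exI[of _ "\<lambda>x. f' x + g' x"] conjI trig_fun.intros allI DERIV_add)
next
  case (trig_mult f g)
  then obtain f' g' where *:
    "trig_fun f'" "\<And>x. (f has_real_derivative f' x) (at x)"
    "trig_fun g'" "\<And>x. (g has_real_derivative g' x) (at x)"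
    by auto
  have "trig_fun (\<lambda>x. f' x * g x + g' x * f x)"
    using * trig_mult by (intro trig_fun.intros)
  moreover have "((\<lambda>x. f x * g x) has_real_derivative f' x * g x + g' x * f x) (at x)" for x
    using DERIV_mult[OF *(2) *(4)] by simp
  ultimately show ?case by blast
qed

lemma trig_fun_deriv_funpow: "trig_fun f \<Longrightarrow> trig_fun ((deriv ^^ n) f)"
proof (induction n)
  case (Suc n)
  then obtain f' where f': "trig_fun f'"
    "\<And>x. ((deriv ^^ n) f has_real_derivative f' x) (at x)"
    using trig_fun_deriv by blast
  then have "deriv ((deriv ^^ n) f) = f'"
    by (intro ext DERIV_imp_deriv)
  then show ?case using f' by simp
qed simp

lemma trig_fun_smooth_periodic:
  assumes "trig_fun f"
  shows "smooth_periodic f"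
  unfolding smooth_periodic_def
proof (intro conjI allI)
  show "f (x + 1) = f x" for x
    using assms
    by induction (simp_all add: distrib_left)
  show "(deriv ^^ n) f differentiable_on UNIV" for n
  proof -
    obtain f' where "\<And>x. ((deriv ^^ n) f has_real_derivative f' x) (at x)"
      using trig_fun_deriv[OF trig_fun_deriv_funpow[OF assms]] by blast
    then show ?thesis
      unfolding differentiable_on_def
      by (metis differentiableI has_field_derivative_imp_has_derivative)
  qed
qed

lemma smooth_periodic_deriv:
  assumes "smooth_periodic \<phi>"
  shows "smooth_periodic (deriv \<phi>)"
  unfolding smooth_periodic_def
proof (intro conjI allI)
  have d: "(\<phi> has_real_derivative deriv \<phi> y) (at y)" for y
  proof -
    have "(deriv ^^ 0) \<phi> differentiable_on UNIV"
      using assms unfolding smooth_periodic_def by blast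
    then have "\<phi> differentiable (at y)"
      by (simp add: differentiable_on_def)
    then show ?thesis
      by (simp add: DERIV_deriv_iff_real_differentiable)
  qed
  fix x
  have "((\<lambda>y. \<phi> (y + 1)) has_real_derivative deriv \<phi> (x + 1)) (at x)"
    using d[of "x + 1"] by (simp add: DERIV_shift)
  moreover have "(\<lambda>y. \<phi> (y + 1)) = \<phi>"
    using assms by (auto simp: smooth_periodic_def)
  ultimately show "deriv \<phi> (x + 1) = deriv \<phi> x"
    using DERIV_unique[OF _ d[of x]] by simp
next
  fix n
  have "(deriv ^^ (Suc n)) \<phi> differentiable_on UNIV"
    using assms unfolding smooth_periodic_def by blast
  then show "(deriv ^^ n) (deriv \<phi>) differentiable_on UNIV"
    by (simp add: funpow_Suc_right del: funpow.simps)
qed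

lemma smooth_periodic_continuous:
  assumes "smooth_periodic \<phi>"
  shows "continuous_on UNIV \<phi>"
proof -
  have "(deriv ^^ 0) \<phi> differentiable_on UNIV"
    using assms unfolding smooth_periodic_def by blast
  then show ?thesis
    by (simp add: differentiable_imp_continuous_on)
qed

lemma continuous_periodic_bounded:
  fixes \<phi> :: "real \<Rightarrow> real"
  assumes "continuous_on UNIV \<phi>"
  obtains B where "\<And>x. x \<in> {0..<1} \<Longrightarrow> \<bar>\<phi> x\<bar> \<le> B"
proof -
  have "compact (\<phi> ` {0..1})"
    by (intro compact_continuous_image continuous_on_subset[OF assms]) auto
  then obtain B where "\<forall>y\<in>\<phi> ` {0..1}. norm y \<le> B"
    using compact_imp_bounded bounded_iff by metis
  then show ?thesis by (intro that[of B]) auto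
qed

lemma torus_finite [simp]: "finite_measure torus"
  by (intro finite_measureI) (simp add: space_restrict_space emeasure_restrict_space)

lemma torus_space [simp]: "space torus = {0..<1}"
  by (simp add: space_restrict_space)

lemma AE_torus_iff: "(AE x in torus. P x) \<longleftrightarrow> (AE x in lborel. x \<in> {0..<1} \<longrightarrow> P x)"
  by (rule AE_restrict_space_iff) simp

lemma borel_measurable_torus:
  "f \<in> borel_measurable borel \<Longrightarrow> f \<in> borel_measurable torus"
  by (simp add: measurable_restrict_space1)

lemma integrable_torus_bounded_mult:
  fixes f \<phi> :: "real \<Rightarrow> real"
  assumes "integrable torus f" "\<phi> \<in> borel_measurable borel"
    and "\<And>x. x \<in> {0..<1} \<Longrightarrow> \<bar>\<phi> x\<bar> \<le> B"
  shows "integrable torus (\<lambda>x. f x * \<phi> x)"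
proof (rule Bochner_Integration.integrable_bound[of _ "\<lambda>x. f x * B"])
  show "integrable torus (\<lambda>x. f x * B)" using assms(1) by simp
  show "(\<lambda>x. f x * \<phi> x) \<in> borel_measurable torus"
    using assms(1) borel_measurable_torus[OF assms(2)] by simp
  show "AE x in torus. norm (f x * \<phi> x) \<le> norm (f x * B)"
    using assms(3) by (intro AE_I2) (fastforce simp: abs_mult intro!: mult_left_mono)
qed

lemma trig_dense:
  fixes H :: "complex \<Rightarrow> real"
  assumes H: "continuous_on UNIV H" and "0 < e"
  obtains \<phi> where "trig_fun \<phi>" "\<And>x. \<bar>H (cis (2 * pi * x)) - \<phi> x\<bar> < e"
proof -
  obtain p :: "complex \<Rightarrow> real" where p: "real_polynomial_function p"
    "\<And>z. z \<in> sphere 0 1 \<Longrightarrow> \<bar>H z - p z\<bar> < e"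
    using Stone_Weierstrass_real_polynomial_function[of "sphere 0 1" H e]
      continuous_on_subset[OF H] assms(2) by auto
  have "trig_fun (\<lambda>x. p (cis (2 * pi * x)))"
    using p(1)
  proof induction
    case (linear f)
    have "f (cis (2 * pi * x)) = cos (2 * pi * x) * f 1 + sin (2 * pi * x) * f \<i>" for x
    proof -
      interpret bounded_linear f by fact
      have "cis (2 * pi * x) = cos (2 * pi * x) *\<^sub>R 1 + sin (2 * pi * x) *\<^sub>R \<i>"
        by (simp add: complex_eq_iff)
      then show ?thesis by (simp add: add scaleR)
    qed
    then show ?case by (simp add: trig_fun.intros)
  qed (auto intro: trig_fun.intros)
  then show ?thesis
    using p(2) by (intro that[of "\<lambda>x. p (cis (2 * pi * x))"]) auto
qed

lemma small_multiples:
  fixes I J :: real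
  assumes "0 \<le> J" and "\<And>e. e > 0 \<Longrightarrow> I \<le> e * J"
  shows "I \<le> 0"
proof (rule ccontr)
  assume I: "\<not> I \<le> 0"
  then have "I \<le> I / (2 * (J + 1)) * J"
    using assms(1) by (intro assms(2)) (auto intro!: divide_pos_pos)
  also have "\<dots> < I * 1"
    using I assms(1) mult_strict_left_mono[of "J / (2 * (J + 1))" 1 I] by (simp add: divide_simps)
  finally show False by simp
qed

text \<open>The fundamental lemma of the calculus of variations on the torus.\<close>

lemma torus_fundamental_lemma:
  fixes f :: "real \<Rightarrow> real"
  assumes f: "integrable torus f" and fb: "f \<in> borel_measurable borel"
    and orth: "\<And>\<phi>. smooth_periodic \<phi> \<Longrightarrow> (\<integral>x. f x * \<phi> x \<partial>torus) = 0"
  shows "AE x in torus. f x = 0"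
proof -
  have cisc: "continuous_on UNIV (\<lambda>x. cis (2 * pi * x))"
    by (intro continuous_intros)
  have cont0: "(\<integral>x. f x * H (cis (2 * pi * x)) \<partial>torus) = 0"
    if H: "continuous_on UNIV H" for H :: "complex \<Rightarrow> real"
  proof -
    let ?h = "\<lambda>x. H (cis (2 * pi * x))"
    have hc: "continuous_on UNIV ?h"
      using continuous_on_compose2[OF H cisc] by simp
    obtain B where B: "\<And>x. x \<in> {0..<1} \<Longrightarrow> \<bar>?h x\<bar> \<le> B"
      using continuous_periodic_bounded[OF hc] by blast
    have ih: "integrable torus (\<lambda>x. f x * ?h x)"
      by (rule integrable_torus_bounded_mult[OF f _ B])
         (use hc borel_measurable_continuous_onI in auto)
    have est: "\<bar>\<integral>x. f x * ?h x \<partial>torus\<bar> \<le> e * (\<integral>x. \<bar>f x\<bar> \<partial>torus)" if e: "e > 0" for e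
    proof -
      obtain \<phi> where \<phi>: "trig_fun \<phi>" "\<And>x. \<bar>?h x - \<phi> x\<bar> < e"
        using trig_dense[OF H e] by blast
      have sp: "smooth_periodic \<phi>" by (rule trig_fun_smooth_periodic[OF \<phi>(1)])
      have pc: "continuous_on UNIV \<phi>" by (rule smooth_periodic_continuous[OF sp])
      obtain B' where B': "\<And>x. x \<in> {0..<1} \<Longrightarrow> \<bar>\<phi> x\<bar> \<le> B'"
        using continuous_periodic_bounded[OF pc] by blast
      have ip: "integrable torus (\<lambda>x. f x * \<phi> x)"
        by (rule integrable_torus_bounded_mult[OF f _ B'])
           (use pc borel_measurable_continuous_onI in auto)
      have "(\<integral>x. f x * ?h x \<partial>torus) = (\<integral>x. f x * ?h x - f x * \<phi> x \<partial>torus)"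
        using ih ip orth[OF sp] by simp
      also have "\<bar>\<dots>\<bar> \<le> (\<integral>x. \<bar>f x * ?h x - f x * \<phi> x\<bar> \<partial>torus)"
        using integral_norm_bound[of torus "\<lambda>x. f x * ?h x - f x * \<phi> x"] by simp
      also have "\<dots> \<le> (\<integral>x. e * \<bar>f x\<bar> \<partial>torus)"
      proof (rule integral_mono)
        show "integrable torus (\<lambda>x. \<bar>f x * ?h x - f x * \<phi> x\<bar>)" using ih ip by simp
        show "integrable torus (\<lambda>x. e * \<bar>f x\<bar>)" using f by simp
        fix x
        have "\<bar>f x * ?h x - f x * \<phi> x\<bar> = \<bar>f x\<bar> * \<bar>?h x - \<phi> x\<bar>"
          by (simp add: abs_mult[symmetric] right_diff_distrib)
        also have "\<dots> \<le> \<bar>f x\<bar> * e"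
          using \<phi>(2)[of x] by (intro mult_left_mono) auto
        finally show "\<bar>f x * ?h x - f x * \<phi> x\<bar> \<le> e * \<bar>f x\<bar>" by (simp add: mult.commute)
      qed
      finally show ?thesis by simp
    qed
    have "\<bar>\<integral>x. f x * ?h x \<partial>torus\<bar> \<le> 0"
      by (rule small_multiples[OF _ est]) (auto intro: integral_nonneg_AE)
    then show ?thesis by simp
  qed
  have comp0: "(\<integral>x. f x * indicator K x \<partial>torus) = 0"
    if K: "compact K" "K \<subseteq> {0<..<1}" "K \<noteq> {}" for K
  proof -
    let ?L = "(\<lambda>x. cis (2 * pi * x)) ` K"
    have L: "closed ?L" "?L \<noteq> {}"
      using K compact_continuous_image[OF continuous_on_subset[OF cisc] K(1)]
      by (auto intro: compact_imp_closed)
    define H where "H = (\<lambda>n z. max 0 (1 - real n * infdist z ?L))"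
    have Hc: "continuous_on UNIV (H n)" for n
      unfolding H_def by (intro continuous_intros)
    have lim: "(\<lambda>n. H n (cis (2 * pi * x))) \<longlonglongrightarrow> indicator K x" if x: "x \<in> {0..<1}" for x
    proof (cases "x \<in> K")
      case True
      then have "cis (2 * pi * x) \<in> ?L" by blast
      then show ?thesis using True by (simp add: H_def)
    next
      case False
      have "cis (2 * pi * x) \<notin> ?L"
      proof
        assume "cis (2 * pi * x) \<in> ?L"
        then obtain y where y: "y \<in> K" "cis (2 * pi * x) = cis (2 * pi * y)" by blast
        then have "sin (2 * pi * x) = sin (2 * pi * y)" "cos (2 * pi * x) = cos (2 * pi * y)"
          by (simp_all add: complex_eq_iff)
        then obtain n :: int where "2 * pi * x = 2 * pi * y + 2 * pi * of_int n"
          using sin_cos_eq_iff[of "2 * pi * x" "2 * pi * y"] by auto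
        then have "2 * pi * x = 2 * pi * (y + of_int n)" by (simp add: distrib_left)
        then have "x = y + of_int n" by simp
        moreover have "0 < y" "y < 1" "0 \<le> x" "x < 1" using y K x by auto
        ultimately have "n = 0" by linarith
        with \<open>x = y + of_int n\<close> y False show False by simp
      qed
      then have d: "infdist (cis (2 * pi * x)) ?L > 0"
        using L infdist_pos_not_in_closed by blast
      obtain N :: nat where N: "1 / infdist (cis (2 * pi * x)) ?L < real N"
        using reals_Archimedean2 by blast
      have "H n (cis (2 * pi * x)) = 0" if "n \<ge> N" for n
      proof -
        have "1 / infdist (cis (2 * pi * x)) ?L \<le> real n" using N that by linarith
        then have "1 \<le> real n * infdist (cis (2 * pi * x)) ?L" using d by (simp add: field_simps)
        then show ?thesis by (simp add: H_def)
      qed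
      then have "\<forall>\<^sub>F n in sequentially. H n (cis (2 * pi * x)) = 0"
        by (auto simp: eventually_sequentially)
      then show ?thesis using False by (simp add: tendsto_eventually)
    qed
    have mH: "(\<lambda>x. H n (cis (2 * pi * x))) \<in> borel_measurable borel" for n
      using continuous_on_compose2[OF Hc cisc] by (intro borel_measurable_continuous_onI) auto
    have mK: "(indicator K :: real \<Rightarrow> real) \<in> borel_measurable borel"
      by (rule borel_measurable_indicator) (use K(1) borel_compact in blast)
    have "(\<lambda>n. \<integral>x. f x * H n (cis (2 * pi * x)) \<partial>torus) \<longlonglongrightarrow> (\<integral>x. f x * indicator K x \<partial>torus)"
    proof (rule integral_dominated_convergence[where w = "\<lambda>x. \<bar>f x\<bar>"])
      show "(\<lambda>x. f x * indicator K x) \<in> borel_measurable torus"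
        by (intro borel_measurable_torus borel_measurable_times fb mK)
      show "(\<lambda>x. f x * H n (cis (2 * pi * x))) \<in> borel_measurable torus" for n
        by (intro borel_measurable_torus borel_measurable_times fb mH)
      show "integrable torus (\<lambda>x. \<bar>f x\<bar>)" using f by simp
      show "AE x in torus. (\<lambda>n. f x * H n (cis (2 * pi * x))) \<longlonglongrightarrow> f x * indicator K x"
        using lim by (intro AE_I2 tendsto_mult tendsto_const) auto
      have "\<bar>H n z\<bar> \<le> 1" for n z
        using infdist_nonneg[of z ?L] by (auto simp: H_def)
      then show "AE x in torus. norm (f x * H n (cis (2 * pi * x))) \<le> \<bar>f x\<bar>" for n
        by (intro AE_I2) (simp add: abs_mult mult_left_le)
    qed
    moreover have "(\<integral>x. f x * H n (cis (2 * pi * x)) \<partial>torus) = 0" for n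
      by (rule cont0[OF Hc])
    ultimately show ?thesis
      by (simp add: LIMSEQ_const_iff)
  qed
  have null: "emeasure lborel A = 0"
    if A: "A \<in> sets borel" "A \<subseteq> {0<..<1}" and sgn: "\<And>x. x \<in> A \<Longrightarrow> c * f x > 0" for A and c :: real
  proof (rule ccontr)
    assume pos: "emeasure lborel A \<noteq> 0"
    have "emeasure lborel A \<le> emeasure lborel {0<..<1::real}"
      using A by (intro emeasure_mono) auto
    then have fin: "emeasure lborel A < \<infinity>"
      by (simp add: le_less_trans)
    have "0 < measure lborel A" 
      using pos fin by (simp add: measure_def enn2real_positive_iff zero_less_iff_neq_zero)
    moreover have AL: "A \<in> sets lebesgue" using A(1) by simp
    ultimately obtain K where K: "closed K" "K \<subseteq> A" "A - K \<in> lmeasurable"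
        "emeasure lebesgue (A - K) < ennreal (measure lborel A)"
      using sets_lebesgue_inner_closed[OF AL] by metis
    have Kb: "K \<in> sets borel" using K(1) by simp
    have AK: "emeasure lborel (A - K) < ennreal (measure lborel A)"
      using K(4) A(1) Kb by simp
    have Kpos: "emeasure lborel K \<noteq> 0"
    proof
      assume "emeasure lborel K = 0"
      then have "emeasure lborel A = emeasure lborel (A - K)"
        using A(1) Kb K(2) emeasure_Diff_null_set[of K lborel A] by (simp add: null_sets_def)
      moreover have "emeasure lborel A = ennreal (measure lborel A)"
        by (rule emeasure_eq_ennreal_measure) (use fin in auto)
      ultimately show False
        using AK by (metis less_irrefl)
    qed
    then have Kne: "K \<noteq> {}" by auto
    have Kc: "compact K"
      using K(1,2) A(2) bounded_subset[of "{0<..<1::real}" K] by (auto simp: compact_eq_bounded_closed)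
    have Ki: "K \<subseteq> {0<..<1}" using K(2) A(2) by blast
    have iK: "integrable torus (\<lambda>x. f x * indicator K x)"
      by (rule integrable_torus_bounded_mult[OF f _, of _ 1]) (use Kb in \<open>auto simp: indicator_def\<close>)
    have "(\<integral>x. c * (f x * indicator K x) \<partial>torus) = 0"
      using comp0[OF Kc Ki Kne] by simp
    moreover have "AE x in torus. 0 \<le> c * (f x * indicator K x)"
      using sgn K(2) by (intro AE_I2) (force simp: indicator_def)
    ultimately have "AE x in torus. c * (f x * indicator K x) = 0"
      using iK integral_nonneg_eq_0_iff_AE[of torus "\<lambda>x. c * (f x * indicator K x)"] by simp
    then have "AE x in lborel. x \<in> {0..<1} \<longrightarrow> c * (f x * indicator K x) = 0"
      by (rule AE_torus_iff[THEN iffD1])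
    then have "AE x in lborel. x \<notin> K"
    proof eventually_elim
      case (elim x)
      show ?case
      proof
        assume "x \<in> K"
        then show False using elim sgn[of x] K(2) Ki by (auto simp: indicator_def)
      qed
    qed
    then show False
      using Kpos Kb AE_iff_measurable[of K lborel "\<lambda>x. x \<notin> K"] by auto
  qed
  have "{x \<in> space borel. f x > 0} \<inter> {0<..<1} \<in> sets borel"
       "{x \<in> space borel. f x < 0} \<inter> {0<..<1} \<in> sets borel"
    using fb by (intro sets.Int; simp)+
  then have "{x \<in> space borel. f x > 0} \<inter> {0<..<1} \<in> null_sets lborel"
       "{x \<in> space borel. f x < 0} \<inter> {0<..<1} \<in> null_sets lborel"
    using null[of "{x \<in> space borel. f x > 0} \<inter> {0<..<1}" 1]
      null[of "{x \<in> space borel. f x < 0} \<inter> {0<..<1}" "-1"] by (auto simp: null_sets_def)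
  moreover have "{0::real} \<in> null_sets lborel" by (simp add: null_sets_def)
  ultimately have "AE x in lborel. x \<notin> {x \<in> space borel. f x > 0} \<inter> {0<..<1} \<and>
      x \<notin> {x \<in> space borel. f x < 0} \<inter> {0<..<1} \<and> x \<notin> {0}"
    using AE_not_in by (intro AE_conjI) blast+
  then have "AE x in lborel. x \<in> {0..<1} \<longrightarrow> f x = 0"
  proof eventually_elim
    case (elim x)
    then show ?case by (cases "f x > 0"; cases "f x < 0"; auto)
  qed
  then show ?thesis by (rule AE_torus_iff[THEN iffD2])
qed


section \<open>The space \<open>L\<^sup>2\<close> of the torus\<close>

text \<open>Every Lebesgue measurable function agrees almost everywhere with a Borel measurable one, so
  Borel measurable representatives suffice.\<close>

definition sq_integrable :: "(real \<Rightarrow> real) \<Rightarrow> bool" where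
  "sq_integrable f \<longleftrightarrow>
     f \<in> borel_measurable borel \<and> (\<forall>x. f (x + 1) = f x) \<and> integrable torus (\<lambda>x. (f x)\<^sup>2)"

definition l2_rel :: "(real \<Rightarrow> real) \<Rightarrow> (real \<Rightarrow> real) \<Rightarrow> bool" where
  "l2_rel f g \<longleftrightarrow> sq_integrable f \<and> sq_integrable g \<and> (AE x in torus. f x = g x)"

lemma sq_integrable_mult:
  assumes "sq_integrable f" "sq_integrable g"
  shows "integrable torus (\<lambda>x. f x * g x)"
proof (rule Bochner_Integration.integrable_bound[of _ "\<lambda>x. (f x)\<^sup>2 + (g x)\<^sup>2"])
  show "integrable torus (\<lambda>x. (f x)\<^sup>2 + (g x)\<^sup>2)"
    using assms by (simp add: sq_integrable_def)
  show "(\<lambda>x. f x * g x) \<in> borel_measurable torus"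
    using assms by (intro borel_measurable_torus borel_measurable_times) (auto simp: sq_integrable_def)
  have "\<bar>a * b\<bar> \<le> a\<^sup>2 + b\<^sup>2" for a b :: real
  proof -
    have "2 * \<bar>a\<bar> * \<bar>b\<bar> \<le> \<bar>a\<bar>\<^sup>2 + \<bar>b\<bar>\<^sup>2" by (rule sum_squares_bound)
    moreover have "0 \<le> \<bar>a\<bar> * \<bar>b\<bar>" by simp
    ultimately show ?thesis unfolding power2_abs abs_mult by linarith
  qed
  then show "AE x in torus. norm (f x * g x) \<le> norm ((f x)\<^sup>2 + (g x)\<^sup>2)"
    by (intro AE_I2) (simp add: abs_mult[symmetric])
qed

lemma sq_integrable_add:
  assumes "sq_integrable f" "sq_integrable g"
  shows "sq_integrable (\<lambda>x. f x + g x)"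
proof -
  have "integrable torus (\<lambda>x. f x * f x + 2 * (f x * g x) + g x * g x)"
    using sq_integrable_mult assms by (intro Bochner_Integration.integrable_add integrable_mult_right) auto
  then have "integrable torus (\<lambda>x. (f x + g x)\<^sup>2)"
    by (rule Bochner_Integration.integrable_cong[THEN iffD1, rotated -1])
       (auto simp: power2_eq_square algebra_simps)
  then show ?thesis using assms by (auto simp: sq_integrable_def)
qed

lemma sq_integrable_scale: "sq_integrable f \<Longrightarrow> sq_integrable (\<lambda>x. c * f x)"
  by (auto simp: sq_integrable_def power_mult_distrib)

lemma sq_integrable_zero: "sq_integrable (\<lambda>x. 0)"
  by (simp add: sq_integrable_def)

lemma sq_integrable_const: "sq_integrable (\<lambda>x. c)"
  by (simp add: sq_integrable_def finite_measure.integrable_const)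

lemma sq_integrable_continuous:
  assumes "continuous_on UNIV f" "\<And>x. f (x + 1) = f x"
  shows "sq_integrable f"
proof -
  have m: "f \<in> borel_measurable borel" using assms(1) by (rule borel_measurable_continuous_onI)
  obtain B where B: "\<And>x. x \<in> {0..<1} \<Longrightarrow> \<bar>f x\<bar> \<le> B"
    using continuous_periodic_bounded[OF assms(1)] by blast
  have "integrable torus (\<lambda>x. 1 * f x)"
    by (rule integrable_torus_bounded_mult[OF _ m B]) (simp_all add: finite_measure.integrable_const)
  from integrable_torus_bounded_mult[OF this m B] have "integrable torus (\<lambda>x. (f x)\<^sup>2)"
    by (simp add: power2_eq_square)
  then show ?thesis using m assms(2) by (simp add: sq_integrable_def)
qed

lemma sq_integrable_test: "smooth_periodic \<phi> \<Longrightarrow> sq_integrable \<phi>"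
  by (intro sq_integrable_continuous smooth_periodic_continuous) (auto simp: smooth_periodic_def)

lemma sq_integrable_integrable:
  assumes "sq_integrable f"
  shows "integrable torus f"
  using sq_integrable_mult[OF assms sq_integrable_const[of 1]] by simp

quotient_type l2_torus = "real \<Rightarrow> real" / partial: l2_rel
proof (rule part_equivpI)
  show "\<exists>f. l2_rel f f" using sq_integrable_zero by (auto simp: l2_rel_def)
  show "symp l2_rel"
    by (rule sympI) (auto simp: l2_rel_def elim: eventually_mono)
  show "transp l2_rel"
  proof (rule transpI)
    fix f g h assume "l2_rel f g" "l2_rel g h"
    then have "AE x in torus. f x = g x" "AE x in torus. g x = h x" by (auto simp: l2_rel_def)
    then have "AE x in torus. f x = h x" by eventually_elim simp
    then show "l2_rel f h" using \<open>l2_rel f g\<close> \<open>l2_rel g h\<close> by (auto simp: l2_rel_def)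
  qed
qed

instantiation l2_torus :: real_inner
begin

lift_definition zero_l2_torus :: l2_torus is "\<lambda>x. 0"
  by (simp add: l2_rel_def sq_integrable_zero)

lift_definition plus_l2_torus :: "l2_torus \<Rightarrow> l2_torus \<Rightarrow> l2_torus" is "\<lambda>f g x. f x + g x"
  by (auto simp: l2_rel_def sq_integrable_add elim: eventually_elim2)

lift_definition scaleR_l2_torus :: "real \<Rightarrow> l2_torus \<Rightarrow> l2_torus" is "\<lambda>c f x. c * f x"
  by (auto simp: l2_rel_def sq_integrable_scale elim: eventually_mono)

definition uminus_l2_torus :: "l2_torus \<Rightarrow> l2_torus" where
  "- (u :: l2_torus) = (-1) *\<^sub>R u"

definition minus_l2_torus :: "l2_torus \<Rightarrow> l2_torus \<Rightarrow> l2_torus" where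
  "(u :: l2_torus) - v = u + (- v)"

lift_definition inner_l2_torus :: "l2_torus \<Rightarrow> l2_torus \<Rightarrow> real" is "\<lambda>f g. \<integral>x. f x * g x \<partial>torus"
proof -
  fix f f' g g' assume "l2_rel f f'" "l2_rel g g'"
  then have sq: "sq_integrable f" "sq_integrable f'" "sq_integrable g" "sq_integrable g'"
    and ae: "AE x in torus. f x = f' x" "AE x in torus. g x = g' x"
    by (auto simp: l2_rel_def)
  show "(\<integral>x. f x * g x \<partial>torus) = (\<integral>x. f' x * g' x \<partial>torus)"
  proof (rule integral_cong_AE)
    show "(\<lambda>x. f x * g x) \<in> borel_measurable torus" "(\<lambda>x. f' x * g' x) \<in> borel_measurable torus"
      using sq by (intro borel_measurable_torus borel_measurable_times; simp add: sq_integrable_def)+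
    show "AE x in torus. f x * g x = f' x * g' x"
      using ae by eventually_elim simp
  qed
qed

definition norm_l2_torus :: "l2_torus \<Rightarrow> real" where
  "norm (u :: l2_torus) = sqrt (inner u u)"

definition sgn_l2_torus :: "l2_torus \<Rightarrow> l2_torus" where
  "sgn (u :: l2_torus) = inverse (norm u) *\<^sub>R u"

definition dist_l2_torus :: "l2_torus \<Rightarrow> l2_torus \<Rightarrow> real" where
  "dist (u :: l2_torus) v = norm (u - v)"

definition uniformity_l2_torus :: "(l2_torus \<times> l2_torus) filter" where
  "uniformity = (INF e\<in>{0<..}. principal {(u, v :: l2_torus). dist u v < e})"

definition open_l2_torus :: "l2_torus set \<Rightarrow> bool" where
  "open (U :: l2_torus set) \<longleftrightarrow> (\<forall>x\<in>U. \<forall>\<^sub>F (x', y) in uniformity. x' = x \<longrightarrow> y \<in> U)"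

instance
proof
  fix u v w :: l2_torus and a b :: real
  show "u + v + w = u + (v + w)"
    by transfer (simp add: l2_rel_def sq_integrable_add add.assoc)
  show "u + v = v + u"
    by transfer (simp add: l2_rel_def sq_integrable_add add.commute)
  show "0 + u = u"
    by transfer (simp add: l2_rel_def)
  show "- u + u = 0"
    unfolding uminus_l2_torus_def
    by transfer (auto simp: l2_rel_def sq_integrable_zero)
  show "u - v = u + - v" by (rule minus_l2_torus_def)
  show "a *\<^sub>R (u + v) = a *\<^sub>R u + a *\<^sub>R v"
    by transfer (auto simp: l2_rel_def distrib_left intro!: sq_integrable_add sq_integrable_scale)
  show "(a + b) *\<^sub>R u = a *\<^sub>R u + b *\<^sub>R u"
    by transfer (auto simp: l2_rel_def distrib_right intro!: sq_integrable_add sq_integrable_scale)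
  show "a *\<^sub>R b *\<^sub>R u = (a * b) *\<^sub>R u"
    by transfer (auto simp: l2_rel_def mult.assoc intro!: sq_integrable_scale)
  show "1 *\<^sub>R u = u"
    by transfer (simp add: l2_rel_def)
  show "sgn u = inverse (norm u) *\<^sub>R u" by (rule sgn_l2_torus_def)
  show "dist u v = norm (u - v)" by (rule dist_l2_torus_def)
  show "uniformity = (INF e\<in>{0<..}. principal {(u, v :: l2_torus). dist u v < e})"
    by (rule uniformity_l2_torus_def)
  show "open U \<longleftrightarrow> (\<forall>x\<in>U. \<forall>\<^sub>F (x', y) in uniformity. x' = x \<longrightarrow> y \<in> U)" for U :: "l2_torus set"
    by (rule open_l2_torus_def)
  show "inner u v = inner v u"
    by transfer (simp add: mult.commute)
  show "inner (u + v) w = inner u w + inner v w"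
    by transfer (simp add: l2_rel_def distrib_right sq_integrable_mult)
  show "inner (a *\<^sub>R u) v = a * inner u v"
    by transfer (simp add: mult.assoc)
  show "0 \<le> inner u u"
    by transfer (auto intro!: integral_nonneg_AE)
  show "inner u u = 0 \<longleftrightarrow> u = 0"
  proof transfer
    fix f assume "l2_rel f f"
    then have f: "sq_integrable f" by (simp add: l2_rel_def)
    have "(\<integral>x. f x * f x \<partial>torus) = 0 \<longleftrightarrow> (AE x in torus. f x * f x = 0)"
      by (rule integral_nonneg_eq_0_iff_AE[OF sq_integrable_mult[OF f f]]) simp
    then show "(\<integral>x. f x * f x \<partial>torus) = 0 \<longleftrightarrow> l2_rel f (\<lambda>x. 0)"
      using f by (simp add: l2_rel_def sq_integrable_zero)
  qed
  show "norm u = sqrt (inner u u)" by (rule norm_l2_torus_def)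
qed

end


section \<open>The Sobolev space \<open>H\<^sup>1\<close> of the torus and its dual\<close>

text \<open>\<open>has_weak_deriv u w\<close>: the periodic distributional derivative of \<open>u\<close> is \<open>w\<close>.\<close>

lift_definition has_weak_deriv :: "l2_torus \<Rightarrow> l2_torus \<Rightarrow> bool" is
  "\<lambda>f h. \<forall>\<phi>. smooth_periodic \<phi> \<longrightarrow>
     (\<integral>x. f x * deriv \<phi> x \<partial>torus) = - (\<integral>x. h x * \<phi> x \<partial>torus)"
proof -
  have *: "(\<integral>x. f x * \<phi> x \<partial>torus) = (\<integral>x. f' x * \<phi> x \<partial>torus)"
    if "l2_rel f f'" "smooth_periodic \<phi>" for f f' \<phi>
  proof (rule integral_cong_AE)
    show "(\<lambda>x. f x * \<phi> x) \<in> borel_measurable torus" "(\<lambda>x. f' x * \<phi> x) \<in> borel_measurable torus"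
      using that sq_integrable_test[of \<phi>]
      by (intro borel_measurable_torus borel_measurable_times; simp add: l2_rel_def sq_integrable_def)+
    show "AE x in torus. f x * \<phi> x = f' x * \<phi> x"
      using that by (auto simp: l2_rel_def elim: eventually_mono)
  qed
  fix f f' h h' assume "l2_rel f f'" "l2_rel h h'"
  then show "(\<forall>\<phi>. smooth_periodic \<phi> \<longrightarrow>
      (\<integral>x. f x * deriv \<phi> x \<partial>torus) = - (\<integral>x. h x * \<phi> x \<partial>torus)) \<longleftrightarrow>
    (\<forall>\<phi>. smooth_periodic \<phi> \<longrightarrow>
      (\<integral>x. f' x * deriv \<phi> x \<partial>torus) = - (\<integral>x. h' x * \<phi> x \<partial>torus))"
    using *[of f f'] *[of h h'] smooth_periodic_deriv by auto
qed

lemma has_weak_deriv_zero: "has_weak_deriv 0 0"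
  by transfer simp

lemma has_weak_deriv_add:
  "has_weak_deriv u w \<Longrightarrow> has_weak_deriv u' w' \<Longrightarrow> has_weak_deriv (u + u') (w + w')"
  by transfer
     (auto simp: l2_rel_def distrib_right sq_integrable_mult sq_integrable_test smooth_periodic_deriv)

lemma has_weak_deriv_scaleR: "has_weak_deriv u w \<Longrightarrow> has_weak_deriv (c *\<^sub>R u) (c *\<^sub>R w)"
  by transfer (simp add: mult.assoc)

lemma has_weak_deriv_unique:
  assumes "has_weak_deriv u w" "has_weak_deriv u w'"
  shows "w = w'"
proof -
  have "has_weak_deriv (u + (-1) *\<^sub>R u) (w + (-1) *\<^sub>R w')"
    using assms by (intro has_weak_deriv_add has_weak_deriv_scaleR)
  then have "has_weak_deriv 0 (w - w')" by simp
  moreover have "v = 0" if "has_weak_deriv 0 v" for v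
    using that
  proof transfer
    fix f assume f: "l2_rel f f"
      and w: "\<forall>\<phi>. smooth_periodic \<phi> \<longrightarrow>
        (\<integral>x. 0 * deriv \<phi> x \<partial>torus) = - (\<integral>x. f x * \<phi> x \<partial>torus)"
    have "AE x in torus. f x = 0"
      by (rule torus_fundamental_lemma)
         (use f w in \<open>auto simp: l2_rel_def sq_integrable_integrable, auto simp: sq_integrable_def\<close>)
    then show "l2_rel f (\<lambda>x. 0)"
      using f by (simp add: l2_rel_def sq_integrable_zero)
  qed
  ultimately have "w - w' = 0" by blast
  then show ?thesis by simp
qed

typedef h1_torus = "{u. \<exists>w. has_weak_deriv u w}"
  morphisms l2_of_h1 h1_of_l2
  using has_weak_deriv_zero by blast

setup_lifting type_definition_h1_torus

definition weak_deriv :: "h1_torus \<Rightarrow> l2_torus" where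
  "weak_deriv u = (THE w. has_weak_deriv (l2_of_h1 u) w)"

lemma weak_deriv_eq: "has_weak_deriv (l2_of_h1 u) w \<Longrightarrow> weak_deriv u = w"
  unfolding weak_deriv_def using has_weak_deriv_unique by blast

lemma has_weak_deriv_weak_deriv: "has_weak_deriv (l2_of_h1 u) (weak_deriv u)"
  using l2_of_h1[of u] weak_deriv_eq by fastforce

instantiation h1_torus :: real_inner
begin

lift_definition zero_h1_torus :: h1_torus is 0
  using has_weak_deriv_zero by blast

lift_definition plus_h1_torus :: "h1_torus \<Rightarrow> h1_torus \<Rightarrow> h1_torus" is "(+)"
  using has_weak_deriv_add by blast

lift_definition scaleR_h1_torus :: "real \<Rightarrow> h1_torus \<Rightarrow> h1_torus" is scaleR
  using has_weak_deriv_scaleR by blast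

definition uminus_h1_torus :: "h1_torus \<Rightarrow> h1_torus" where
  "- (u :: h1_torus) = (-1) *\<^sub>R u"

definition minus_h1_torus :: "h1_torus \<Rightarrow> h1_torus \<Rightarrow> h1_torus" where
  "(u :: h1_torus) - v = u + (- v)"

definition inner_h1_torus :: "h1_torus \<Rightarrow> h1_torus \<Rightarrow> real" where
  "inner (u :: h1_torus) v = inner (l2_of_h1 u) (l2_of_h1 v) + inner (weak_deriv u) (weak_deriv v)"

definition norm_h1_torus :: "h1_torus \<Rightarrow> real" where
  "norm (u :: h1_torus) = sqrt (inner u u)"

definition sgn_h1_torus :: "h1_torus \<Rightarrow> h1_torus" where
  "sgn (u :: h1_torus) = inverse (norm u) *\<^sub>R u"

definition dist_h1_torus :: "h1_torus \<Rightarrow> h1_torus \<Rightarrow> real" where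
  "dist (u :: h1_torus) v = norm (u - v)"

definition uniformity_h1_torus :: "(h1_torus \<times> h1_torus) filter" where
  "uniformity = (INF e\<in>{0<..}. principal {(u, v :: h1_torus). dist u v < e})"

definition open_h1_torus :: "h1_torus set \<Rightarrow> bool" where
  "open (U :: h1_torus set) \<longleftrightarrow> (\<forall>x\<in>U. \<forall>\<^sub>F (x', y) in uniformity. x' = x \<longrightarrow> y \<in> U)"

lemma weak_deriv_add: "weak_deriv (u + v) = weak_deriv u + weak_deriv v"
  by (rule weak_deriv_eq)
     (simp add: plus_h1_torus.rep_eq has_weak_deriv_add has_weak_deriv_weak_deriv)

lemma weak_deriv_scaleR: "weak_deriv (c *\<^sub>R u) = c *\<^sub>R weak_deriv u"
  by (rule weak_deriv_eq)
     (simp add: scaleR_h1_torus.rep_eq has_weak_deriv_scaleR has_weak_deriv_weak_deriv)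

instance
proof
  fix u v w :: h1_torus and a b :: real
  show "u + v + w = u + (v + w)" by transfer simp
  show "u + v = v + u" by transfer simp
  show "0 + u = u" by transfer simp
  show "- u + u = 0" unfolding uminus_h1_torus_def by transfer simp
  show "u - v = u + - v" by (rule minus_h1_torus_def)
  show "a *\<^sub>R (u + v) = a *\<^sub>R u + a *\<^sub>R v" by transfer (simp add: scaleR_add_right)
  show "(a + b) *\<^sub>R u = a *\<^sub>R u + b *\<^sub>R u" by transfer (simp add: scaleR_add_left)
  show "a *\<^sub>R b *\<^sub>R u = (a * b) *\<^sub>R u" by transfer simp
  show "1 *\<^sub>R u = u" by transfer simp
  show "sgn u = inverse (norm u) *\<^sub>R u" by (rule sgn_h1_torus_def)
  show "dist u v = norm (u - v)" by (rule dist_h1_torus_def)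
  show "uniformity = (INF e\<in>{0<..}. principal {(u, v :: h1_torus). dist u v < e})"
    by (rule uniformity_h1_torus_def)
  show "open U \<longleftrightarrow> (\<forall>x\<in>U. \<forall>\<^sub>F (x', y) in uniformity. x' = x \<longrightarrow> y \<in> U)" for U :: "h1_torus set"
    by (rule open_h1_torus_def)
  show "inner u v = inner v u" by (simp add: inner_h1_torus_def inner_commute)
  show "inner (u + v) w = inner u w + inner v w"
    by (simp add: inner_h1_torus_def plus_h1_torus.rep_eq weak_deriv_add inner_add_left)
  show "inner (a *\<^sub>R u) v = a * inner u v"
    by (simp add: inner_h1_torus_def scaleR_h1_torus.rep_eq weak_deriv_scaleR distrib_left)
  show "0 \<le> inner u u" by (simp add: inner_h1_torus_def)
  show "inner u u = 0 \<longleftrightarrow> u = 0"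
  proof
    assume "inner u u = 0"
    then have "inner (l2_of_h1 u) (l2_of_h1 u) = 0"
      using inner_ge_zero[of "l2_of_h1 u"] inner_ge_zero[of "weak_deriv u"]
      unfolding inner_h1_torus_def by linarith
    then show "u = 0" by (simp add: l2_of_h1_inject[symmetric] zero_h1_torus.rep_eq)
  next
    assume "u = 0"
    then show "inner u u = 0"
      using weak_deriv_scaleR[of 0 u]
      by (simp add: inner_h1_torus_def zero_h1_torus.rep_eq scaleR_h1_torus_def
            h1_of_l2_inverse weak_deriv_eq has_weak_deriv_zero)
  qed
  show "norm u = sqrt (inner u u)" by (rule norm_h1_torus_def)
qed

end

lemma norm_l2_of_h1_le: "norm (l2_of_h1 u) \<le> norm u"
  by (simp add: norm_eq_sqrt_inner inner_h1_torus_def[of u u])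

lemma norm_weak_deriv_le: "norm (weak_deriv u) \<le> norm u"
  by (simp add: norm_eq_sqrt_inner inner_h1_torus_def[of u u])

lemma bounded_linear_l2_of_h1: "bounded_linear l2_of_h1"
  by (rule bounded_linear_intro[of _ 1])
     (simp_all add: plus_h1_torus.rep_eq scaleR_h1_torus.rep_eq norm_l2_of_h1_le)

lemma bounded_linear_weak_deriv: "bounded_linear weak_deriv"
  by (rule bounded_linear_intro[of _ 1])
     (simp_all add: weak_deriv_add weak_deriv_scaleR norm_weak_deriv_le)

text \<open>\<open>H\<^sup>-\<^sup>1\<close> is the dual of \<open>H\<^sup>1\<close>, with \<open>L\<^sup>2\<close> embedded through the \<open>L\<^sup>2\<close> inner product.\<close>

type_synonym hm1_torus = "h1_torus \<Rightarrow>\<^sub>L real"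

lift_definition hm1_of_l2 :: "l2_torus \<Rightarrow> hm1_torus" is "\<lambda>v \<phi>. inner v (l2_of_h1 \<phi>)"
  by (rule bounded_linear_compose[OF bounded_linear_inner_right bounded_linear_l2_of_h1])

text \<open>The distributional second derivative \<open>\<partial>\<^sub>x\<^sup>2 : H\<^sup>1 \<rightarrow> H\<^sup>-\<^sup>1\<close>.\<close>

lift_definition dxx :: "h1_torus \<Rightarrow> hm1_torus" is "\<lambda>u \<phi>. - inner (weak_deriv u) (weak_deriv \<phi>)"
  by (rule bounded_linear_minus[OF bounded_linear_compose[OF bounded_linear_inner_right bounded_linear_weak_deriv]])


section \<open>Nonlinear wave equation and the numerical scheme\<close>

text \<open>The class of the pointwise composition \<open>g \<circ> u\<close>.  For continuous \<open>g\<close> it does not depend on the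
  representative of \<open>u\<close> as soon as \<open>g \<circ> u\<close> is square integrable, which is the case for all \<open>u\<close> in
  \<open>H\<^sup>1\<close>.\<close>

definition l2_comp :: "(real \<Rightarrow> real) \<Rightarrow> l2_torus \<Rightarrow> l2_torus" where
  "l2_comp g u = abs_l2_torus (\<lambda>x. g (rep_l2_torus u x))"

definition l2_mult :: "l2_torus \<Rightarrow> l2_torus \<Rightarrow> l2_torus" where
  "l2_mult u v = abs_l2_torus (\<lambda>x. rep_l2_torus u x * rep_l2_torus v x)"

lemma l2_rel_rep:
  assumes "sq_integrable f"
  shows "l2_rel (rep_l2_torus (abs_l2_torus f)) f"
proof -
  have "l2_rel f f" using assms by (simp add: l2_rel_def)
  then show ?thesis
    using Quotient3_rep_abs[OF Quotient3_l2_torus] by blast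
qed

lemma l2_comp_abs:
  assumes f: "sq_integrable f" and g: "continuous_on UNIV g"
    and gf: "sq_integrable (\<lambda>x. g (f x))"
  shows "l2_comp g (abs_l2_torus f) = abs_l2_torus (\<lambda>x. g (f x))"
proof -
  let ?r = "rep_l2_torus (abs_l2_torus f)"
  have r: "sq_integrable ?r" "AE x in torus. ?r x = f x"
    using l2_rel_rep[OF f] by (auto simp: l2_rel_def)
  have m: "(\<lambda>x. g (?r x)) \<in> borel_measurable borel"
    using r(1) borel_measurable_continuous_onI[OF g]
    by (auto simp: sq_integrable_def intro: measurable_compose)
  have ae: "AE x in torus. g (?r x) = g (f x)"
    using r(2) by eventually_elim simp
  have "integrable torus (\<lambda>x. (g (f x))\<^sup>2)" using gf by (simp add: sq_integrable_def)
  then have "integrable torus (\<lambda>x. (g (?r x))\<^sup>2)"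
    by (rule integrable_cong_AE_imp)
       (use m ae in \<open>auto intro!: borel_measurable_torus elim: eventually_mono\<close>)
  then have "sq_integrable (\<lambda>x. g (?r x))"
    using m r(1) by (simp add: sq_integrable_def)
  then have "l2_rel (\<lambda>x. g (?r x)) (\<lambda>x. g (f x))"
    using gf ae by (simp add: l2_rel_def)
  then show ?thesis
    unfolding l2_comp_def by (rule Quotient3_rel_abs[OF Quotient3_l2_torus])
qed

lemma l2_mult_abs:
  assumes f: "sq_integrable f" and h: "sq_integrable h"
    and fh: "sq_integrable (\<lambda>x. f x * h x)"
  shows "l2_mult (abs_l2_torus f) (abs_l2_torus h) = abs_l2_torus (\<lambda>x. f x * h x)"
proof -
  let ?r = "rep_l2_torus (abs_l2_torus f)" and ?s = "rep_l2_torus (abs_l2_torus h)"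
  have r: "sq_integrable ?r" "AE x in torus. ?r x = f x"
    and s: "sq_integrable ?s" "AE x in torus. ?s x = h x"
    using l2_rel_rep[OF f] l2_rel_rep[OF h] by (auto simp: l2_rel_def)
  have m: "(\<lambda>x. ?r x * ?s x) \<in> borel_measurable borel"
    using r(1) s(1) by (auto simp: sq_integrable_def)
  have ae: "AE x in torus. ?r x * ?s x = f x * h x"
    using r(2) s(2) by eventually_elim simp
  have "integrable torus (\<lambda>x. (f x * h x)\<^sup>2)" using fh by (simp add: sq_integrable_def)
  then have "integrable torus (\<lambda>x. (?r x * ?s x)\<^sup>2)"
    by (rule integrable_cong_AE_imp)
       (use m ae in \<open>auto intro!: borel_measurable_torus elim: eventually_mono\<close>)
  then have "sq_integrable (\<lambda>x. ?r x * ?s x)"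
    using m r(1) s(1) by (simp add: sq_integrable_def)
  then have "l2_rel (\<lambda>x. ?r x * ?s x) (\<lambda>x. f x * h x)"
    using fh ae by (simp add: l2_rel_def)
  then show ?thesis
    unfolding l2_mult_def by (rule Quotient3_rel_abs[OF Quotient3_l2_torus])
qed

text \<open>Since \<open>H\<^sup>1\<close> is contained in \<open>L\<^sup>\<infinity>\<close>, \<open>g \<circ> u\<close> lies in \<open>L\<^sup>2\<close> for continuous \<open>g\<close>, in \<open>H\<^sup>1\<close> for
  continuously differentiable \<open>g\<close>, and \<open>(g' \<circ> u) v\<close> lies in \<open>L\<^sup>2\<close> for \<open>v\<close> in \<open>L\<^sup>2\<close>.\<close>

definition nonlin :: "(real \<Rightarrow> real) \<Rightarrow> h1_torus \<Rightarrow> l2_torus" where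
  "nonlin g u = l2_comp g (l2_of_h1 u)"

definition nonlin_h1 :: "(real \<Rightarrow> real) \<Rightarrow> h1_torus \<Rightarrow> h1_torus" where
  "nonlin_h1 g u = h1_of_l2 (nonlin g u)"

definition C2_fun :: "(real \<Rightarrow> real) \<Rightarrow> bool" where
  "C2_fun g \<longleftrightarrow> g differentiable_on UNIV \<and> deriv g differentiable_on UNIV \<and>
     continuous_on UNIV (deriv (deriv g))"

text \<open>\<open>wave_solution I G u v\<close>: on the time set \<open>I\<close>, \<open>(u, v)\<close> belongs to
  \<open>C(I, H\<^sup>1 \<times> L\<^sup>2) \<inter> C\<^sup>1(I, L\<^sup>2 \<times> H\<^sup>-\<^sup>1)\<close>, \<open>v\<close> is the time derivative of \<open>u\<close>, and
  \<open>\<partial>\<^sub>t\<^sup>2 u - \<partial>\<^sub>x\<^sup>2 u = G(u)\<close> holds in \<open>H\<^sup>-\<^sup>1\<close>.  Here \<open>w\<close> is the time derivative of \<open>(u, v)\<close>.\<close>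

definition wave_solution ::
  "real set \<Rightarrow> (h1_torus \<Rightarrow> l2_torus) \<Rightarrow> (real \<Rightarrow> h1_torus) \<Rightarrow> (real \<Rightarrow> l2_torus) \<Rightarrow> bool" where
  "wave_solution I G u v \<longleftrightarrow>
     continuous_on I (\<lambda>t. (u t, v t)) \<and>
     (\<exists>w :: real \<Rightarrow> l2_torus \<times> hm1_torus.
        continuous_on I w \<and>
        (\<forall>t\<in>I. ((\<lambda>s. (l2_of_h1 (u s), hm1_of_l2 (v s))) has_vector_derivative w t) (at t within I) \<and>
           fst (w t) = v t \<and>
           snd (w t) - dxx (u t) = hm1_of_l2 (G (u t))))"

text \<open>The group \<open>e\<^sup>t\<^sup>A\<close>, as the solution operator of the linear wave equation on the whole time axis.\<close>

definition wave_group :: "real \<Rightarrow> h1_torus \<times> l2_torus \<Rightarrow> h1_torus \<times> l2_torus" where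
  "wave_group t w = (THE z. \<exists>\<phi> \<psi>. wave_solution UNIV (\<lambda>_. 0) \<phi> \<psi> \<and>
     (\<phi> 0, \<psi> 0) = w \<and> (\<phi> t, \<psi> t) = z)"

text \<open>The operator \<open>\<phi>\<^sub>2(-2\<tau>A)\<close>; the integral is that of a continuous function with values in
  \<open>H\<^sup>1 \<times> L\<^sup>2\<close>.\<close>

definition phi2 :: "real \<Rightarrow> h1_torus \<times> l2_torus \<Rightarrow> h1_torus \<times> l2_torus" where
  "phi2 \<tau> w = (1 / \<tau>\<^sup>2) *\<^sub>R integral {0..\<tau>} (\<lambda>s. (\<tau> - s) *\<^sub>R wave_group (-2 * s) w)"

definition scheme_step ::
  "(real \<Rightarrow> real) \<Rightarrow> real \<Rightarrow> h1_torus \<times> l2_torus \<Rightarrow> h1_torus \<times> l2_torus" where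
  "scheme_step g \<tau> = (\<lambda>(u, v). wave_group \<tau>
     ((u, v) + \<tau> *\<^sub>R (0, nonlin g u)
      + \<tau>\<^sup>2 *\<^sub>R phi2 \<tau> (- nonlin_h1 g u, l2_mult (nonlin (deriv g) u) v)))"

definition scheme ::
  "(real \<Rightarrow> real) \<Rightarrow> real \<Rightarrow> h1_torus \<Rightarrow> l2_torus \<Rightarrow> nat \<Rightarrow> h1_torus \<times> l2_torus" where
  "scheme g \<tau> u0 v0 n = (scheme_step g \<tau> ^^ n) (u0, v0)"

definition Linf_norm :: "real \<Rightarrow> (real \<Rightarrow> 'a::real_normed_vector) \<Rightarrow> real" where
  "Linf_norm T f = real_of_ereal (esssup (restrict_space lborel {0..T}) (\<lambda>t. ereal (norm (f t))))"

end

theory Submission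
  imports Defs
begin

text \<open>The proof compares one step of the scheme with Duhamel's formula and sums the local errors.
  The source \<open>(0, g(u))\<close>, transported by the linear flow to a fixed time, has a time derivative that
  is the transport of \<open>H(u, v) = (-g(u), g'(u) v)\<close> (\<open>moving_source_derivative\<close>). Integrating by parts
  in Duhamel's integral therefore gives, at time \<open>t = n\<tau>\<close> and with \<open>U = (u, \<partial>\<^sub>tu)\<close>,

  \<open>U(t + \<tau>) = exp(\<tau>A) [U(t) + \<tau> (0, g(u(t))) + \<integral>\<^sub>0\<^sup>\<tau> (\<tau> - s) exp(-sA) H(U(t + s)) ds]\<close>

  (\<open>source_integral_expansion\<close>), and the scheme replaces \<open>H(U(t + s))\<close> by \<open>exp(-sA) H(U(t))\<close>. This is a
  good approximation because of a cancellation that is visible in the Riemann invariants \<open>p = v +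
  \<partial>\<^sub>xu\<close> and \<open>q = v - \<partial>\<^sub>xu\<close>: those of \<open>H(u, v)\<close> are \<open>g'(u) q\<close> and \<open>g'(u) p\<close>, with the two families exchanged
  (\<open>riem_source_rate\<close>). Since \<open>q\<close> is transported to the right and \<open>p\<close> to the left, \<open>H\<close> evolves to leading
  order by the backward linear flow.

  What remains is the change of \<open>g'(u)\<close> along the characteristics, and this is a null form: on a
  characteristic that carries \<open>q\<close>, \<open>u\<close> changes by half the integral of \<open>p\<close> over the interval of length
  \<open>2s\<close> that is swept over. By the Cauchy--Schwarz inequality the error in \<open>H\<close> is at most of order \<open>\<tau> +
  sqrt (\<tau> b\<^sub>n)\<close>, where \<open>b\<^sub>n = \<integral> q(x)\<^sup>2 \<integral>\<^sub>x\<^sup>x\<^sup>+\<^sup>2\<^sup>\<tau> p(y)\<^sup>2 dy dx\<close> is taken at time \<open>n\<tau>\<close>, or is the mirror image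
  of this (\<open>riem_source_rate_increment\<close>). For states of finite energy no single \<open>b\<^sub>n\<close> needs to be of
  order \<open>\<tau>\<close>, but the sum of all of them is bounded. Up to bounded functions, \<open>p\<close> and \<open>q\<close> are translates
  of their initial values in opposite directions, so that after a change of variables the inner
  integrals of successive steps extend over adjacent intervals and add up to one integral over an
  interval of length at most \<open>2T\<close> (\<open>sum_null_form_le\<close>). Hence \<open>sqrt \<tau>\<close> times the sum of the \<open>sqrt b\<^sub>n\<close> is
  bounded (\<open>sum_sqrt_null_form_le\<close>), and the local errors, each of which contains a further factor
  \<open>\<tau>\<^sup>2\<close>, add up to a multiple of \<open>\<tau>\<^sup>2\<close> (\<open>sum_local_error_le\<close>). One step is Lipschitz continuous with
  constant \<open>1 + \<Lambda> \<tau>\<close> on balls of the energy space (\<open>step_lipschitz\<close>), which turns the sum of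
  the local errors into a bound for the global error, as long as the numerical solution stays in a
  ball; for small \<open>\<tau>\<close> the bound itself keeps it there (\<open>global_error\<close>).

  The analysis that this rests on is developed from the translations \<open>f \<mapsto> f(\<cdot> + h)\<close>, which form a
  strongly continuous group of isometries of \<open>L\<^sup>2\<close> with the weak derivative as generator
  (\<open>has_weak_deriv_iff_shift_derivative\<close>). The mean of \<open>u\<close> and the two Riemann invariants are
  coordinates of the energy space in which the wave group consists of translations (\<open>wave_flow\<close>). A
  solution in the sense of \<open>H\<^sup>-\<^sup>1\<close> satisfies Duhamel's formula because its coordinates do so when
  paired with test functions that move along characteristics (\<open>duhamel_backward\<close>).\<close>

section \<open>Translations of the torus\<close>

lemma sets_torus: "A \<in> sets torus \<longleftrightarrow> A \<in> sets borel \<and> A \<subseteq> {0..<1}"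
  by (auto simp: sets_restrict_space_iff)

lemma measurable_torus_frac: "(\<lambda>x::real. frac (x + h)) \<in> torus \<rightarrow>\<^sub>M torus"
proof (rule measurable_restrict_space2)
  show "(\<lambda>x. frac (x + h)) \<in> torus \<rightarrow>\<^sub>M lborel"
    unfolding measurable_lborel1 frac_def by (rule borel_measurable_torus) measurable
qed (auto simp: frac_lt_1)

lemma emeasure_lborel_translate:
  assumes "B \<in> sets borel"
  shows "emeasure lborel ((+) c -` B) = emeasure lborel (B :: real set)"
proof -
  have "emeasure (distr lborel borel ((+) c)) B = emeasure lborel ((+) c -` B)"
    using assms by (subst emeasure_distr) auto
  then show ?thesis by (simp add: lborel_distr_plus)
qed

text \<open>On the fundamental domain a translation exchanges two intervals and moves each of them
  rigidly, so that it preserves the measure.\<close>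

lemma distr_torus_frac: "distr torus torus (\<lambda>x. frac (x + h)) = torus"
proof (rule measure_eqI)
  fix A assume "A \<in> sets (distr torus torus (\<lambda>x. frac (x + h)))"
  then have A: "A \<in> sets borel" "A \<subseteq> {0..<1}" "A \<in> sets torus" by (auto simp: sets_torus)
  define k where "k = frac h"
  have k: "0 \<le> k" "k < 1" by (auto simp: k_def frac_lt_1)
  let ?V = "(\<lambda>x. frac (x + h)) -` A \<inter> {0..<1}"
  let ?B1 = "A \<inter> {k..<1}" and ?B2 = "A \<inter> {0..<k}"
  have fr: "frac (x + h) = (if x + k < 1 then x + k else x + k - 1)" if "x \<in> {0..<1}" for x
    using that frac_add[of x h] k frac_eq[of x] unfolding k_def[symmetric] by auto
  have V: "?V = ((+) k -` ?B1) \<union> ((+) (k - 1) -` ?B2)"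
  proof (intro set_eqI iffI)
    fix x assume "x \<in> ?V"
    then show "x \<in> ((+) k -` ?B1) \<union> ((+) (k - 1) -` ?B2)"
      using fr[of x] by (auto split: if_splits simp: algebra_simps)
  next
    fix x assume x: "x \<in> ((+) k -` ?B1) \<union> ((+) (k - 1) -` ?B2)"
    then have "x \<in> {0..<1}" using k by auto
    with x fr[OF this] show "x \<in> ?V" using k by (auto simp: algebra_simps)
  qed
  have "emeasure torus ?V = emeasure lborel ?V"
    by (rule emeasure_restrict_space) auto
  also have "\<dots> = emeasure lborel ((+) k -` ?B1) + emeasure lborel ((+) (k - 1) -` ?B2)"
    unfolding V using A k by (intro plus_emeasure[symmetric]) (auto intro!: measurable_sets_borel)
  also have "\<dots> = emeasure lborel ?B1 + emeasure lborel ?B2"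
    using A by (simp only: emeasure_lborel_translate sets.Int atLeastLessThan_borel)
  also have "\<dots> = emeasure lborel (?B1 \<union> ?B2)"
    using A by (intro plus_emeasure) auto
  also have "?B1 \<union> ?B2 = A" using A k by auto
  also have "emeasure lborel A = emeasure torus A"
    using A by (intro emeasure_restrict_space[symmetric]) auto
  finally have "emeasure torus ?V = emeasure torus A" .
  then show "emeasure (distr torus torus (\<lambda>x. frac (x + h))) A = emeasure torus A"
    using A by (simp add: emeasure_distr[OF measurable_torus_frac])
qed simp

lemma periodic_add_int:
  fixes f :: "real \<Rightarrow> 'a"
  assumes "\<And>x. f (x + 1) = f x"
  shows "f (x + of_int n) = f x"
proof -
  have n: "f (x + of_nat m) = f x" for m x
  proof (induction m)
    case (Suc m)
    then show ?case using assms[of "x + of_nat m"] by (simp add: add_ac)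
  qed simp
  show ?thesis
  proof (cases n)
    case (neg m)
    then show ?thesis using n[of "x + of_int n" "Suc m"] by simp
  qed (use n in simp)
qed

lemma periodic_frac:
  fixes f :: "real \<Rightarrow> 'a"
  assumes "\<And>x. f (x + 1) = f x"
  shows "f (frac x) = f x"
  using periodic_add_int[of f x "- \<lfloor>x\<rfloor>", OF assms] by (simp add: frac_def)

lemma integral_torus_shift:
  fixes f :: "real \<Rightarrow> real"
  assumes "f \<in> borel_measurable borel" and "\<And>x. f (x + 1) = f x"
  shows "(\<integral>x. f (x + h) \<partial>torus) = (\<integral>x. f x \<partial>torus)"
proof -
  have "(\<integral>x. f x \<partial>torus) = (\<integral>x. f x \<partial>distr torus torus (\<lambda>x. frac (x + h)))"
    by (simp add: distr_torus_frac)
  also have "\<dots> = (\<integral>x. f (frac (x + h)) \<partial>torus)"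
    by (rule integral_distr[OF measurable_torus_frac borel_measurable_torus[OF assms(1)]])
  finally show ?thesis by (simp add: periodic_frac[of f, OF assms(2)])
qed

lemma integrable_torus_shift:
  fixes f :: "real \<Rightarrow> real"
  assumes "f \<in> borel_measurable borel" and "\<And>x. f (x + 1) = f x" and "integrable torus f"
  shows "integrable torus (\<lambda>x. f (x + h))"
proof -
  have "integrable (distr torus torus (\<lambda>x. frac (x + h))) f"
    by (simp add: distr_torus_frac assms(3))
  then have "integrable torus (\<lambda>x. f (frac (x + h)))"
    by (subst (asm) integrable_distr_eq[OF measurable_torus_frac borel_measurable_torus[OF assms(1)]])
  then show ?thesis by (simp add: periodic_frac[of f, OF assms(2)])
qed

lemma AE_torus_shift:
  assumes "Measurable.pred borel P" and "\<And>x. P (x + 1) = P x" and "AE x in torus. P x"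
  shows "AE x in torus. P (x + h)"
proof -
  have *: "AE x in distr torus torus (\<lambda>x. frac (x + h)). P x"
    unfolding distr_torus_frac by (rule assms(3))
  have "AE x in torus. P (frac (x + h))" using *
  proof -
    have "{x \<in> space torus. P x} = {x. P x} \<inter> {0..<1}" by auto
    then have "{x \<in> space torus. P x} \<in> sets torus"
      using assms(1) by (auto simp: sets_torus)
    from AE_distr_iff[OF measurable_torus_frac this] show ?thesis using * by blast
  qed
  then show ?thesis by (simp add: periodic_frac[of P, OF assms(2)])
qed

text \<open>The exceptional set of a periodic property is the union of the integer translates of its part
  in the fundamental domain.\<close>

lemma AE_torus_imp_lborel:
  assumes "Measurable.pred borel P" and "\<And>x. P (x + 1) = P x" and "AE x in torus. P x"
  shows "AE x in lborel. P (x :: real)"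
proof -
  have "{x. \<not> P x} \<inter> {0..<1} \<in> null_sets lborel"
  proof -
    have "AE x in lborel. x \<notin> {x. \<not> P x} \<inter> {0..<1}"
      using assms(3) by (subst (asm) AE_torus_iff) auto
    moreover have "{x. \<not> P x} \<inter> {0..<1} \<in> sets lborel"
      using assms(1) by (auto simp: pred_def Collect_neg_eq)
    ultimately show ?thesis by (subst (asm) AE_iff_null_sets[symmetric]) auto
  qed
  note N = this
  have "(\<Union>n. (+) (real_of_int n) -` ({x. \<not> P x} \<inter> {0..<1})) \<in> null_sets lborel"
  proof (rule null_sets_UN)
    fix n :: int
    have "{x. \<not> P x} \<inter> {0..<1} \<in> sets borel" using N by (auto simp: null_sets_def)
    then show "(+) (real_of_int n) -` ({x. \<not> P x} \<inter> {0..<1}) \<in> null_sets lborel"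
      using N emeasure_lborel_translate[of "{x. \<not> P x} \<inter> {0..<1}" "real_of_int n"]
      by (auto simp: null_sets_def simp del: vimage_Int intro: measurable_sets_borel[of _ borel])
  qed
  then show ?thesis
  proof (rule AE_I')
    show "{x \<in> space lborel. \<not> P x} \<subseteq> (\<Union>n. (+) (real_of_int n) -` ({x. \<not> P x} \<inter> {0..<1}))"
    proof
      fix x assume "x \<in> {x \<in> space lborel. \<not> P x}"
      moreover have "of_int (- \<lfloor>x\<rfloor>) + x = frac x" by (simp add: frac_def)
      ultimately have "x \<in> (+) (real_of_int (- \<lfloor>x\<rfloor>)) -` ({x. \<not> P x} \<inter> {0..<1})"
        using periodic_frac[of P x, OF assms(2)] frac_lt_1[of x] by simp
      then show "x \<in> (\<Union>n. (+) (real_of_int n) -` ({x. \<not> P x} \<inter> {0..<1}))" by blast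
    qed
  qed
qed

section \<open>Completeness of \<open>L\<^sup>2\<close>\<close>

abbreviation (input) rep :: "l2_torus \<Rightarrow> real \<Rightarrow> real" where "rep \<equiv> rep_l2_torus"

abbreviation (input) cls :: "(real \<Rightarrow> real) \<Rightarrow> l2_torus" where "cls \<equiv> abs_l2_torus"

lemma sq_integrable_shift:
  assumes "sq_integrable f"
  shows "sq_integrable (\<lambda>x. f (x + h))"
proof -
  have "f (x + 1 + h) = f (x + h)" for x
    using assms unfolding sq_integrable_def by (metis add.commute add.left_commute)
  then show ?thesis
    using assms integrable_torus_shift[of "\<lambda>x. (f x)\<^sup>2" h]
    unfolding sq_integrable_def by auto
qed

lemma sq_integrable_minus: "sq_integrable f \<Longrightarrow> sq_integrable g \<Longrightarrow> sq_integrable (\<lambda>x. f x - g x)"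
  using sq_integrable_add[of f "\<lambda>x. -1 * g x"] sq_integrable_scale[of g "-1"] by simp

lemma sq_integrable_rep: "sq_integrable (rep u)"
proof -
  have "l2_rel (rep u) (rep u)"
    using Quotient3_rep_reflp[OF Quotient3_l2_torus] .
  then show ?thesis by (simp add: l2_rel_def)
qed

lemma abs_rep_l2: "cls (rep u) = u"
  using Quotient3_abs_rep[OF Quotient3_l2_torus] .

lemma rep_abs_l2: "sq_integrable f \<Longrightarrow> AE x in torus. rep (cls f) x = f x"
  using l2_rel_rep by (auto simp: l2_rel_def)

lemma abs_l2_eq_iff:
  assumes "sq_integrable f" "sq_integrable g"
  shows "cls f = cls g \<longleftrightarrow> (AE x in torus. f x = g x)"
  using Quotient3_rel[OF Quotient3_l2_torus, of f g] assms by (auto simp: l2_rel_def)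

lemma l2_eq_iff: "u = v \<longleftrightarrow> (AE x in torus. rep u x = rep v x)"
  using abs_l2_eq_iff[OF sq_integrable_rep sq_integrable_rep, of u v] by (simp add: abs_rep_l2)

lemma rep_l2_add: "AE x in torus. rep (u + v) x = rep u x + rep v x"
proof -
  have "u + v = cls (\<lambda>x. rep u x + rep v x)"
    using plus_l2_torus.abs_eq[of "rep u" "rep v"]
    by (simp add: l2_rel_def sq_integrable_rep abs_rep_l2)
  then show ?thesis
    using rep_abs_l2 sq_integrable_add[OF sq_integrable_rep sq_integrable_rep] by simp
qed

lemma rep_l2_scaleR: "AE x in torus. rep (c *\<^sub>R u) x = c * rep u x"
proof -
  have "c *\<^sub>R u = cls (\<lambda>x. c * rep u x)"
    using scaleR_l2_torus.abs_eq[of "rep u" c]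
    by (simp add: l2_rel_def sq_integrable_rep abs_rep_l2)
  then show ?thesis
    using rep_abs_l2 sq_integrable_scale[OF sq_integrable_rep] by simp
qed

lemma rep_l2_minus: "AE x in torus. rep (u - v) x = rep u x - rep v x"
proof -
  have "AE x in torus. rep (u + (-1) *\<^sub>R v) x = rep u x - rep v x"
    using rep_l2_add[of u "(-1) *\<^sub>R v"] rep_l2_scaleR[of "-1" v] by eventually_elim simp
  then show ?thesis by simp
qed

lemma inner_l2_rep: "inner u v = (\<integral>x. rep u x * rep v x \<partial>torus)"
  using inner_l2_torus.abs_eq[of "rep u" "rep v"]
  by (simp add: l2_rel_def sq_integrable_rep abs_rep_l2)

lemma inner_l2_abs:
  "sq_integrable f \<Longrightarrow> sq_integrable g \<Longrightarrow>
    inner (cls f) (cls g) = (\<integral>x. f x * g x \<partial>torus)"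
  by (rule inner_l2_torus.abs_eq) (simp_all add: l2_rel_def)

lemma norm_l2_rep: "(norm (u::l2_torus))\<^sup>2 = (\<integral>x. (rep u x)\<^sup>2 \<partial>torus)"
  unfolding power2_norm_eq_inner inner_l2_rep by (simp add: power2_eq_square)

lemma norm_l2_abs: "sq_integrable f \<Longrightarrow> (norm (cls f))\<^sup>2 = (\<integral>x. (f x)\<^sup>2 \<partial>torus)"
  unfolding power2_norm_eq_inner by (simp add: inner_l2_abs power2_eq_square)

lemma abs_l2_add:
  "sq_integrable f \<Longrightarrow> sq_integrable g \<Longrightarrow>
    cls f + cls g = cls (\<lambda>x. f x + g x)"
  by (rule plus_l2_torus.abs_eq) (simp_all add: l2_rel_def)

lemma abs_l2_scaleR: "sq_integrable f \<Longrightarrow> c *\<^sub>R cls f = cls (\<lambda>x. c * f x)"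
  by (rule scaleR_l2_torus.abs_eq) (simp add: l2_rel_def)

lemma abs_l2_minus:
  assumes "sq_integrable f" "sq_integrable g"
  shows "cls f - cls g = cls (\<lambda>x. f x - g x)"
proof -
  have "cls f - cls g = cls f + (-1) *\<^sub>R cls g" by simp
  also have "\<dots> = cls (\<lambda>x. f x + (-1) * g x)"
    unfolding abs_l2_scaleR[OF assms(2)]
    by (rule abs_l2_add[OF assms(1) sq_integrable_scale[OF assms(2)]])
  finally show ?thesis by simp
qed

lemma borel_measurable_rep [measurable]: "rep u \<in> borel_measurable borel"
  using sq_integrable_rep[of u] by (simp add: sq_integrable_def)

lemma rep_periodic: "rep u (x + 1) = rep u x"
  using sq_integrable_rep[of u] by (simp add: sq_integrable_def)

lemma integrable_rep: "integrable torus (rep u)"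
  by (rule sq_integrable_integrable[OF sq_integrable_rep])

lemma integrable_rep_sq: "integrable torus (\<lambda>x. (rep v x)\<^sup>2)"
  using sq_integrable_rep by (simp add: sq_integrable_def)

lemma sq_integrable_abs: "sq_integrable f \<Longrightarrow> sq_integrable (\<lambda>x. \<bar>f x\<bar>)"
  by (auto simp: sq_integrable_def)

lemma norm_one_l2: "norm (cls (\<lambda>x. 1)) = 1"
proof -
  have "(norm (cls (\<lambda>x. 1)))\<^sup>2 = measure torus (space torus)"
    by (simp add: norm_l2_abs[OF sq_integrable_const])
  also have "\<dots> = 1" by (subst measure_restrict_space) auto
  finally show ?thesis by (simp add: power2_eq_1_iff) (smt (verit) norm_ge_zero)
qed

lemma integral_abs_le_norm: "(\<integral>x. \<bar>rep u x\<bar> \<partial>torus) \<le> norm u"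
proof -
  let ?a = "cls (\<lambda>x. \<bar>rep u x\<bar>)"
  note s = sq_integrable_abs[OF sq_integrable_rep[of u]]
  have "(\<integral>x. \<bar>rep u x\<bar> \<partial>torus) = inner ?a (cls (\<lambda>x. 1))"
    using s by (simp add: inner_l2_abs sq_integrable_const)
  also have "\<dots> \<le> norm ?a * norm (cls (\<lambda>x. 1))" by (rule norm_cauchy_schwarz)
  also have "\<dots> = norm u"
  proof -
    have "(norm ?a)\<^sup>2 = (norm u)\<^sup>2" unfolding norm_l2_abs[OF s] by (simp add: norm_l2_rep)
    then show ?thesis by (simp add: norm_one_l2)
  qed
  finally show ?thesis .
qed

lemma norm_le_of_AE:
  assumes "sq_integrable f" "sq_integrable g" "AE x in torus. \<bar>f x\<bar> \<le> \<bar>g x\<bar>"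
  shows "norm (cls f) \<le> norm (cls g)"
proof (rule power2_le_imp_le)
  show "(norm (cls f))\<^sup>2 \<le> (norm (cls g))\<^sup>2"
    unfolding norm_l2_abs[OF assms(1)] norm_l2_abs[OF assms(2)]
    using assms by (intro integral_mono_AE) (auto simp: sq_integrable_def abs_le_square_iff)
qed simp

text \<open>On a space of measure one the \<open>L\<^sup>1\<close> norm is at most the \<open>L\<^sup>2\<close> norm, so that the sum of the absolute
  values has finite integral and is finite almost everywhere.\<close>

lemma summable_norm_AE_summable:
  fixes d :: "nat \<Rightarrow> l2_torus"
  assumes "summable (\<lambda>n. norm (d n))"
  shows "AE x in torus. summable (\<lambda>n. rep (d n) x)"
proof -
  have "(\<integral>\<^sup>+x. (\<Sum>n. ennreal \<bar>rep (d n) x\<bar>) \<partial>torus) = (\<Sum>n. \<integral>\<^sup>+x. ennreal \<bar>rep (d n) x\<bar> \<partial>torus)"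
    by (rule nn_integral_suminf) (auto intro!: borel_measurable_torus)
  also have "\<dots> \<le> (\<Sum>n. ennreal (norm (d n)))"
  proof (rule suminf_le)
    fix n
    have "(\<integral>\<^sup>+x. ennreal \<bar>rep (d n) x\<bar> \<partial>torus) = ennreal (\<integral>x. \<bar>rep (d n) x\<bar> \<partial>torus)"
      by (rule nn_integral_eq_integral) (use integrable_rep in auto)
    also have "\<dots> \<le> ennreal (norm (d n))" by (intro ennreal_leI integral_abs_le_norm)
    finally show "(\<integral>\<^sup>+x. ennreal \<bar>rep (d n) x\<bar> \<partial>torus) \<le> ennreal (norm (d n))" .
  qed auto
  also have "\<dots> = ennreal (\<Sum>n. norm (d n))"
    by (rule suminf_ennreal_eq) (use assms in \<open>auto intro: summable_sums\<close>)
  also have "\<dots> < \<infinity>" by simp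
  finally have "AE x in torus. (\<Sum>n. ennreal \<bar>rep (d n) x\<bar>) \<noteq> \<infinity>"
    by (intro nn_integral_PInf_AE) (auto intro!: borel_measurable_torus)
  then show ?thesis
  proof eventually_elim
    case (elim x)
    then have "summable (\<lambda>n. \<bar>rep (d n) x\<bar>)"
      by (intro summable_suminf_not_top) auto
    then show ?case by (rule summable_rabs_cancel)
  qed
qed

text \<open>The limit \<open>f\<close> is a function and not a class because it is constructed pointwise: that it is
  square integrable is part of what has to be shown.\<close>

lemma l2_fatou:
  fixes X :: "nat \<Rightarrow> l2_torus"
  assumes f: "f \<in> borel_measurable borel" "\<And>x. f (x + 1) = f x"
    and lim: "AE x in torus. (\<lambda>n. rep (X n) x) \<longlonglongrightarrow> f x"
    and bd: "\<And>n. n \<ge> N \<Longrightarrow> norm (X n - Y) \<le> e"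
  shows "sq_integrable f \<and> norm (cls f - Y) \<le> e"
proof -
  let ?y = "rep Y"
  have e: "0 \<le> e" using bd[of N] norm_ge_zero order_trans by blast
  have AEd: "AE x in torus. \<forall>n. rep (X n - Y) x = rep (X n) x - ?y x"
    by (simp add: AE_all_countable rep_l2_minus)
  have "(\<integral>\<^sup>+x. ennreal ((f x - ?y x)\<^sup>2) \<partial>torus) = (\<integral>\<^sup>+x. liminf (\<lambda>n. ennreal ((rep (X n - Y) x)\<^sup>2)) \<partial>torus)"
  proof (rule nn_integral_cong_AE)
    show "AE x in torus. ennreal ((f x - ?y x)\<^sup>2) = liminf (\<lambda>n. ennreal ((rep (X n - Y) x)\<^sup>2))"
      using lim AEd
    proof eventually_elim
      case (elim x)
      have "(\<lambda>n. ennreal ((rep (X n - Y) x)\<^sup>2)) \<longlonglongrightarrow> ennreal ((f x - ?y x)\<^sup>2)"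
        using elim by (auto intro!: tendsto_intros)
      from lim_imp_Liminf[OF sequentially_bot this] show ?case by simp
    qed
  qed
  also have "\<dots> \<le> liminf (\<lambda>n. \<integral>\<^sup>+x. ennreal ((rep (X n - Y) x)\<^sup>2) \<partial>torus)"
    by (rule nn_integral_liminf) (auto intro!: borel_measurable_torus)
  also have "\<dots> \<le> ennreal (e\<^sup>2)"
  proof (rule Liminf_le)
    have "(\<integral>\<^sup>+x. ennreal ((rep (X n - Y) x)\<^sup>2) \<partial>torus) \<le> ennreal (e\<^sup>2)" if "n \<ge> N" for n
      using bd[OF that] by (subst nn_integral_eq_integral) (auto simp: integrable_rep_sq norm_l2_rep[symmetric] intro!: ennreal_leI power_mono)
    then show "\<forall>\<^sub>F n in sequentially. (\<integral>\<^sup>+x. ennreal ((rep (X n - Y) x)\<^sup>2) \<partial>torus) \<le> ennreal (e\<^sup>2)"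
      by (auto simp: eventually_sequentially)
  qed simp
  finally have fin: "(\<integral>\<^sup>+x. ennreal ((f x - ?y x)\<^sup>2) \<partial>torus) \<le> ennreal (e\<^sup>2)" .
  have sd: "sq_integrable (\<lambda>x. f x - ?y x)"
    unfolding sq_integrable_def
  proof (intro conjI allI)
    show "integrable torus (\<lambda>x. (f x - ?y x)\<^sup>2)"
      using fin f(1) by (intro integrableI_bounded) (auto intro!: borel_measurable_torus simp: le_less_trans)
  qed (use f rep_periodic in auto)
  then have sf: "sq_integrable f"
    using sq_integrable_add[OF sd sq_integrable_rep[of Y]] by simp
  have "(norm (cls f - Y))\<^sup>2 = (\<integral>x. (f x - ?y x)\<^sup>2 \<partial>torus)"
    using abs_l2_minus[OF sf sq_integrable_rep[of Y]] norm_l2_abs[OF sd] by (simp add: abs_rep_l2)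
  also have "\<dots> = enn2real (\<integral>\<^sup>+x. ennreal ((f x - ?y x)\<^sup>2) \<partial>torus)"
    using sd by (intro integral_eq_nn_integral) (auto simp: sq_integrable_def)
  also have "\<dots> \<le> e\<^sup>2"
    using fin enn2real_mono[OF fin] by simp
  finally show ?thesis using sf e power2_le_imp_le by blast
qed

text \<open>Riesz--Fischer: a rapidly Cauchy subsequence converges almost everywhere, because its
  increments are summable in \<open>L\<^sup>1\<close>, and Fatou's lemma turns the pointwise limit into a limit in norm.\<close>

instance l2_torus :: banach
proof
  fix X :: "nat \<Rightarrow> l2_torus" assume X: "Cauchy X"
  have "\<exists>N. \<forall>m\<ge>N. \<forall>n\<ge>N. norm (X m - X n) < (1/2) ^ k" for k :: nat
    using X by (auto simp: Cauchy_iff)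
  then obtain N where N: "\<And>k m n. m \<ge> N k \<Longrightarrow> n \<ge> N k \<Longrightarrow> norm (X m - X n) < (1/2) ^ k"
    by metis
  define r where "r k = (\<Sum>i\<le>k. N i) + k" for k
  have rN: "r k \<ge> N k" for k
  proof -
    have "N k \<le> (\<Sum>i\<le>k. N i)" by (rule member_le_sum) auto
    then show ?thesis by (simp add: r_def)
  qed
  have rS: "strict_mono r" by (rule strict_monoI_Suc) (simp add: r_def)
  define d where "d k = X (r (Suc k)) - X (r k)" for k
  have "norm (d k) \<le> (1/2) ^ k" for k
    unfolding d_def
    using N[of k "r (Suc k)" "r k"] rN[of k] strict_monoD[OF rS, of k "Suc k"] by simp
  then have "summable (\<lambda>k. norm (d k))"
    by (intro summable_comparison_test[OF _ summable_geometric[of "1/2::real"]]) auto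
  from summable_norm_AE_summable[OF this]
  have S: "AE x in torus. summable (\<lambda>n. rep (d n) x)" .
  have D: "AE x in torus. \<forall>k. rep (d k) x = rep (X (r (Suc k))) x - rep (X (r k)) x"
    unfolding d_def by (simp add: AE_all_countable rep_l2_minus)
  \<comment> \<open>Where the limit does not exist, \<open>lim\<close> still depends on the sequence only, so that \<open>f\<close> is
    periodic at every point.\<close>
  define f where "f x = lim (\<lambda>k. rep (X (r k)) x)" for x
  have fm: "f \<in> borel_measurable borel" unfolding f_def by measurable
  have fp: "f (x + 1) = f x" for x by (simp add: f_def rep_periodic)
  have L: "AE x in torus. (\<lambda>k. rep (X (r k)) x) \<longlonglongrightarrow> f x"
    using S D
  proof eventually_elim
    case (elim x)
    have "(\<Sum>k<n. rep (d k) x) = rep (X (r n)) x - rep (X (r 0)) x" for n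
      using elim(2) by (induction n) auto
    moreover have "convergent (\<lambda>n. \<Sum>k<n. rep (d k) x)"
      using elim(1) by (simp add: summable_iff_convergent)
    ultimately have "convergent (\<lambda>n. rep (X (r n)) x - rep (X (r 0)) x)" by simp
    then have "convergent (\<lambda>n. rep (X (r n)) x)"
      using convergent_add_const_right_iff[of "\<lambda>n. rep (X (r n)) x" "- rep (X (r 0)) x"] by simp
    then show ?case by (simp add: f_def convergent_LIMSEQ_iff)
  qed
  have "X \<longlonglongrightarrow> cls f"
  proof (rule LIMSEQ_I)
    fix e :: real assume "0 < e"
    then obtain M where M: "\<And>m n. m \<ge> M \<Longrightarrow> n \<ge> M \<Longrightarrow> norm (X m - X n) < e / 2"
      using X by (metis Cauchy_iff half_gt_zero)
    have "norm (X n - cls f) < e" if n: "n \<ge> M" for n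
    proof -
      have "norm (X (r k) - X n) \<le> e / 2" if "k \<ge> M" for k
        using M[of "r k" n] n seq_suble[OF rS, of k] that by fastforce
      from l2_fatou[OF fm fp L this]
      have "norm (cls f - X n) \<le> e / 2" by blast
      then show ?thesis using \<open>0 < e\<close> by (simp add: norm_minus_commute)
    qed
    then show "\<exists>no. \<forall>n\<ge>no. norm (X n - cls f) < e" by blast
  qed
  then show "convergent X" by (rule convergentI)
qed

section \<open>Calculus of vector valued functions of a real variable\<close>

lemma has_vector_derivative_quotient:
  "(f has_vector_derivative D) (at x within S) \<longleftrightarrow>
     ((\<lambda>y. (f y - f x) /\<^sub>R (y - x)) \<longlongrightarrow> D) (at x within S)"
proof -
  have *: "norm (f y - f x - (y - x) *\<^sub>R D) / norm (y - x) = norm ((f y - f x) /\<^sub>R (y - x) - D)"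
    if "y \<noteq> x" for y
  proof -
    have "(f y - f x) /\<^sub>R (y - x) - D = (f y - f x - (y - x) *\<^sub>R D) /\<^sub>R (y - x)"
      using that by (simp add: scaleR_diff_right)
    then show ?thesis by (simp add: divide_inverse mult.commute)
  qed
  have "(f has_vector_derivative D) (at x within S) \<longleftrightarrow>
      ((\<lambda>y. norm (f y - f x - (y - x) *\<^sub>R D) / norm (y - x)) \<longlongrightarrow> 0) (at x within S)"
    unfolding has_vector_derivative_def has_derivative_iff_norm
    by (auto simp: bounded_linear_scaleR_left)
  also have "\<dots> \<longleftrightarrow> ((\<lambda>y. norm ((f y - f x) /\<^sub>R (y - x) - D)) \<longlongrightarrow> 0) (at x within S)"
    by (rule Lim_cong_within[OF refl refl refl]) (rule *)
  also have "\<dots> \<longleftrightarrow> ((\<lambda>y. (f y - f x) /\<^sub>R (y - x)) \<longlongrightarrow> D) (at x within S)"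
    by (simp add: tendsto_norm_zero_iff LIM_zero_iff)
  finally show ?thesis .
qed

text \<open>A product rule in which only one factor is differentiated, against a factor that is merely
  continuous.\<close>

lemma (in bounded_bilinear) has_vector_derivative_increment:
  assumes "(f has_vector_derivative D) (at x within S)" "(g \<longlongrightarrow> g x) (at x within S)"
  shows "((\<lambda>y. prod (f y - f x) (g y)) has_vector_derivative prod D (g x)) (at x within S)"
proof -
  have "((\<lambda>y. prod ((f y - f x) /\<^sub>R (y - x)) (g y)) \<longlongrightarrow> prod D (g x)) (at x within S)"
    using assms by (intro tendsto) (simp_all add: has_vector_derivative_quotient)
  then show ?thesis
    by (simp add: has_vector_derivative_quotient scaleR_left diff_left zero_left)
qed

text \<open>Increments are prescribed for \<open>a \<le> b\<close> only, since the integral over \<open>{a..b}\<close> vanishes otherwise;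
  the derivative at \<open>t\<close> is therefore taken along increments from \<open>t - 1\<close>.\<close>

lemma has_vector_derivative_of_integral:
  fixes f :: "real \<Rightarrow> 'a::banach"
  assumes "continuous_on UNIV w" and "\<And>a b. a \<le> b \<Longrightarrow> f b - f a = integral {a..b} w"
  shows "(f has_vector_derivative w t) (at t)"
proof -
  have "((\<lambda>u. integral {t - 1..u} w) has_vector_derivative w t) (at t within {t - 1..t + 1})"
    using assms(1) by (intro integral_has_vector_derivative) (auto intro: continuous_on_subset)
  then have "((\<lambda>u. f (t - 1) + integral {t - 1..u} w) has_vector_derivative w t) (at t within {t - 1..t + 1})"
    by (auto intro!: derivative_eq_intros)
  then have "(f has_vector_derivative w t) (at t within {t - 1..t + 1})"
    by (rule has_vector_derivative_transform[rotated 2]) (auto simp: assms(2)[symmetric])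
  then have "(f has_vector_derivative w t) (at t within {t - 1<..<t + 1})"
    by (rule has_vector_derivative_within_subset) auto
  then show ?thesis
    by (subst (asm) has_vector_derivative_within_open) auto
qed

lemma integral_bounded_linear_image:
  fixes f :: "real \<Rightarrow> 'a::banach"
  assumes "continuous_on {a..b} f" "bounded_linear L"
  shows "L (integral {a..b} f) = integral {a..b} (\<lambda>s. L (f s))"
  using integral_linear[OF integrable_continuous_real[OF assms(1)] assms(2)] by (simp add: o_def)

text \<open>A minimising sequence for the distance from a point to the subspace is Cauchy by the
  parallelogram law, and the difference between the point and its limit is orthogonal to the
  subspace, hence zero.\<close>

lemma dense_of_trivial_complement:
  fixes V :: "'a::{real_inner, banach} set"
  assumes V: "subspace V" and triv: "\<And>z. (\<And>y. y \<in> V \<Longrightarrow> inner z y = 0) \<Longrightarrow> z = 0"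
  shows "closure V = UNIV"
proof -
  have "x \<in> closure V" for x
  proof -
    define d where "d = infdist x V"
    have Vne: "V \<noteq> {}" using subspace_0[OF V] by auto
    have d0: "0 \<le> d" by (simp add: d_def infdist_nonneg)
    have dle: "d \<le> norm (x - y)" if "y \<in> V" for y
      using infdist_le[OF that, of x] by (simp add: d_def dist_norm)
    have "\<exists>y\<in>V. norm (x - y) < d + inverse (real (Suc n))" for n
    proof (rule ccontr)
      assume "\<not> ?thesis"
      then have "\<And>y. y \<in> V \<Longrightarrow> d + inverse (real (Suc n)) \<le> dist x y" by (auto simp: dist_norm not_less)
      then have "d + inverse (real (Suc n)) \<le> infdist x V"
        unfolding infdist_notempty[OF Vne] by (intro cINF_greatest[OF Vne]) auto
      then show False by (simp add: d_def)
    qed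
    then obtain v where v: "\<And>n. v n \<in> V" "\<And>n. norm (x - v n) < d + inverse (real (Suc n))"
      by metis
    have lim: "(\<lambda>n. norm (x - v n)) \<longlonglongrightarrow> d"
    proof (rule tendsto_sandwich)
      show "\<forall>\<^sub>F n in sequentially. d \<le> norm (x - v n)" using dle v by auto
      show "\<forall>\<^sub>F n in sequentially. norm (x - v n) \<le> d + inverse (real (Suc n))"
        by (intro always_eventually allI less_imp_le v(2))
      show "(\<lambda>n. d + inverse (real (Suc n))) \<longlonglongrightarrow> d"
        using tendsto_add[OF tendsto_const LIMSEQ_inverse_real_of_nat, of d] by simp
    qed simp
    have para: "(norm (v m - v n))\<^sup>2 \<le> 2 * (norm (x - v m))\<^sup>2 + 2 * (norm (x - v n))\<^sup>2 - 4 * d\<^sup>2" for m n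
    proof -
      have "(1/2) *\<^sub>R (v m + v n) \<in> V" using V v(1) by (auto simp: subspace_def)
      from dle[OF this] have "d\<^sup>2 \<le> (norm (x - (1/2) *\<^sub>R (v m + v n)))\<^sup>2"
        using d0 by (intro power_mono) auto
      moreover have "(norm (v m - v n))\<^sup>2 + 4 * (norm (x - (1/2) *\<^sub>R (v m + v n)))\<^sup>2
          = 2 * (norm (x - v m))\<^sup>2 + 2 * (norm (x - v n))\<^sup>2"
        unfolding power2_norm_eq_inner
        by (simp add: inner_simps inner_commute algebra_simps)
      ultimately show ?thesis by linarith
    qed
    have "Cauchy v"
    proof (rule CauchyI)
      fix e :: real assume e: "0 < e"
      have "(\<lambda>n. (norm (x - v n))\<^sup>2) \<longlonglongrightarrow> d\<^sup>2" using lim by (intro tendsto_intros)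
      then have "\<forall>\<^sub>F n in sequentially. (norm (x - v n))\<^sup>2 < d\<^sup>2 + e\<^sup>2 / 4"
        using e by (intro order_tendstoD(2)) auto
      then obtain M where M: "\<And>n. n \<ge> M \<Longrightarrow> (norm (x - v n))\<^sup>2 < d\<^sup>2 + e\<^sup>2 / 4"
        by (auto simp: eventually_sequentially)
      have "norm (v m - v n) < e" if "m \<ge> M" "n \<ge> M" for m n
      proof (rule power2_less_imp_less)
        show "(norm (v m - v n))\<^sup>2 < e\<^sup>2" using para[of m n] M[OF that(1)] M[OF that(2)] by linarith
      qed (use e in simp)
      then show "\<exists>M. \<forall>m\<ge>M. \<forall>n\<ge>M. norm (v m - v n) < e" by blast
    qed
    then obtain z where z: "v \<longlonglongrightarrow> z" using Cauchy_convergent convergent_def by blast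
    then have zc: "z \<in> closure V" using v(1) closure_sequential by blast
    have xz: "norm (x - z) = d"
      using LIMSEQ_unique[OF lim] z by (intro LIMSEQ_unique[OF _ lim] tendsto_intros)
    have "inner (x - z) y = 0" if y: "y \<in> V" for y
    proof -
      have ge: "d \<le> norm (x - z - t *\<^sub>R y)" for t
      proof (rule LIMSEQ_le_const)
        show "(\<lambda>n. norm (x - (v n + t *\<^sub>R y))) \<longlonglongrightarrow> norm (x - z - t *\<^sub>R y)"
          using tendsto_norm[OF tendsto_diff[OF tendsto_const tendsto_add[OF z tendsto_const]], of x "t *\<^sub>R y"]
          by (simp add: diff_diff_eq)
        show "\<exists>N. \<forall>n\<ge>N. d \<le> norm (x - (v n + t *\<^sub>R y))"
          using V v(1) y by (auto intro!: dle simp: subspace_def)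
      qed
      have *: "2 * t * inner (x - z) y \<le> t\<^sup>2 * (norm y)\<^sup>2" for t
      proof -
        have "d\<^sup>2 \<le> (norm (x - z - t *\<^sub>R y))\<^sup>2" using ge d0 by (intro power_mono) auto
        also have "\<dots> = d\<^sup>2 - 2 * t * inner (x - z) y + t\<^sup>2 * (norm y)\<^sup>2"
          unfolding xz[symmetric] power2_norm_eq_inner
          by (simp add: inner_simps inner_commute algebra_simps power2_eq_square)
        finally show ?thesis by simp
      qed
      show ?thesis
      proof (cases "y = 0")
        case False
        \<comment> \<open>The multiple of \<open>y\<close> that is nearest to \<open>x - z\<close>.\<close>
        let ?t = "inner (x - z) y / (norm y)\<^sup>2"
        have "2 * (inner (x - z) y)\<^sup>2 / (norm y)\<^sup>2 \<le> (inner (x - z) y)\<^sup>2 / (norm y)\<^sup>2"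
          using *[of ?t] False by (simp add: power2_eq_square field_simps)
        then show ?thesis using False by (simp add: divide_simps split: if_splits)
      qed simp
    qed
    then have "x - z = 0" by (rule triv)
    then show ?thesis using zc by simp
  qed
  then show ?thesis by auto
qed

section \<open>The translation group on \<open>L\<^sup>2\<close>\<close>

lift_definition l2_shift :: "real \<Rightarrow> l2_torus \<Rightarrow> l2_torus" is "\<lambda>h f x. f (x + h)"
proof -
  fix h and f g :: "real \<Rightarrow> real" assume a: "l2_rel f g"
  then have s: "sq_integrable f" "sq_integrable g" and "AE x in torus. f x = g x"
    by (auto simp: l2_rel_def)
  then have "AE x in torus. f (x + h) = g (x + h)"
    by (intro AE_torus_shift[of "\<lambda>x. f x = g x"]) (auto simp: sq_integrable_def)
  then show "l2_rel (\<lambda>x. f (x + h)) (\<lambda>x. g (x + h))"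
    using s by (simp add: l2_rel_def sq_integrable_shift)
qed

lemma l2_shift_abs: "sq_integrable f \<Longrightarrow> l2_shift h (cls f) = cls (\<lambda>x. f (x + h))"
  by (rule l2_shift.abs_eq) (simp add: l2_rel_def)

lemma rep_l2_shift: "AE x in torus. rep (l2_shift h u) x = rep u (x + h)"
  using rep_abs_l2[OF sq_integrable_shift[OF sq_integrable_rep[of u]], of h]
    l2_shift_abs[OF sq_integrable_rep[of u], of h] by (simp add: abs_rep_l2)

lemma l2_shift_0 [simp]: "l2_shift 0 u = u"
  using l2_shift_abs[OF sq_integrable_rep[of u], of 0] by (simp add: abs_rep_l2)

lemma l2_shift_shift [simp]: "l2_shift a (l2_shift b u) = l2_shift (a + b) u"
  using l2_shift_abs[OF sq_integrable_rep[of u]]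
    l2_shift_abs[OF sq_integrable_shift[OF sq_integrable_rep[of u], of b], of a]
  by (simp add: abs_rep_l2 add.assoc)

lemma l2_shift_add: "l2_shift h (u + v) = l2_shift h u + l2_shift h v"
  by transfer (simp add: l2_rel_def sq_integrable_add sq_integrable_shift)

lemma l2_shift_scaleR: "l2_shift h (c *\<^sub>R u) = c *\<^sub>R l2_shift h u"
  by transfer (simp add: l2_rel_def sq_integrable_scale sq_integrable_shift)

lemma inner_l2_shift_shift: "inner (l2_shift h u) (l2_shift h v) = inner u v"
proof transfer
  fix h :: real and f g :: "real \<Rightarrow> real" assume "l2_rel f f" "l2_rel g g"
  then show "(\<integral>x. f (x + h) * g (x + h) \<partial>torus) = (\<integral>x. f x * g x \<partial>torus)"
    by (intro integral_torus_shift[of "\<lambda>x. f x * g x"]) (auto simp: l2_rel_def sq_integrable_def)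
qed

lemma norm_l2_shift [simp]: "norm (l2_shift h u) = norm u"
  by (simp add: norm_eq_sqrt_inner inner_l2_shift_shift)

lemma bounded_linear_l2_shift: "bounded_linear (l2_shift h)"
  by (rule bounded_linear_intro[of _ 1]) (simp_all add: l2_shift_add l2_shift_scaleR)

lemmas l2_shift_linear_simps [simp] = bounded_linear.linear[OF bounded_linear_l2_shift, THEN linear_0]
  bounded_linear.linear[OF bounded_linear_l2_shift, THEN linear_diff]
  bounded_linear.linear[OF bounded_linear_l2_shift, THEN linear_neg]
  l2_shift_add l2_shift_scaleR

lemma inner_l2_shift: "inner (l2_shift h u) v = inner u (l2_shift (- h) v)"
  using inner_l2_shift_shift[of "- h" "l2_shift h u" v] by simp

lemma funpow_deriv_shift:
  "(deriv ^^ n) (\<lambda>x. f (x + h)) = (\<lambda>x::real. ((deriv ^^ n) f) (x + h))"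
proof (induction n)
  case (Suc n)
  have "deriv (\<lambda>x. F (x + h)) x = deriv F (x + h)" for F :: "real \<Rightarrow> real" and x
    by (simp add: deriv_def DERIV_shift)
  then show ?case by (simp add: Suc)
qed simp

lemma smooth_periodic_DERIV:
  assumes "smooth_periodic \<phi>"
  shows "(\<phi> has_real_derivative deriv \<phi> x) (at x)"
proof -
  have "(deriv ^^ 0) \<phi> differentiable_on UNIV"
    using assms unfolding smooth_periodic_def by blast
  then have "\<phi> differentiable (at x)" by (simp add: differentiable_on_def)
  then show ?thesis by (simp add: DERIV_deriv_iff_real_differentiable)
qed

lemma smooth_periodic_shift:
  assumes "smooth_periodic \<phi>"
  shows "smooth_periodic (\<lambda>x. \<phi> (x + h))"
  unfolding smooth_periodic_def funpow_deriv_shift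
proof (intro conjI allI)
  show "\<phi> (x + 1 + h) = \<phi> (x + h)" for x
    using assms unfolding smooth_periodic_def by (metis add.commute add.left_commute)
  show "(\<lambda>x. (deriv ^^ n) \<phi> (x + h)) differentiable_on UNIV" for n
  proof -
    have "(deriv ^^ n) \<phi> differentiable_on UNIV" using assms unfolding smooth_periodic_def by blast
    then have "((deriv ^^ n) \<phi> has_real_derivative deriv ((deriv ^^ n) \<phi>) y) (at y)" for y
      by (simp add: differentiable_on_def DERIV_deriv_iff_real_differentiable)
    then have "((\<lambda>x. (deriv ^^ n) \<phi> (x + h)) has_real_derivative deriv ((deriv ^^ n) \<phi>) (x + h)) (at x)" for x
      by (rule DERIV_shift[THEN iffD1])
    then show ?thesis
      unfolding differentiable_on_def real_differentiable_def by blast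
  qed
qed

lemma smooth_periodic_bounded:
  assumes "smooth_periodic \<phi>"
  obtains B where "0 \<le> B" "\<And>x. \<bar>\<phi> x\<bar> \<le> B"
proof -
  obtain B where B: "\<And>x. x \<in> {0..<1} \<Longrightarrow> \<bar>\<phi> x\<bar> \<le> B"
    using continuous_periodic_bounded[OF smooth_periodic_continuous[OF assms]] by blast
  have "\<bar>\<phi> x\<bar> \<le> B" for x
    using B[of "frac x"] periodic_frac[of \<phi> x] assms frac_lt_1[of x]
    by (auto simp: smooth_periodic_def)
  moreover from this[of 0] have "0 \<le> B" by linarith
  ultimately show ?thesis using that by blast
qed

lemma norm_l2_const: "norm (cls (\<lambda>x. c)) = \<bar>c\<bar>"
proof -
  have "cls (\<lambda>x. c) = c *\<^sub>R cls (\<lambda>x. 1)"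
    by (simp add: abs_l2_scaleR sq_integrable_const)
  then show ?thesis by (simp add: norm_one_l2)
qed

lemma norm_le_of_AE_bound:
  assumes "sq_integrable f" "AE x in torus. \<bar>f x\<bar> \<le> c" "0 \<le> c"
  shows "norm (cls f) \<le> c"
  using norm_le_of_AE[OF assms(1) sq_integrable_const[of c]] assms by (simp add: norm_l2_const)

text \<open>A second order Taylor bound for \<open>\<phi>\<close>, which is uniform in \<open>x\<close> by periodicity.\<close>

lemma smooth_shift_derivative_0:
  assumes \<phi>: "smooth_periodic \<phi>"
  shows "((\<lambda>h. l2_shift h (cls \<phi>)) has_vector_derivative cls (deriv \<phi>)) (at 0)"
proof -
  note d = smooth_periodic_DERIV[OF \<phi>]
  note d' = smooth_periodic_DERIV[OF smooth_periodic_deriv[OF \<phi>]]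
  obtain B where B: "0 \<le> B" "\<And>x. \<bar>deriv (deriv \<phi>) x\<bar> \<le> B"
    using smooth_periodic_bounded[OF smooth_periodic_deriv[OF smooth_periodic_deriv[OF \<phi>]]] by blast
  have l: "\<bar>deriv \<phi> x - deriv \<phi> y\<bar> \<le> B * \<bar>x - y\<bar>" for x y
    using field_differentiable_bound[of UNIV "deriv \<phi>" "deriv (deriv \<phi>)" B x y] d' B by auto
  have t: "\<bar>\<phi> (x + h) - \<phi> x - h * deriv \<phi> x\<bar> \<le> B * \<bar>h\<bar> * \<bar>h\<bar>" for x h
  proof -
    let ?S = "closed_segment x (x + h)"
    have "\<bar>(\<phi> (x + h) - deriv \<phi> x * (x + h)) - (\<phi> x - deriv \<phi> x * x)\<bar> \<le> B * \<bar>h\<bar> * norm (x + h - x)"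
      unfolding real_norm_def[symmetric]
    proof (rule field_differentiable_bound[where S = "?S" and f' = "\<lambda>y. deriv \<phi> y - deriv \<phi> x"])
      show "((\<lambda>y. \<phi> y - deriv \<phi> x * y) has_field_derivative deriv \<phi> z - deriv \<phi> x) (at z within ?S)" for z
        using d[of z] by (auto intro!: derivative_eq_intros intro: has_field_derivative_at_within)
      show "norm (deriv \<phi> z - deriv \<phi> x) \<le> B * norm h" if "z \<in> ?S" for z
      proof -
        have "\<bar>z - x\<bar> \<le> \<bar>h\<bar>" using that by (auto simp: closed_segment_eq_real_ivl split: if_splits)
        then have "B * \<bar>z - x\<bar> \<le> B * \<bar>h\<bar>" using B(1) by (rule mult_left_mono)
        with l[of z x] show ?thesis by simp
      qed
    qed auto
    then show ?thesis by (simp add: algebra_simps)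
  qed
  note s = sq_integrable_test[OF \<phi>] and s' = sq_integrable_test[OF smooth_periodic_deriv[OF \<phi>]]
  have n: "norm (l2_shift h (cls \<phi>) - cls \<phi> - h *\<^sub>R cls (deriv \<phi>)) \<le> B * \<bar>h\<bar> * \<bar>h\<bar>" for h
  proof -
    have "l2_shift h (cls \<phi>) - cls \<phi> - h *\<^sub>R cls (deriv \<phi>)
        = cls (\<lambda>x. \<phi> (x + h) - \<phi> x - h * deriv \<phi> x)"
      using s s' by (simp add: l2_shift_abs abs_l2_minus abs_l2_scaleR sq_integrable_shift sq_integrable_minus sq_integrable_scale)
    also have "norm \<dots> \<le> B * \<bar>h\<bar> * \<bar>h\<bar>"
      using s s' t B(1) by (intro norm_le_of_AE_bound AE_I2 sq_integrable_minus sq_integrable_scale sq_integrable_shift) auto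
    finally show ?thesis .
  qed
  show ?thesis
    unfolding has_vector_derivative_def has_derivative_iff_norm
  proof (intro conjI bounded_linear_scaleR_left)
    have "((\<lambda>h. B * \<bar>h\<bar>) \<longlongrightarrow> B * \<bar>0\<bar>) (at 0)" by (intro tendsto_intros)
    then have lim: "((\<lambda>h. B * \<bar>h\<bar>) \<longlongrightarrow> 0) (at 0)" by simp
    show "((\<lambda>h. norm (l2_shift h (cls \<phi>) - l2_shift 0 (cls \<phi>) - (h - 0) *\<^sub>R cls (deriv \<phi>)) / norm (h - 0)) \<longlongrightarrow> 0) (at 0)"
    proof (rule Lim_null_comparison[OF _ lim])
      show "\<forall>\<^sub>F h in at 0. norm (norm (l2_shift h (cls \<phi>) - l2_shift 0 (cls \<phi>) - (h - 0) *\<^sub>R cls (deriv \<phi>)) / norm (h - 0)) \<le> B * \<bar>h\<bar>"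
        using n by (intro always_eventually) (auto simp: divide_simps)
    qed
  qed
qed

definition smooth_l2 :: "l2_torus set" where
  "smooth_l2 = cls ` Collect smooth_periodic"

lemma smooth_l2_orthogonal_imp_0:
  assumes "\<And>\<phi>. smooth_periodic \<phi> \<Longrightarrow> inner z (cls \<phi>) = 0"
  shows "z = 0"
proof -
  have "AE x in torus. rep z x = 0"
  proof (rule torus_fundamental_lemma)
    fix \<phi> assume \<phi>: "smooth_periodic \<phi>"
    then show "(\<integral>x. rep z x * \<phi> x \<partial>torus) = 0"
      using assms[OF \<phi>] inner_l2_abs[OF sq_integrable_rep[of z] sq_integrable_test[OF \<phi>]]
      by (simp add: abs_rep_l2)
  qed (simp_all add: integrable_rep)
  then have "cls (rep z) = cls (\<lambda>x. 0)"
    by (subst abs_l2_eq_iff) (auto simp: sq_integrable_rep sq_integrable_zero)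
  then show ?thesis by (simp add: abs_rep_l2 zero_l2_torus_def)
qed

text \<open>Orthogonality to all smooth functions is exactly what the fundamental lemma of the calculus
  of variations excludes, which makes the smooth functions total.\<close>

lemma closure_span_smooth_l2: "closure (span smooth_l2) = UNIV"
proof (rule dense_of_trivial_complement[OF subspace_span])
  fix z assume *: "\<And>y. y \<in> span smooth_l2 \<Longrightarrow> inner z y = 0"
  show "z = 0"
    by (rule smooth_l2_orthogonal_imp_0, rule *) (auto simp: smooth_l2_def intro: span_base)
qed

text \<open>Strong continuity of the translations: it follows from differentiability for smooth
  functions, and passes to the closure of their span because translations are isometries.\<close>

lemma l2_shift_tendsto_0: "((\<lambda>h. l2_shift h u) \<longlongrightarrow> u) (at 0)"
proof -
  have span: "((\<lambda>h. l2_shift h v) \<longlongrightarrow> v) (at 0)" if "v \<in> span smooth_l2" for v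
    using that
  proof (induction rule: span_induct_alt)
    case (step c x y)
    then obtain \<phi> where "smooth_periodic \<phi>" "x = cls \<phi>" by (auto simp: smooth_l2_def)
    then have "((\<lambda>h. l2_shift h x) \<longlongrightarrow> x) (at 0)"
      using has_vector_derivative_continuous[OF smooth_shift_derivative_0[of \<phi>]]
      by (simp add: continuous_within)
    with step show ?case by (auto intro!: tendsto_intros)
  qed simp
  show ?thesis
    unfolding tendsto_iff
  proof (intro allI impI)
    fix e :: real assume e: "0 < e"
    have "u \<in> closure (span smooth_l2)" by (simp add: closure_span_smooth_l2)
    then obtain v where v: "v \<in> span smooth_l2" "dist v u < e / 3"
      using e by (meson closure_approachable divide_pos_pos zero_less_numeral)
    have "\<forall>\<^sub>F h in at 0. dist (l2_shift h v) v < e / 3"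
      using tendstoD[OF span[OF v(1)], of "e / 3"] e by simp
    then show "\<forall>\<^sub>F h in at 0. dist (l2_shift h u) u < e"
    proof eventually_elim
      case (elim h)
      have "dist (l2_shift h u) (l2_shift h v) = dist u v"
        unfolding dist_norm l2_shift_linear_simps(2)[symmetric] by (rule norm_l2_shift)
      then show ?case
        using elim v(2) dist_triangle[of "l2_shift h u" u "l2_shift h v"] dist_triangle[of "l2_shift h v" u v]
        by (simp add: dist_commute)
    qed
  qed
qed

lemma l2_shift_tendsto:
  assumes "(f \<longlongrightarrow> u) F" "(c \<longlongrightarrow> h) F"
  shows "((\<lambda>x. l2_shift (c x) (f x)) \<longlongrightarrow> l2_shift h u) F"
proof -
  have "((\<lambda>k. l2_shift k u) \<longlongrightarrow> l2_shift h u) (at h)"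
  proof -
    have "((\<lambda>k. l2_shift h (l2_shift k u)) \<longlongrightarrow> l2_shift h u) (at 0)"
      using bounded_linear.tendsto[OF bounded_linear_l2_shift l2_shift_tendsto_0] .
    then show ?thesis by (subst LIM_offset_zero_iff) auto
  qed
  then have "isCont (\<lambda>k. l2_shift k u) h" by (simp add: isCont_def)
  then have 1: "((\<lambda>x. l2_shift (c x) u) \<longlongrightarrow> l2_shift h u) F"
    using assms(2) isCont_tendsto_compose by blast
  have "((\<lambda>x. norm (l2_shift (c x) (f x - u))) \<longlongrightarrow> 0) F"
    using assms(1) by (simp add: LIM_zero tendsto_norm_zero del: l2_shift_linear_simps)
  then have "((\<lambda>x. l2_shift (c x) (f x - u)) \<longlongrightarrow> 0) F"
    by (rule tendsto_norm_zero_cancel)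
  from tendsto_add[OF this 1] show ?thesis by simp
qed

lemma l2_shift_continuous_on [continuous_intros]:
  assumes "continuous_on S f" "continuous_on S c"
  shows "continuous_on S (\<lambda>x. l2_shift (c x) (f x))"
  using assms by (auto simp: continuous_on_def intro: l2_shift_tendsto)

section \<open>Weak derivatives as generators of translations\<close>

lemma has_weak_deriv_iff:
  "has_weak_deriv u w \<longleftrightarrow> (\<forall>\<phi>. smooth_periodic \<phi> \<longrightarrow>
     inner u (cls (deriv \<phi>)) = - inner w (cls \<phi>))"
proof -
  have i: "inner u (cls \<phi>) = (\<integral>x. rep u x * \<phi> x \<partial>torus)" if "smooth_periodic \<phi>" for u \<phi>
    using inner_l2_abs[OF sq_integrable_rep[of u] sq_integrable_test[OF that]] by (simp add: abs_rep_l2)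
  have "has_weak_deriv (cls (rep u)) (cls (rep w)) \<longleftrightarrow>
    (\<forall>\<phi>. smooth_periodic \<phi> \<longrightarrow> (\<integral>x. rep u x * deriv \<phi> x \<partial>torus) = - (\<integral>x. rep w x * \<phi> x \<partial>torus))"
    by (rule has_weak_deriv.abs_eq) (simp_all add: l2_rel_def sq_integrable_rep)
  then show ?thesis
    unfolding abs_rep_l2 using i smooth_periodic_deriv by auto
qed

lemma shift_derivative_at:
  assumes "((\<lambda>h. l2_shift h z) has_vector_derivative y) (at 0)"
  shows "((\<lambda>s. l2_shift (c * s) z) has_vector_derivative c *\<^sub>R l2_shift (c * s) y) (at s within S)"
proof -
  have "((\<lambda>h. l2_shift h z) \<circ> (\<lambda>r. c * (r - s)) has_vector_derivative c *\<^sub>R y) (at s)"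
  proof (rule vector_diff_chain_at)
    show "((\<lambda>r. c * (r - s)) has_vector_derivative c) (at s)"
      by (auto intro!: derivative_eq_intros)
  qed (use assms in simp)
  then have "((\<lambda>r. l2_shift (c * s) (l2_shift (c * (r - s)) z)) has_vector_derivative l2_shift (c * s) (c *\<^sub>R y)) (at s)"
    unfolding o_def by (rule bounded_linear.has_vector_derivative[OF bounded_linear_l2_shift])
  then have "((\<lambda>r. l2_shift (c * r) z) has_vector_derivative c *\<^sub>R l2_shift (c * s) y) (at s)"
    by (simp add: algebra_simps)
  then show ?thesis by (rule has_vector_derivative_at_within)
qed

lemma smooth_shift_derivative:
  assumes "smooth_periodic \<phi>"
  shows "((\<lambda>s. l2_shift (c * s) (cls \<phi>)) has_vector_derivative
      c *\<^sub>R l2_shift (c * s) (cls (deriv \<phi>))) (at s within S)"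
  by (rule shift_derivative_at[OF smooth_shift_derivative_0[OF assms]])

lemma l2_shift_smooth:
  assumes "smooth_periodic \<phi>"
  shows "l2_shift h (cls \<phi>) = cls (\<lambda>x. \<phi> (x + h))"
    and "l2_shift h (cls (deriv \<phi>)) = cls (deriv (\<lambda>x. \<phi> (x + h)))"
  using funpow_deriv_shift[of 1 \<phi> h]
  by (simp_all add: l2_shift_abs sq_integrable_test assms smooth_periodic_deriv)

lemma inner_integral_l2:
  fixes f :: "real \<Rightarrow> 'a::{real_inner, banach}"
  assumes "continuous_on {a..b} f"
  shows "inner (integral {a..b} f) y = integral {a..b} (\<lambda>s. inner (f s) y)"
  by (rule integral_bounded_linear_image[OF assms bounded_linear_inner_left])

lemma l2_shift_continuous_real [continuous_intros]: "continuous_on S (\<lambda>s. l2_shift s u)"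
  by (intro continuous_intros)

text \<open>Paired with a smooth function, the translation can be moved to that function, where it may be
  differentiated in the classical sense.\<close>

lemma l2_shift_diff_integral:
  assumes w: "has_weak_deriv u w" and ab: "a \<le> b"
  shows "l2_shift b u - l2_shift a u = integral {a..b} (\<lambda>s. l2_shift s w)"
proof -
  have "l2_shift b u - l2_shift a u - integral {a..b} (\<lambda>s. l2_shift s w) = 0"
  proof (rule smooth_l2_orthogonal_imp_0)
    fix \<phi> assume \<phi>: "smooth_periodic \<phi>"
    let ?p = "cls \<phi>" and ?d = "cls (deriv \<phi>)"
    have "((\<lambda>s. inner (l2_shift s w) ?p) has_integral inner (l2_shift b u) ?p - inner (l2_shift a u) ?p) {a..b}"
    proof (rule fundamental_theorem_of_calculus[OF ab])
      fix s
      have "((\<lambda>s. inner u (l2_shift (-1 * s) ?p)) has_vector_derivative inner u ((-1) *\<^sub>R l2_shift (-1 * s) ?d)) (at s within {a..b})"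
        by (intro bounded_linear.has_vector_derivative[OF bounded_linear_inner_right] smooth_shift_derivative[OF \<phi>])
      moreover have "inner u ((-1) *\<^sub>R l2_shift (-1 * s) ?d) = inner (l2_shift s w) ?p"
        using w smooth_periodic_shift[OF \<phi>, of "- s"]
        by (simp add: inner_l2_shift l2_shift_smooth[OF \<phi>] has_weak_deriv_iff)
      ultimately show "((\<lambda>s. inner (l2_shift s u) ?p) has_vector_derivative inner (l2_shift s w) ?p) (at s within {a..b})"
        by (simp add: inner_l2_shift)
    qed
    then show "inner (l2_shift b u - l2_shift a u - integral {a..b} (\<lambda>s. l2_shift s w)) ?p = 0"
      by (simp add: inner_diff_left inner_integral_l2 integral_unique l2_shift_continuous_real)
  qed
  then show ?thesis by simp
qed

text \<open>The weak derivative is the generator of the translation group. With this description weak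
  derivatives can be computed as limits of difference quotients in \<open>L\<^sup>2\<close>, without test functions.\<close>

lemma has_weak_deriv_iff_shift_derivative:
  "has_weak_deriv u w \<longleftrightarrow> ((\<lambda>h. l2_shift h u) has_vector_derivative w) (at 0)"
proof
  assume w: "has_weak_deriv u w"
  have "((\<lambda>h. l2_shift h u) has_vector_derivative l2_shift 0 w) (at 0)"
    by (rule has_vector_derivative_of_integral)
       (auto intro: l2_shift_diff_integral[OF w] continuous_intros)
  then show "((\<lambda>h. l2_shift h u) has_vector_derivative w) (at 0)" by simp
next
  assume w: "((\<lambda>h. l2_shift h u) has_vector_derivative w) (at 0)"
  show "has_weak_deriv u w"
    unfolding has_weak_deriv_iff
  proof (intro allI impI)
    fix \<phi> assume \<phi>: "smooth_periodic \<phi>"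
    let ?p = "cls \<phi>" and ?d = "cls (deriv \<phi>)"
    have "((\<lambda>s. inner u (l2_shift (-1 * s) ?p)) has_vector_derivative inner u ((-1) *\<^sub>R l2_shift (-1 * 0) ?d)) (at 0)"
      by (intro bounded_linear.has_vector_derivative[OF bounded_linear_inner_right] smooth_shift_derivative[OF \<phi>])
    then have "((\<lambda>s. inner (l2_shift s u) ?p) has_vector_derivative - inner u ?d) (at 0)"
      by (simp add: inner_l2_shift)
    moreover have "((\<lambda>s. inner (l2_shift s u) ?p) has_vector_derivative inner w ?p) (at 0)"
      by (intro bounded_linear.has_vector_derivative[OF bounded_linear_inner_left] w)
    ultimately show "inner u ?d = - inner w ?p"
      using vector_derivative_unique_at by fastforce
  qed
qed

lemma weak_deriv_shift_derivative:
  "((\<lambda>s. l2_shift (c * s) (l2_of_h1 u)) has_vector_derivative c *\<^sub>R l2_shift (c * s) (weak_deriv u)) (at s within S)"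
  using shift_derivative_at[OF has_weak_deriv_iff_shift_derivative[THEN iffD1, OF has_weak_deriv_weak_deriv]] .

text \<open>Both sides are derivatives at \<open>h = 0\<close> of the pairing of the translate of \<open>u\<close> by \<open>h\<close> with \<open>v\<close>, or of \<open>u\<close>
  with the translate of \<open>v\<close> by \<open>-h\<close>.\<close>

lemma has_weak_deriv_inner:
  assumes "has_weak_deriv u w" "has_weak_deriv v y"
  shows "inner u y = - inner w v"
proof -
  have "((\<lambda>s. inner (l2_shift s u) v) has_vector_derivative inner w v) (at 0)"
    by (intro bounded_linear.has_vector_derivative[OF bounded_linear_inner_left]
        has_weak_deriv_iff_shift_derivative[THEN iffD1] assms)
  moreover have "((\<lambda>s. inner u (l2_shift (-1 * s) v)) has_vector_derivative inner u ((-1) *\<^sub>R l2_shift (-1 * 0) y)) (at 0)"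
    using assms(2) by (intro bounded_linear.has_vector_derivative[OF bounded_linear_inner_right]
        shift_derivative_at) (simp add: has_weak_deriv_iff_shift_derivative)
  ultimately have "inner w v = - inner u y"
    by (intro vector_derivative_unique_at) (simp_all add: inner_l2_shift)
  then show ?thesis by simp
qed

lemma inner_weak_deriv: "inner (weak_deriv u) (l2_of_h1 v) = - inner (l2_of_h1 u) (weak_deriv v)"
  using has_weak_deriv_inner[OF has_weak_deriv_weak_deriv[of u] has_weak_deriv_weak_deriv[of v]] by simp

lemma has_weak_deriv_minus:
  "has_weak_deriv u w \<Longrightarrow> has_weak_deriv u' w' \<Longrightarrow> has_weak_deriv (u - u') (w - w')"
  using has_weak_deriv_add[of u w "(-1) *\<^sub>R u'" "(-1) *\<^sub>R w'"] has_weak_deriv_scaleR[of u' w' "-1"] by simp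

lemma has_weak_deriv_closed:
  assumes "(U \<longlongrightarrow> u) F" "(W \<longlongrightarrow> w) F" "\<And>n. has_weak_deriv (U n) (W n)" "F \<noteq> bot"
  shows "has_weak_deriv u w"
  unfolding has_weak_deriv_iff
proof (intro allI impI)
  fix \<phi> assume \<phi>: "smooth_periodic \<phi>"
  have "((\<lambda>n. inner (U n) (cls (deriv \<phi>))) \<longlongrightarrow> inner u (cls (deriv \<phi>))) F"
    by (intro tendsto_intros assms)
  moreover have "((\<lambda>n. - inner (W n) (cls \<phi>)) \<longlongrightarrow> - inner w (cls \<phi>)) F"
    by (intro tendsto_intros assms)
  ultimately show "inner u (cls (deriv \<phi>)) = - inner w (cls \<phi>)"
    using assms(3) \<phi> tendsto_unique[OF assms(4)] by (simp add: has_weak_deriv_iff)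
qed

lemma l2_of_h1_of_l2: "has_weak_deriv u w \<Longrightarrow> l2_of_h1 (h1_of_l2 u) = u"
  by (rule h1_of_l2_inverse) auto

lemma weak_deriv_h1_of_l2: "has_weak_deriv u w \<Longrightarrow> weak_deriv (h1_of_l2 u) = w"
  by (rule weak_deriv_eq) (simp add: l2_of_h1_of_l2)

lemma norm_h1_sq: "(norm (u::h1_torus))\<^sup>2 = (norm (l2_of_h1 u))\<^sup>2 + (norm (weak_deriv u))\<^sup>2"
  by (simp add: power2_norm_eq_inner inner_h1_torus_def)

lemma norm_h1_le: "norm (u::h1_torus) \<le> norm (l2_of_h1 u) + norm (weak_deriv u)"
  by (rule power2_le_imp_le) (simp_all add: norm_h1_sq power2_sum)

lemmas l2_of_h1_simps [simp] = bounded_linear.linear[OF bounded_linear_l2_of_h1, THEN linear_0]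
  bounded_linear.linear[OF bounded_linear_l2_of_h1, THEN linear_diff]
  bounded_linear.linear[OF bounded_linear_l2_of_h1, THEN linear_neg]
  plus_h1_torus.rep_eq scaleR_h1_torus.rep_eq

lemmas weak_deriv_simps [simp] = bounded_linear.linear[OF bounded_linear_weak_deriv, THEN linear_0]
  bounded_linear.linear[OF bounded_linear_weak_deriv, THEN linear_diff]
  bounded_linear.linear[OF bounded_linear_weak_deriv, THEN linear_neg]
  weak_deriv_add weak_deriv_scaleR

lemma tendsto_h1:
  assumes "((\<lambda>x. l2_of_h1 (f x)) \<longlongrightarrow> l2_of_h1 u) F" "((\<lambda>x. weak_deriv (f x)) \<longlongrightarrow> weak_deriv u) F"
  shows "(f \<longlongrightarrow> u) F"
proof -
  have "((\<lambda>x. norm (l2_of_h1 (f x - u)) + norm (weak_deriv (f x - u))) \<longlongrightarrow> norm (0::l2_torus) + norm (0::l2_torus)) F"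
    using assms by (intro tendsto_intros) (simp_all add: LIM_zero)
  then have "((\<lambda>x. norm (l2_of_h1 (f x - u)) + norm (weak_deriv (f x - u))) \<longlongrightarrow> 0) F" by simp
  then have "((\<lambda>x. f x - u) \<longlongrightarrow> 0) F"
    by (rule Lim_null_comparison[rotated]) (intro always_eventually allI norm_h1_le)
  then show ?thesis by (simp add: LIM_zero_iff)
qed

instance h1_torus :: banach
proof
  fix X :: "nat \<Rightarrow> h1_torus" assume X: "Cauchy X"
  have "Cauchy (\<lambda>n. l2_of_h1 (X n))" "Cauchy (\<lambda>n. weak_deriv (X n))"
    by (rule bounded_linear.Cauchy[OF bounded_linear_l2_of_h1 X] bounded_linear.Cauchy[OF bounded_linear_weak_deriv X])+
  then obtain u w where l: "(\<lambda>n. l2_of_h1 (X n)) \<longlonglongrightarrow> u" "(\<lambda>n. weak_deriv (X n)) \<longlonglongrightarrow> w"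
    using Cauchy_convergent convergent_def by metis
  have "has_weak_deriv u w"
    by (rule has_weak_deriv_closed[OF l has_weak_deriv_weak_deriv]) simp
  then have "X \<longlonglongrightarrow> h1_of_l2 u"
    using l by (intro tendsto_h1) (simp_all add: l2_of_h1_of_l2 weak_deriv_h1_of_l2)
  then show "convergent X" by (rule convergentI)
qed

lemma has_weak_deriv_integral_shift:
  assumes ab: "a \<le> b"
  shows "has_weak_deriv (integral {a..b} (\<lambda>s. l2_shift s v)) (l2_shift b v - l2_shift a v)"
  unfolding has_weak_deriv_iff
proof (intro allI impI)
  fix \<phi> assume \<phi>: "smooth_periodic \<phi>"
  let ?p = "cls \<phi>" and ?d = "cls (deriv \<phi>)"
  have "((\<lambda>s. inner v ((-1) *\<^sub>R l2_shift (-1 * s) ?d)) has_integral inner v (l2_shift (-1 * b) ?p) - inner v (l2_shift (-1 * a) ?p)) {a..b}"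
    by (intro fundamental_theorem_of_calculus[OF ab]
      bounded_linear.has_vector_derivative[OF bounded_linear_inner_right] smooth_shift_derivative[OF \<phi>])
  then have "((\<lambda>s. - inner (l2_shift s v) ?d) has_integral inner (l2_shift b v) ?p - inner (l2_shift a v) ?p) {a..b}"
    by (simp add: inner_l2_shift)
  from has_integral_neg[OF this]
  show "inner (integral {a..b} (\<lambda>s. l2_shift s v)) ?d = - inner (l2_shift b v - l2_shift a v) ?p"
    by (simp add: inner_integral_l2 l2_shift_continuous_real integral_unique inner_diff_left)
qed

section \<open>Averages over moving windows\<close>

text \<open>The intervals are half-open so that consecutive windows are disjoint and add up exactly.\<close>

definition window :: "real \<Rightarrow> real \<Rightarrow> (real \<Rightarrow> real) \<Rightarrow> real \<Rightarrow> real" where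
  "window a b f x = (LINT s:{a..<b}|lborel. f (x + s))"

definition periodic_L1 :: "(real \<Rightarrow> real) \<Rightarrow> bool" where
  "periodic_L1 f \<longleftrightarrow> f \<in> borel_measurable borel \<and> (\<forall>x. f (x + 1) = f x) \<and> integrable torus f"

lemma window_empty [simp]: "window a a f x = 0"
  by (simp add: window_def set_lebesgue_integral_def)

lemma periodic_L1_shift: "periodic_L1 f \<Longrightarrow> periodic_L1 (\<lambda>x. f (x + h))"
  using integrable_torus_shift[of f h] unfolding periodic_L1_def
  by (auto simp: add_ac) (metis add.assoc add.commute)

lemma periodic_L1_rep: "periodic_L1 (rep u)" "periodic_L1 (\<lambda>x. (rep u x)\<^sup>2)"
   "periodic_L1 (\<lambda>x. \<bar>rep u x\<bar>)"
  by (auto simp: periodic_L1_def rep_periodic integrable_rep integrable_rep_sq)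

lemma periodic_L1_add: "periodic_L1 f \<Longrightarrow> periodic_L1 g \<Longrightarrow> periodic_L1 (\<lambda>x. f x + g x)"
  by (auto simp: periodic_L1_def)

lemma periodic_L1_scale: "periodic_L1 f \<Longrightarrow> periodic_L1 (\<lambda>x. c * f x)"
  by (auto simp: periodic_L1_def)

lemma periodic_L1_const: "periodic_L1 (\<lambda>x. c)"
  by (auto simp: periodic_L1_def finite_measure.integrable_const)

lemma integrable_torus_iff: "integrable torus f \<longleftrightarrow> set_integrable lborel {0..<1} f" for f :: "real \<Rightarrow> real"
  unfolding set_integrable_def by (rule integrable_restrict_space) simp

lemma integral_torus_eq: "(\<integral>x. f x \<partial>torus) = (LINT x:{0..<1}|lborel. f x)" for f :: "real \<Rightarrow> real"
  unfolding set_lebesgue_integral_def by (rule integral_restrict_space) simp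

lemma set_integrable_translate:
  fixes f :: "real \<Rightarrow> real"
  shows "set_integrable lborel {a + t..<b + t} f \<longleftrightarrow> set_integrable lborel {a..<b} (\<lambda>s. f (s + t))"
proof -
  have "integrable lborel (\<lambda>x. indicator {a + t..<b + t} (t + 1 * x) *\<^sub>R f (t + 1 * x)) \<longleftrightarrow>
      integrable lborel (\<lambda>x. indicator {a + t..<b + t} x *\<^sub>R f x)"
    by (rule lborel_integrable_real_affine_iff) simp
  moreover have "(\<lambda>x. indicator {a + t..<b + t} (t + 1 * x) *\<^sub>R f (t + 1 * x)) = (\<lambda>x. indicator {a..<b} x *\<^sub>R f (x + t))"
    by (auto simp: indicator_def add.commute)
  ultimately show ?thesis unfolding set_integrable_def by simp
qed

lemma set_integral_translate:
  fixes f :: "real \<Rightarrow> real"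
  shows "(LINT s:{a + t..<b + t}|lborel. f s) = (LINT s:{a..<b}|lborel. f (s + t))"
proof -
  have "(\<integral>x. indicator {a + t..<b + t} x *\<^sub>R f x \<partial>lborel) = \<bar>1\<bar> *\<^sub>R (\<integral>x. indicator {a + t..<b + t} (t + 1 * x) *\<^sub>R f (t + 1 * x) \<partial>lborel)"
    by (rule lborel_integral_real_affine) simp
  moreover have "(\<lambda>x. indicator {a + t..<b + t} (t + 1 * x) *\<^sub>R f (t + 1 * x)) = (\<lambda>x. indicator {a..<b} x *\<^sub>R f (x + t))"
    by (auto simp: indicator_def add.commute)
  ultimately show ?thesis unfolding set_lebesgue_integral_def by simp
qed

lemma periodic_L1_set_integrable:
  assumes "periodic_L1 f"
  shows "set_integrable lborel {a..<b} f"
proof -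
  obtain N :: nat where N: "\<bar>a\<bar> \<le> real N" "\<bar>b\<bar> \<le> real N"
    by (metis (mono_tags) linear order_trans real_arch_simple)
  have "set_integrable lborel (\<Union>n\<in>{- int N..<int N}. {real_of_int n..<real_of_int n + 1}) f"
  proof (rule set_integrable_UN)
    fix n :: int
    have "set_integrable lborel {0..<1} (\<lambda>s. f (s + of_int n))"
      using assms periodic_add_int[of f _ n] by (simp add: periodic_L1_def integrable_torus_iff)
    then show "set_integrable lborel {real_of_int n..<real_of_int n + 1} f"
      using set_integrable_translate[of 0 "of_int n" 1 f] by (simp add: add.commute)
  qed auto
  then show ?thesis
  proof (rule set_integrable_subset)
    show "{a..<b} \<subseteq> (\<Union>n\<in>{- int N..<int N}. {real_of_int n..<real_of_int n + 1})"
    proof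
      fix x assume "x \<in> {a..<b}"
      then have "- real N \<le> x" "x < real N" using N by auto
      then have "\<lfloor>x\<rfloor> \<in> {- int N..<int N}" "x \<in> {real_of_int \<lfloor>x\<rfloor>..<real_of_int \<lfloor>x\<rfloor> + 1}"
        by (auto simp: le_floor_iff floor_less_iff)
      then show "x \<in> (\<Union>n\<in>{- int N..<int N}. {real_of_int n..<real_of_int n + 1})" by blast
    qed
  qed simp
qed

lemma window_integrable:
  assumes "periodic_L1 f"
  shows "set_integrable lborel {a..<b} (\<lambda>s. f (x + s))"
  using periodic_L1_set_integrable[OF periodic_L1_shift[OF assms, of x]] by (simp add: add.commute)

lemma window_combine:
  assumes "periodic_L1 f" "a \<le> b" "b \<le> c"
  shows "window a b f x + window b c f x = window a c f x"
proof -
  have "{a..<b} \<union> {b..<c} = {a..<c}" using assms by auto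
  then show ?thesis
    unfolding window_def
    using set_integral_Un[of "{a..<b}" "{b..<c}" lborel "\<lambda>s. f (x + s)"] window_integrable[OF assms(1)] by auto
qed

lemma window_shift: "window (a + t) (b + t) f x = window a b f (x + t)"
  unfolding window_def using set_integral_translate[of a t b "\<lambda>s. f (x + s)"] by (simp add: add_ac)

lemma window_unit:
  assumes "periodic_L1 f"
  shows "window 0 1 f x = (\<integral>x. f x \<partial>torus)"
  using integral_torus_shift[of f x] assms
  by (simp add: window_def integral_torus_eq periodic_L1_def add.commute)

lemma window_mono:
  assumes "periodic_L1 f" "periodic_L1 g" "AE x in torus. f x \<le> g x"
  shows "window a b f x \<le> window a b g x"
  unfolding window_def
proof (rule set_integral_mono_AE)
  have "AE s in torus. f (s + x) \<le> g (s + x)"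
    using assms by (intro AE_torus_shift[of "\<lambda>x. f x \<le> g x"]) (auto simp: periodic_L1_def)
  then have "AE s in lborel. f (s + x) \<le> g (s + x)"
    using assms periodic_L1_shift[of f x] periodic_L1_shift[of g x]
    by (intro AE_torus_imp_lborel) (auto simp: periodic_L1_def)
  then show "AE s\<in>{a..<b} in lborel. f (x + s) \<le> g (x + s)"
    by eventually_elim (simp add: add.commute)
qed (use assms in \<open>auto intro: window_integrable\<close>)

lemma window_nonneg:
  assumes "periodic_L1 f" "AE x in torus. 0 \<le> f x"
  shows "0 \<le> window a b f x"
  using window_mono[OF periodic_L1_const[of 0] assms(1), of a b x] assms(2) by (simp add: window_def)

lemma window_le:
  assumes "periodic_L1 f" "AE x in torus. 0 \<le> f x" "b \<le> a + real N" "a \<le> b"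
  shows "window a b f x \<le> real N * (\<integral>x. f x \<partial>torus)"
proof -
  have "window 0 (real n) f y = real n * (\<integral>x. f x \<partial>torus)" for n y
  proof (induction n)
    case (Suc n)
    have "window 0 (real (Suc n)) f y = window 0 (real n) f y + window (real n) (real (Suc n)) f y"
      by (rule window_combine[symmetric]) (use assms in auto)
    also have "window (real n) (real (Suc n)) f y = (\<integral>x. f x \<partial>torus)"
      using window_shift[of 0 "real n" 1 f y] window_unit[OF assms(1)] by (simp add: add.commute)
    finally show ?case using Suc by (simp add: algebra_simps)
  qed simp
  from this[of N "x + a"] have "window a (a + real N) f x = real N * (\<integral>x. f x \<partial>torus)"
    using window_shift[of 0 a "real N" f x] by (simp add: add.commute)
  then show ?thesis
    using window_combine[OF assms(1,4,3), of x] window_nonneg[OF assms(1,2), of b "a + real N" x] by simp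
qed

lemma window_periodic: "(\<And>x. f (x + 1) = f x) \<Longrightarrow> window a b f (x + 1) = window a b f x"
  unfolding window_def by (metis add.assoc add.commute)

lemma window_measurable:
  assumes [measurable]: "f \<in> borel_measurable borel"
  shows "window a b f \<in> borel_measurable borel"
  unfolding window_def set_lebesgue_integral_def by measurable

text \<open>The Cauchy--Schwarz inequality, from \<open>2 m \<bar>f\<bar> \<le> f\<^sup>2 + m\<^sup>2\<close> with the average \<open>m\<close> of \<open>\<bar>f\<bar>\<close> over the
  window.\<close>

lemma window_abs_sq_le:
  assumes "sq_integrable f" "a \<le> b"
  shows "(window a b (\<lambda>x. \<bar>f x\<bar>) x)\<^sup>2 \<le> (b - a) * window a b (\<lambda>x. (f x)\<^sup>2) x"
proof (cases "a = b")
  case False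
  let ?m = "window a b (\<lambda>x. \<bar>f x\<bar>) x / (b - a)"
  have ab: "0 < b - a" using False assms(2) by simp
  have p1: "periodic_L1 (\<lambda>x. \<bar>f x\<bar>)" "periodic_L1 (\<lambda>x. (f x)\<^sup>2)"
    using assms(1) sq_integrable_integrable[OF assms(1)] by (auto simp: periodic_L1_def sq_integrable_def)
  have i: "set_integrable lborel {a..<b} (\<lambda>s. 2 * ?m * \<bar>f (x + s)\<bar>)" "set_integrable lborel {a..<b} (\<lambda>s. (f (x + s))\<^sup>2)"
    "set_integrable lborel {a..<b} (\<lambda>s. ?m\<^sup>2)"
    using window_integrable[OF p1(1)] window_integrable[OF p1(2)] window_integrable[OF periodic_L1_const] by auto
  have "(LINT s:{a..<b}|lborel. 2 * ?m * \<bar>f (x + s)\<bar>) \<le> (LINT s:{a..<b}|lborel. (f (x + s))\<^sup>2 + ?m\<^sup>2)"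
  proof (rule set_integral_mono)
    fix s
    have "2 * ?m * \<bar>f (x + s)\<bar> \<le> ?m\<^sup>2 + \<bar>f (x + s)\<bar>\<^sup>2" by (rule sum_squares_bound)
    then show "2 * ?m * \<bar>f (x + s)\<bar> \<le> (f (x + s))\<^sup>2 + ?m\<^sup>2" by simp
  qed (use i in \<open>auto intro: set_integral_add\<close>)
  also have "\<dots> = window a b (\<lambda>x. (f x)\<^sup>2) x + ?m\<^sup>2 * (b - a)"
    using i ab by (subst set_integral_add) (auto simp: window_def set_lebesgue_integral_def)
  also have "(LINT s:{a..<b}|lborel. 2 * ?m * \<bar>f (x + s)\<bar>) = 2 * ?m * window a b (\<lambda>x. \<bar>f x\<bar>) x"
    by (simp add: window_def)
  finally have "2 * ?m * window a b (\<lambda>x. \<bar>f x\<bar>) x \<le> window a b (\<lambda>x. (f x)\<^sup>2) x + ?m\<^sup>2 * (b - a)" .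
  moreover have "?m\<^sup>2 * (b - a) = ?m * window a b (\<lambda>x. \<bar>f x\<bar>) x"
    using ab by (simp add: power2_eq_square)
  ultimately have "?m * window a b (\<lambda>x. \<bar>f x\<bar>) x \<le> window a b (\<lambda>x. (f x)\<^sup>2) x" by simp
  then show ?thesis using ab by (simp add: divide_le_eq power2_eq_square mult.commute)
qed simp

lemma sq_integrable_window:
  assumes "sq_integrable f" "a \<le> b"
  shows "sq_integrable (window a b f)"
proof -
  have p: "periodic_L1 f" "periodic_L1 (\<lambda>x. \<bar>f x\<bar>)" and m: "f \<in> borel_measurable borel"
    using assms(1) sq_integrable_integrable[OF assms(1)] by (auto simp: periodic_L1_def sq_integrable_def)
  obtain N :: nat where N: "b - a \<le> real N" using real_arch_simple by blast
  have "\<bar>window a b f x\<bar> \<le> real N * (\<integral>x. \<bar>f x\<bar> \<partial>torus)" for x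
  proof -
    have "\<bar>window a b f x\<bar> \<le> window a b (\<lambda>x. \<bar>f x\<bar>) x"
      using set_integral_norm_bound[OF window_integrable[OF p(1), of a b x]] by (simp add: window_def)
    also have "\<dots> \<le> real N * (\<integral>x. \<bar>f x\<bar> \<partial>torus)"
      by (rule window_le[OF p(2)]) (use N assms in auto)
    finally show ?thesis .
  qed
  note bd = this
  have wm: "window a b f \<in> borel_measurable borel" by (rule window_measurable[OF m])
  have "integrable torus (\<lambda>x. 1 * window a b f x)"
    by (rule integrable_torus_bounded_mult[OF _ wm bd]) (simp_all add: finite_measure.integrable_const)
  from integrable_torus_bounded_mult[OF this wm bd] have "integrable torus (\<lambda>x. (window a b f x)\<^sup>2)"
    by (simp add: power2_eq_square)
  then show ?thesis
    using wm p window_periodic[of f a b] by (simp add: sq_integrable_def periodic_L1_def)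
qed

text \<open>Integrals of translates are taken in \<open>L\<^sup>2\<close>, but the estimates of the null form below are
  pointwise in space. Testing with a smooth function and exchanging the order of integration
  connects the two.\<close>

lemma integral_shift_eq_window:
  assumes f: "sq_integrable f" and ab: "a \<le> b"
  shows "integral {a..b} (\<lambda>s. l2_shift s (cls f)) = cls (window a b f)"
proof -
  let ?w = "cls f" and ?W = "cls (window a b f)"
  let ?R = "restrict_space lborel {a..<b}"
  have [measurable]: "f \<in> borel_measurable borel" using f by (simp add: sq_integrable_def)
  interpret R: finite_measure ?R
    using ab by (intro finite_measureI) (simp add: emeasure_restrict_space space_restrict_space)
  interpret T: finite_measure torus by simp
  interpret P: pair_sigma_finite ?R torus ..
  have "integral {a..b} (\<lambda>s. l2_shift s ?w) - ?W = 0"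
  proof (rule smooth_l2_orthogonal_imp_0)
    fix \<phi> assume \<phi>: "smooth_periodic \<phi>"
    let ?p = "cls \<phi>"
    have sp: "sq_integrable \<phi>" by (rule sq_integrable_test[OF \<phi>])
    then have m\<phi>[measurable]: "\<phi> \<in> borel_measurable borel" by (simp add: sq_integrable_def)
    have mp[measurable]: "(\<lambda>p. fst p) \<in> borel_measurable (?R \<Otimes>\<^sub>M torus)" "(\<lambda>p. snd p) \<in> borel_measurable (?R \<Otimes>\<^sub>M torus)"
      by (auto intro!: measurable_compose[OF measurable_fst] measurable_compose[OF measurable_snd] measurable_restrict_space1)
    have mF: "(\<lambda>p. f (snd p + fst p) * \<phi> (snd p)) \<in> borel_measurable (?R \<Otimes>\<^sub>M torus)"
      by measurable
    have in_eq: "inner (l2_shift s ?w) ?p = (\<integral>x. f (x + s) * \<phi> x \<partial>torus)" for s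
      using f sp by (simp add: l2_shift_abs inner_l2_abs sq_integrable_shift)
    have int: "integrable (?R \<Otimes>\<^sub>M torus) (\<lambda>p. f (snd p + fst p) * \<phi> (snd p))"
    proof (rule P.Fubini_integrable[OF mF])
      show "AE s in ?R. integrable torus (\<lambda>x. f (snd (s, x) + fst (s, x)) * \<phi> (snd (s, x)))"
        using sq_integrable_mult[OF sq_integrable_shift[OF f] sp] by simp
      show "integrable ?R (\<lambda>s. \<integral>x. norm (f (snd (s, x) + fst (s, x)) * \<phi> (snd (s, x))) \<partial>torus)"
      proof (rule R.integrable_const_bound)
        show "AE s in ?R. norm (\<integral>x. norm (f (snd (s, x) + fst (s, x)) * \<phi> (snd (s, x))) \<partial>torus)
          \<le> norm (cls (\<lambda>x. \<bar>f x\<bar>)) * norm (cls (\<lambda>x. \<bar>\<phi> x\<bar>))"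
        proof (intro AE_I2)
          fix s
          have "(\<integral>x. norm (f (x + s) * \<phi> x) \<partial>torus) = inner (l2_shift s (cls (\<lambda>x. \<bar>f x\<bar>))) (cls (\<lambda>x. \<bar>\<phi> x\<bar>))"
            using sq_integrable_abs[OF f] sq_integrable_abs[OF sp] sq_integrable_shift[OF sq_integrable_abs[OF f], of s]
            by (simp add: l2_shift_abs inner_l2_abs abs_mult)
          then show "norm (\<integral>x. norm (f (snd (s, x) + fst (s, x)) * \<phi> (snd (s, x))) \<partial>torus)
            \<le> norm (cls (\<lambda>x. \<bar>f x\<bar>)) * norm (cls (\<lambda>x. \<bar>\<phi> x\<bar>))"
            using Cauchy_Schwarz_ineq2[of "l2_shift s (cls (\<lambda>x. \<bar>f x\<bar>))" "cls (\<lambda>x. \<bar>\<phi> x\<bar>)"] by simp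
        qed
        show "(\<lambda>s. \<integral>x. norm (f (snd (s, x) + fst (s, x)) * \<phi> (snd (s, x))) \<partial>torus) \<in> borel_measurable ?R"
          by (rule T.borel_measurable_lebesgue_integral) (use mF in \<open>simp add: case_prod_beta\<close>)
      qed
    qed
    have set_int: "set_integrable lborel {a..b} (\<lambda>s. inner (l2_shift s ?w) ?p)"
      by (intro borel_integrable_atLeastAtMost' continuous_intros)
    have "inner (integral {a..b} (\<lambda>s. l2_shift s ?w)) ?p = integral {a..b} (\<lambda>s. inner (l2_shift s ?w) ?p)"
      by (intro inner_integral_l2 continuous_intros)
    also have "\<dots> = (LINT s:{a..b}|lborel. inner (l2_shift s ?w) ?p)"
      by (rule set_borel_integral_eq_integral(2)[OF set_int, symmetric])
    also have "\<dots> = (LINT s:{a..<b}|lborel. inner (l2_shift s ?w) ?p)"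
      by (rule set_integral_discrete_difference[where X = "{b}"]) auto
    also have "\<dots> = (\<integral>s. inner (l2_shift s ?w) ?p \<partial>?R)"
      unfolding set_lebesgue_integral_def by (rule integral_restrict_space[symmetric]) simp
    also have "\<dots> = (\<integral>s. (\<integral>x. f (x + s) * \<phi> x \<partial>torus) \<partial>?R)" by (simp add: in_eq)
    also have "\<dots> = (\<integral>x. (\<integral>s. f (x + s) * \<phi> x \<partial>?R) \<partial>torus)"
      by (rule P.Fubini_integral[symmetric]) (use int in \<open>simp add: case_prod_unfold\<close>)
    also have "\<dots> = (\<integral>x. window a b f x * \<phi> x \<partial>torus)"
      by (simp add: window_def set_lebesgue_integral_def integral_restrict_space)
    also have "\<dots> = inner ?W ?p"
      by (rule inner_l2_abs[symmetric, OF sq_integrable_window[OF f ab] sp])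
    finally show "inner (integral {a..b} (\<lambda>s. l2_shift s ?w) - ?W) ?p = 0"
      by (simp add: inner_diff_left)
  qed
  then show ?thesis by simp
qed

section \<open>Essential bounds and the Sobolev embedding\<close>

definition ess_bd :: "real \<Rightarrow> l2_torus \<Rightarrow> bool" where
  "ess_bd K u \<longleftrightarrow> (AE x in torus. \<bar>rep u x\<bar> \<le> K)"

lemma ess_bd_abs:
  assumes "sq_integrable f"
  shows "ess_bd K (cls f) \<longleftrightarrow> (AE x in torus. \<bar>f x\<bar> \<le> K)"
  unfolding ess_bd_def
proof
  assume "AE x in torus. \<bar>rep (cls f) x\<bar> \<le> K"
  then show "AE x in torus. \<bar>f x\<bar> \<le> K" using rep_abs_l2[OF assms] by eventually_elim simp
next
  assume "AE x in torus. \<bar>f x\<bar> \<le> K"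
  then show "AE x in torus. \<bar>rep (cls f) x\<bar> \<le> K"
    using rep_abs_l2[OF assms] by eventually_elim simp
qed

lemma ess_bd_add:
  assumes "ess_bd K u" "ess_bd L v" shows "ess_bd (K + L) (u + v)"
  using assms rep_l2_add[of u v] unfolding ess_bd_def by eventually_elim linarith

lemma ess_bd_diff:
  assumes "ess_bd K u" "ess_bd L v" shows "ess_bd (K + L) (u - v)"
  using assms rep_l2_minus[of u v] unfolding ess_bd_def by eventually_elim linarith

lemma ess_bd_scaleR:
  assumes "ess_bd K u" shows "ess_bd (\<bar>c\<bar> * K) (c *\<^sub>R u)"
  using assms rep_l2_scaleR[of c u] unfolding ess_bd_def
  by eventually_elim (simp add: abs_mult mult_left_mono)

lemma ess_bd_mono: "ess_bd K u \<Longrightarrow> K \<le> L \<Longrightarrow> ess_bd L u"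
  unfolding ess_bd_def by (auto elim: eventually_mono)

lemma ess_bd_shift: "ess_bd K u \<Longrightarrow> ess_bd K (l2_shift h u)"
  unfolding ess_bd_def
  using rep_l2_shift[of h u] AE_torus_shift[of "\<lambda>x. \<bar>rep u x\<bar> \<le> K" h]
  by (auto simp: rep_periodic elim!: eventually_elim2)

lemma ess_bd_norm: "ess_bd K u \<Longrightarrow> 0 \<le> K \<Longrightarrow> norm u \<le> K"
  unfolding ess_bd_def using norm_le_of_AE_bound[OF sq_integrable_rep[of u], of K] by (simp add: abs_rep_l2)

lemma sq_integrable_bounded:
  assumes "f \<in> borel_measurable borel" "\<And>x. f (x + 1) = f x" "AE x in torus. \<bar>f x\<bar> \<le> K"
  shows "sq_integrable f"
  unfolding sq_integrable_def
proof (intro conjI allI)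
  show "integrable torus (\<lambda>x. (f x)\<^sup>2)"
  proof (rule finite_measure.integrable_const_bound[OF torus_finite])
    show "AE x in torus. norm ((f x)\<^sup>2) \<le> K\<^sup>2"
      using assms(3) by eventually_elim (simp add: abs_le_square_iff[symmetric])
    show "(\<lambda>x. (f x)\<^sup>2) \<in> borel_measurable torus"
      using assms(1) by (intro borel_measurable_torus) simp
  qed
qed (use assms in auto)

text \<open>Pairing with the indicator function of the set where the asserted bound fails shows that this
  set is null.\<close>

lemma AE_integral_le:
  assumes cf: "continuous_on {a..b} f" and ab: "a \<le> b"
    and le: "\<And>s. s \<in> {a..b} \<Longrightarrow> AE x in torus. rep (f s) x \<le> K"
  shows "AE x in torus. rep (integral {a..b} f) x \<le> K * (b - a)"
proof -
  let ?I = "rep (integral {a..b} f)" and ?c = "K * (b - a)"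
  define e :: "real \<Rightarrow> real" where "e x = (if ?c < ?I x then 1 else 0)" for x
  have se: "sq_integrable e"
  proof (rule sq_integrable_bounded[where K = 1])
    show "e \<in> borel_measurable borel" unfolding e_def by measurable
  qed (auto simp: e_def rep_periodic)
  let ?e = "cls e" and ?one = "cls (\<lambda>x. 1)"
  have i: "inner u ?e = (\<integral>x. rep u x * e x \<partial>torus)" for u
    using inner_l2_abs[OF sq_integrable_rep[of u] se] by (simp add: abs_rep_l2)
  have i1: "inner ?one ?e = (\<integral>x. e x \<partial>torus)"
    by (simp add: inner_l2_abs sq_integrable_const se)
  note int = sq_integrable_mult[OF sq_integrable_rep se] and int1 = sq_integrable_integrable[OF se]
  have "inner (f s) ?e \<le> K * inner ?one ?e" if "s \<in> {a..b}" for s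
  proof -
    have "(\<integral>x. rep (f s) x * e x \<partial>torus) \<le> (\<integral>x. K * e x \<partial>torus)"
    proof (rule integral_mono_AE)
      show "AE x in torus. rep (f s) x * e x \<le> K * e x"
        using le[OF that] by eventually_elim (simp add: e_def)
    qed (use int int1 in auto)
    then show ?thesis by (simp add: i[of "f s"] i1)
  qed
  then have "integral {a..b} (\<lambda>s. inner (f s) ?e) \<le> integral {a..b} (\<lambda>s. K * inner ?one ?e)"
    using cf by (intro integral_le integrable_continuous_real continuous_intros) auto
  then have "inner (integral {a..b} f) ?e \<le> ?c * inner ?one ?e"
    using ab by (simp add: inner_integral_l2[OF cf] algebra_simps)
  then have "(\<integral>x. (?I x - ?c) * e x \<partial>torus) \<le> 0"
    using int[of "integral {a..b} f"] int1 by (simp add: i[of "integral {a..b} f"] i1 left_diff_distrib)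
  moreover have "0 \<le> (\<integral>x. (?I x - ?c) * e x \<partial>torus)"
    by (rule integral_nonneg_AE) (auto simp: e_def)
  ultimately have "(\<integral>x. (?I x - ?c) * e x \<partial>torus) = 0" by simp
  moreover have "integrable torus (\<lambda>x. (?I x - ?c) * e x)"
    using int[of "integral {a..b} f"] int1 by (simp add: left_diff_distrib)
  ultimately have "AE x in torus. (?I x - ?c) * e x = 0"
    by (subst (asm) integral_nonneg_eq_0_iff_AE) (auto simp: e_def)
  then show ?thesis by eventually_elim (auto simp: e_def split: if_splits)
qed

text \<open>The ball of \<open>L\<^sup>\<infinity>\<close> is closed and convex in \<open>L\<^sup>2\<close>, so that essential bounds pass to integrals.\<close>

lemma ess_bd_integral:
  assumes cf: "continuous_on {a..b} f" and ab: "a \<le> b" and bd: "\<And>s. s \<in> {a..b} \<Longrightarrow> ess_bd K (f s)"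
  shows "ess_bd (K * (b - a)) (integral {a..b} f)"
proof -
  have 1: "AE x in torus. rep (integral {a..b} f) x \<le> K * (b - a)"
    using bd by (intro AE_integral_le[OF cf ab]) (force simp: ess_bd_def elim: eventually_mono)
  have "AE x in torus. rep (integral {a..b} (\<lambda>s. (-1) *\<^sub>R f s)) x \<le> K * (b - a)"
  proof (rule AE_integral_le[OF _ ab])
    show "continuous_on {a..b} (\<lambda>s. (-1) *\<^sub>R f s)" by (intro continuous_intros cf)
    show "AE x in torus. rep ((-1) *\<^sub>R f s) x \<le> K" if "s \<in> {a..b}" for s
      using bd[OF that] rep_l2_scaleR[of "-1" "f s"] unfolding ess_bd_def by eventually_elim linarith
  qed
  then have "AE x in torus. rep ((-1) *\<^sub>R integral {a..b} f) x \<le> K * (b - a)"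
    by (simp only: integral_cmul)
  then show ?thesis
    unfolding ess_bd_def using 1 rep_l2_scaleR[of "-1" "integral {a..b} f"] by eventually_elim linarith
qed

definition one_l2 :: l2_torus where "one_l2 = cls (\<lambda>x. 1)"

definition mean :: "l2_torus \<Rightarrow> real" where "mean u = inner u one_l2"

lemma norm_one [simp]: "norm one_l2 = 1"
  by (simp add: one_l2_def norm_one_l2)

lemma bounded_linear_mean: "bounded_linear mean"
  unfolding mean_def by (rule bounded_linear_inner_left)

lemmas mean_simps [simp] = bounded_linear.linear[OF bounded_linear_mean, THEN linear_0]
  bounded_linear.linear[OF bounded_linear_mean, THEN linear_diff]
  bounded_linear.linear[OF bounded_linear_mean, THEN linear_neg]
  bounded_linear.linear[OF bounded_linear_mean, THEN linear_add]
  bounded_linear.linear[OF bounded_linear_mean, THEN linear_cmul]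

lemma l2_shift_one [simp]: "l2_shift h one_l2 = one_l2"
  by (simp add: one_l2_def l2_shift_abs sq_integrable_const)

lemma mean_shift [simp]: "mean (l2_shift h u) = mean u"
  by (simp add: mean_def inner_l2_shift)

lemma mean_one [simp]: "mean one_l2 = 1"
  by (simp add: mean_def power2_norm_eq_inner[symmetric])

lemma abs_mean_le: "\<bar>mean u\<bar> \<le> norm u"
  using Cauchy_Schwarz_ineq2[of u one_l2] by (simp add: mean_def)

lemma has_weak_deriv_one: "has_weak_deriv one_l2 0"
  by (simp add: has_weak_deriv_iff_shift_derivative)

lemma mean_has_weak_deriv: "has_weak_deriv u w \<Longrightarrow> mean w = 0"
  using has_weak_deriv_inner[OF _ has_weak_deriv_one, of u w] by (simp add: mean_def)

lemma mean_weak_deriv [simp]: "mean (weak_deriv u) = 0"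
  by (rule mean_has_weak_deriv[OF has_weak_deriv_weak_deriv])

lemma mean_rep: "mean u = (\<integral>x. rep u x \<partial>torus)"
  using inner_l2_abs[OF sq_integrable_rep[of u] sq_integrable_const[of 1]]
  by (simp add: mean_def one_l2_def abs_rep_l2)

lemma integral_shift_unit: "integral {0..1} (\<lambda>s. l2_shift s u) = mean u *\<^sub>R one_l2"
proof -
  have "window 0 1 (rep u) = (\<lambda>x. mean u)"
    by (rule ext) (simp add: mean_rep window_unit[OF periodic_L1_rep(1)])
  then have "integral {0..1} (\<lambda>s. l2_shift s u) = cls (\<lambda>x. mean u)"
    using integral_shift_eq_window[OF sq_integrable_rep[of u], of 0 1] by (simp add: abs_rep_l2)
  then show ?thesis by (simp add: one_l2_def abs_l2_scaleR sq_integrable_const)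
qed

lemma ess_bd_integral_shift:
  assumes "0 \<le> h" "h \<le> 1"
  shows "ess_bd (norm w) (integral {0..h} (\<lambda>s. l2_shift s w))"
proof -
  have "\<bar>window 0 h (rep w) x\<bar> \<le> norm w" for x
  proof -
    have "\<bar>window 0 h (rep w) x\<bar> \<le> window 0 h (\<lambda>x. \<bar>rep w x\<bar>) x"
      using set_integral_norm_bound[OF window_integrable[OF periodic_L1_rep(1)[of w], of 0 h x]] by (simp add: window_def)
    also have "\<dots> \<le> real 1 * (\<integral>x. \<bar>rep w x\<bar> \<partial>torus)"
      using assms by (intro window_le periodic_L1_rep) auto
    also have "\<dots> \<le> norm w" using integral_abs_le_norm by simp
    finally show ?thesis .
  qed
  then show ?thesis
    using integral_shift_eq_window[OF sq_integrable_rep[of w] assms(1)]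
    by (simp add: abs_rep_l2 ess_bd_abs sq_integrable_window sq_integrable_rep assms)
qed

text \<open>Poincare's inequality in \<open>L\<^sup>\<infinity>\<close>: the deviation from the mean is an average of increments, each of
  which is the integral of the derivative over an interval of length at most one.\<close>

lemma ess_bd_minus_mean: "ess_bd (norm (weak_deriv u)) (l2_of_h1 u - mean (l2_of_h1 u) *\<^sub>R one_l2)"
proof -
  let ?u = "l2_of_h1 u"
  have "?u - mean ?u *\<^sub>R one_l2 = integral {0..1} (\<lambda>s. ?u - l2_shift s ?u)"
    using integral_diff[of "\<lambda>s. ?u" "{0..1::real}" "\<lambda>s. l2_shift s ?u"]
    by (simp add: integral_shift_unit integrable_continuous_real l2_shift_continuous_real)
  moreover have "ess_bd (norm (weak_deriv u) * (1 - 0)) (integral {0..1} (\<lambda>s. ?u - l2_shift s ?u))"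
  proof (rule ess_bd_integral)
    show "ess_bd (norm (weak_deriv u)) (?u - l2_shift s ?u)" if s: "s \<in> {0..1}" for s
    proof -
      have "integral {0..s} (\<lambda>s. l2_shift s (weak_deriv u)) = l2_shift s ?u - ?u"
        using l2_shift_diff_integral[OF has_weak_deriv_weak_deriv[of u], of 0 s] s by simp
      then show ?thesis
        using ess_bd_scaleR[OF ess_bd_integral_shift[of s "weak_deriv u"], of "-1"] s by simp
    qed
  qed (auto intro!: continuous_intros)
  ultimately show ?thesis by simp
qed

lemma norm_l2_of_h1_poincare: "norm (l2_of_h1 u) \<le> \<bar>mean (l2_of_h1 u)\<bar> + norm (weak_deriv u)"
proof -
  have "norm (l2_of_h1 u - mean (l2_of_h1 u) *\<^sub>R one_l2) \<le> norm (weak_deriv u)"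
    by (rule ess_bd_norm[OF ess_bd_minus_mean]) simp
  then show ?thesis
    using norm_triangle_sub[of "l2_of_h1 u" "mean (l2_of_h1 u) *\<^sub>R one_l2"] by simp
qed

lemma ess_bd_l2_of_h1: "ess_bd (2 * norm u) (l2_of_h1 u)"
proof -
  have "ess_bd (\<bar>mean (l2_of_h1 u)\<bar> * 1) (mean (l2_of_h1 u) *\<^sub>R one_l2)"
    by (rule ess_bd_scaleR) (simp add: one_l2_def ess_bd_abs sq_integrable_const)
  from ess_bd_add[OF ess_bd_minus_mean[of u] this]
  have "ess_bd (norm (weak_deriv u) + \<bar>mean (l2_of_h1 u)\<bar>) (l2_of_h1 u)" by simp
  then show ?thesis
    by (rule ess_bd_mono)
       (use abs_mean_le[of "l2_of_h1 u"] norm_l2_of_h1_le[of u] norm_weak_deriv_le[of u] in linarith)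
qed

text \<open>Integration by parts in \<open>s\<close> on \<open>{0..1}\<close>: the weight \<open>1 - s\<close> leaves the boundary term \<open>w\<close> at \<open>s = 0\<close>,
  and its derivative produces the average of all translates, which is the mean of \<open>w\<close>.\<close>

lemma has_weak_deriv_primitive:
  "has_weak_deriv (- integral {0..1} (\<lambda>s. (1 - s) *\<^sub>R l2_shift s w)) (w - mean w *\<^sub>R one_l2)"
  unfolding has_weak_deriv_iff
proof (intro allI impI)
  fix \<phi> assume \<phi>: "smooth_periodic \<phi>"
  let ?p = "cls \<phi>" and ?d = "cls (deriv \<phi>)"
  have c: "continuous_on {0..1} (\<lambda>s. (1 - s) *\<^sub>R l2_shift s w)" by (intro continuous_intros)
  have "((\<lambda>s. - (1 - s) * inner (l2_shift s w) ?d - inner (l2_shift s w) ?p) has_integral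
      (1 - 1) * inner w (l2_shift (-1 * 1) ?p) - (1 - 0) * inner w (l2_shift (-1 * 0) ?p)) {0..1}"
  proof (rule fundamental_theorem_of_calculus)
    fix s :: real
    have "((\<lambda>s. inner w (l2_shift (-1 * s) ?p)) has_vector_derivative inner w ((-1) *\<^sub>R l2_shift (-1 * s) ?d)) (at s within {0..1})"
      by (intro bounded_linear.has_vector_derivative[OF bounded_linear_inner_right] smooth_shift_derivative[OF \<phi>])
    then show "((\<lambda>s. (1 - s) * inner w (l2_shift (-1 * s) ?p)) has_vector_derivative
      - (1 - s) * inner (l2_shift s w) ?d - inner (l2_shift s w) ?p) (at s within {0..1})"
      unfolding has_real_derivative_iff_has_vector_derivative[symmetric]
      by (auto intro!: derivative_eq_intros simp: inner_l2_shift algebra_simps)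
  qed simp
  then have "integral {0..1} (\<lambda>s. - (1 - s) * inner (l2_shift s w) ?d - inner (l2_shift s w) ?p) = - inner w ?p"
    by (simp add: integral_unique)
  moreover have "integral {0..1} (\<lambda>s. - (1 - s) * inner (l2_shift s w) ?d - inner (l2_shift s w) ?p)
     = - integral {0..1} (\<lambda>s. (1 - s) * inner (l2_shift s w) ?d) - integral {0..1} (\<lambda>s. inner (l2_shift s w) ?p)"
    unfolding mult_minus_left
    by (subst integral_diff) (auto intro!: integrable_continuous_real continuous_intros)
  moreover have "integral {0..1} (\<lambda>s. inner (l2_shift s w) ?p) = mean w * inner one_l2 ?p"
    using inner_integral_l2[OF l2_shift_continuous_real, of 0 1 w ?p] by (simp add: integral_shift_unit)
  moreover have "inner (integral {0..1} (\<lambda>s. (1 - s) *\<^sub>R l2_shift s w)) ?d = integral {0..1} (\<lambda>s. (1 - s) * inner (l2_shift s w) ?d)"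
    using inner_integral_l2[OF c, of ?d] by simp
  ultimately show "inner (- integral {0..1} (\<lambda>s. (1 - s) *\<^sub>R l2_shift s w)) ?d = - inner (w - mean w *\<^sub>R one_l2) ?p"
    by (simp add: inner_diff_left)
qed

lemma h1_primitive_exists:
  "\<exists>u. weak_deriv u = w - mean w *\<^sub>R one_l2 \<and> mean (l2_of_h1 u) = c"
proof -
  let ?z = "- integral {0..1} (\<lambda>s. (1 - s) *\<^sub>R l2_shift s w)"
  have "has_weak_deriv (?z + (c - mean ?z) *\<^sub>R one_l2) (w - mean w *\<^sub>R one_l2 + (c - mean ?z) *\<^sub>R 0)"
    by (intro has_weak_deriv_add has_weak_deriv_primitive has_weak_deriv_scaleR has_weak_deriv_one)
  then show ?thesis
    by (intro exI[of _ "h1_of_l2 (?z + (c - mean ?z) *\<^sub>R one_l2)"])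
       (simp add: weak_deriv_h1_of_l2 l2_of_h1_of_l2 del: mean_simps(3), simp)
qed

lemma h1_eqI:
  assumes "weak_deriv u = weak_deriv v" "mean (l2_of_h1 u) = mean (l2_of_h1 v)"
  shows "u = v"
proof -
  have "norm (l2_of_h1 (u - v)) \<le> 0"
    using norm_l2_of_h1_poincare[of "u - v"] assms by simp
  then have "norm (u - v) \<le> 0" using norm_h1_le[of "u - v"] assms by simp
  then show ?thesis by simp
qed

section \<open>Riemann invariants and the wave group\<close>

type_synonym state = "h1_torus \<times> l2_torus"

text \<open>For \<open>\<sigma> = 1\<close> and \<open>\<sigma> = -1\<close> these are the two Riemann invariants \<open>v + \<partial>\<^sub>xu\<close> and \<open>v - \<partial>\<^sub>xu\<close> of the wave
  equation; the linear flow translates them with velocity \<open>-\<sigma>\<close>.\<close>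

definition riem :: "real \<Rightarrow> state \<Rightarrow> l2_torus" where
  "riem \<sigma> z = snd z + \<sigma> *\<^sub>R weak_deriv (fst z)"

definition fmean :: "state \<Rightarrow> real" where
  "fmean z = mean (l2_of_h1 (fst z))"

lemma bounded_linear_riem: "bounded_linear (riem \<sigma>)"
  unfolding riem_def
  by (intro bounded_linear_add bounded_linear_snd bounded_linear_compose[OF bounded_linear_scaleR_right]
      bounded_linear_compose[OF bounded_linear_weak_deriv] bounded_linear_fst)

lemma bounded_linear_fmean: "bounded_linear fmean"
  unfolding fmean_def
  by (intro bounded_linear_compose[OF bounded_linear_mean] bounded_linear_compose[OF bounded_linear_l2_of_h1] bounded_linear_fst)

lemma riem_simps [simp]: "riem \<sigma> 0 = 0" "riem \<sigma> (x + y) = riem \<sigma> x + riem \<sigma> y"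
  "riem \<sigma> (x - y) = riem \<sigma> x - riem \<sigma> y" "riem \<sigma> (- x) = - riem \<sigma> x" "riem \<sigma> (c *\<^sub>R x) = c *\<^sub>R riem \<sigma> x"
  using bounded_linear.linear[OF bounded_linear_riem]
  by (auto intro: linear_0 linear_add linear_diff linear_neg linear_cmul)

lemma fmean_simps [simp]: "fmean 0 = 0" "fmean (x + y) = fmean x + fmean y"
  "fmean (x - y) = fmean x - fmean y" "fmean (- x) = - fmean x" "fmean (c *\<^sub>R x) = c * fmean x"
  by (simp_all add: fmean_def)

lemma snd_riem: "snd z = (1/2) *\<^sub>R (riem 1 z + riem (-1) z)"
  by (simp add: riem_def flip: scaleR_2)

lemma weak_deriv_riem: "weak_deriv (fst z) = (1/2) *\<^sub>R (riem 1 z - riem (-1) z)"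
  by (simp add: riem_def flip: scaleR_2)

lemma mean_riem: "mean (riem \<sigma> z) = mean (snd z)"
  by (simp add: riem_def)

text \<open>The mean of \<open>u\<close> and the two Riemann invariants are coordinates on the energy space in which the
  linear flow is explicit. They determine a state, and by Poincare's inequality they control its
  norm, so that identities, limits and derivatives of states may be verified coordinate by
  coordinate.\<close>

lemma state_eqI:
  assumes "fmean z = fmean z'" "riem 1 z = riem 1 z'" "riem (-1) z = riem (-1) z'"
  shows "z = z'"
proof (rule prod_eqI)
  show "fst z = fst z'"
    using assms by (intro h1_eqI) (simp_all add: weak_deriv_riem fmean_def)
  show "snd z = snd z'" using assms by (simp add: snd_riem)
qed

lemma norm_state_le: "norm z \<le> \<bar>fmean z\<bar> + 2 * (norm (riem 1 z) + norm (riem (-1) z))"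
proof -
  have "norm z \<le> norm (fst z) + norm (snd z)"
    by (metis norm_Pair_le prod.collapse)
  moreover have "norm (fst z) \<le> \<bar>fmean z\<bar> + 2 * norm (weak_deriv (fst z))"
    using norm_h1_le[of "fst z"] norm_l2_of_h1_poincare[of "fst z"] by (simp add: fmean_def)
  moreover have "norm (weak_deriv (fst z)) \<le> (1/2) * (norm (riem 1 z) + norm (riem (-1) z))"
    unfolding weak_deriv_riem using norm_triangle_ineq4[of "riem 1 z" "riem (-1) z"] by simp
  moreover have "norm (snd z) \<le> (1/2) * (norm (riem 1 z) + norm (riem (-1) z))"
    unfolding snd_riem using norm_triangle_ineq[of "riem 1 z" "riem (-1) z"] by simp
  moreover have "0 \<le> norm (riem 1 z)" "0 \<le> norm (riem (-1) z)" by simp_all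
  ultimately show ?thesis by argo
qed

lemma norm_state_sq: "(norm z)\<^sup>2 = (norm (l2_of_h1 (fst z)))\<^sup>2 + (1/2) * ((norm (riem 1 z))\<^sup>2 + (norm (riem (-1) z))\<^sup>2)"
proof -
  have "(norm z)\<^sup>2 = (norm (fst z))\<^sup>2 + (norm (snd z))\<^sup>2"
    by (simp add: norm_prod_def)
  also have "\<dots> = (norm (l2_of_h1 (fst z)))\<^sup>2 + ((norm (weak_deriv (fst z)))\<^sup>2 + (norm (snd z))\<^sup>2)"
    by (simp add: norm_h1_sq)
  also have "(norm (weak_deriv (fst z)))\<^sup>2 + (norm (snd z))\<^sup>2 = (1/2) * ((norm (riem 1 z))\<^sup>2 + (norm (riem (-1) z))\<^sup>2)"
    unfolding riem_def power2_norm_eq_inner by (simp add: inner_simps inner_commute)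
  finally show ?thesis .
qed

lemma norm_fst_state_le: "norm (fst (z :: state)) \<le> norm z"
  and norm_snd_state_le: "norm (snd (z :: state)) \<le> norm z"
  using norm_fst_le[of "fst z" "snd z"] norm_snd_le[of "snd z" "fst z"] by simp_all

lemma norm_riem_le:
  assumes "\<sigma> = 1 \<or> \<sigma> = -1"
  shows "norm (riem \<sigma> z) \<le> 2 * norm z"
proof -
  have "norm (snd z) \<le> norm z" "norm (weak_deriv (fst z)) \<le> norm z"
    using norm_snd_state_le[of z] norm_fst_state_le[of z] norm_weak_deriv_le[of "fst z"] by linarith+
  then show ?thesis
    using assms norm_triangle_ineq[of "snd z" "\<sigma> *\<^sub>R weak_deriv (fst z)"] by (auto simp: riem_def)
qed

lemma tendsto_state:
  assumes "((\<lambda>x. fmean (f x)) \<longlongrightarrow> fmean z) F" "((\<lambda>x. riem 1 (f x)) \<longlongrightarrow> riem 1 z) F"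
    "((\<lambda>x. riem (-1) (f x)) \<longlongrightarrow> riem (-1) z) F"
  shows "(f \<longlongrightarrow> z) F"
proof -
  have "((\<lambda>x. \<bar>fmean (f x - z)\<bar> + 2 * (norm (riem 1 (f x - z)) + norm (riem (-1) (f x - z)))) \<longlongrightarrow> 0) F"
    using assms by (auto intro!: tendsto_eq_intros simp: LIM_zero)
  then have "((\<lambda>x. f x - z) \<longlongrightarrow> 0) F"
    by (rule Lim_null_comparison[rotated]) (intro always_eventually allI norm_state_le)
  then show ?thesis by (simp add: LIM_zero_iff)
qed

lemma state_has_vector_derivative:
  assumes "((\<lambda>x. fmean (f x)) has_vector_derivative fmean D) (at x within S)"
    "((\<lambda>x. riem 1 (f x)) has_vector_derivative riem 1 D) (at x within S)"
    "((\<lambda>x. riem (-1) (f x)) has_vector_derivative riem (-1) D) (at x within S)"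
  shows "(f has_vector_derivative D) (at x within S)"
  using assms unfolding has_vector_derivative_quotient
  by (intro tendsto_state) (simp_all add: real_scaleR_def[symmetric] del: real_scaleR_def)

text \<open>The three coordinates on the right determine a state. A state with these coordinates exists
  because both invariants have the mean of \<open>v\<close>, so that their difference has a periodic primitive.\<close>

definition wave_flow :: "real \<Rightarrow> state \<Rightarrow> state" where
  "wave_flow t z = (SOME z'. fmean z' = fmean z + t * mean (snd z) \<and>
     riem 1 z' = l2_shift t (riem 1 z) \<and> riem (-1) z' = l2_shift (- t) (riem (-1) z))"

lemma wave_flow_props:
  "fmean (wave_flow t z) = fmean z + t * mean (snd z) \<and>
     riem 1 (wave_flow t z) = l2_shift t (riem 1 z) \<and> riem (-1) (wave_flow t z) = l2_shift (- t) (riem (-1) z)"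
proof -
  define p q where "p = l2_shift t (riem 1 z)" and "q = l2_shift (- t) (riem (-1) z)"
  have half: "(1/2) *\<^sub>R (p + q) + (1/2) *\<^sub>R (p - q) = p" "(1/2) *\<^sub>R (p + q) - (1/2) *\<^sub>R (p - q) = q"
    unfolding scaleR_add_right[symmetric] scaleR_diff_right[symmetric]
    using scaleR_half_double[of p] scaleR_half_double[of q] by simp_all
  obtain u where u: "weak_deriv u = (1/2) *\<^sub>R (p - q) - mean ((1/2) *\<^sub>R (p - q)) *\<^sub>R one_l2"
      "mean (l2_of_h1 u) = fmean z + t * mean (snd z)"
    using h1_primitive_exists by blast
  have "mean p = mean q" by (simp only: p_def q_def mean_shift mean_riem)
  then have "weak_deriv u = (1/2) *\<^sub>R (p - q)" using u(1) by simp
  then have "riem 1 (u, (1/2) *\<^sub>R (p + q)) = p \<and> riem (-1) (u, (1/2) *\<^sub>R (p + q)) = q"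
    unfolding riem_def using half by simp
  then have "\<exists>z'. fmean z' = fmean z + t * mean (snd z) \<and> riem 1 z' = p \<and> riem (-1) z' = q"
    using u(2) by (intro exI[of _ "(u, (1/2) *\<^sub>R (p + q))"]) (simp add: fmean_def)
  from someI_ex[OF this] show ?thesis
    unfolding wave_flow_def p_def[symmetric] q_def[symmetric] .
qed

lemma fmean_wave_flow [simp]: "fmean (wave_flow t z) = fmean z + t * mean (snd z)"
  and riem_wave_flow1: "riem 1 (wave_flow t z) = l2_shift t (riem 1 z)"
  and riem_wave_flow2: "riem (-1) (wave_flow t z) = l2_shift (- t) (riem (-1) z)"
  using wave_flow_props by blast+

lemma riem_wave_flow: "\<sigma> = 1 \<or> \<sigma> = -1 \<Longrightarrow> riem \<sigma> (wave_flow t z) = l2_shift (\<sigma> * t) (riem \<sigma> z)"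
  by (elim disjE) (simp_all add: riem_wave_flow1 riem_wave_flow2)

lemma mean_snd_wave_flow [simp]: "mean (snd (wave_flow t z)) = mean (snd z)"
  by (metis mean_riem mean_shift riem_wave_flow1)

lemma wave_flow_0 [simp]: "wave_flow 0 z = z"
  by (rule state_eqI) (simp_all add: riem_wave_flow1 riem_wave_flow2)

lemma wave_flow_flow [simp]: "wave_flow s (wave_flow t z) = wave_flow (s + t) z"
  by (rule state_eqI) (simp_all add: riem_wave_flow1 riem_wave_flow2 algebra_simps)

lemma wave_flow_simps [simp]: "wave_flow t 0 = 0" "wave_flow t (x + y) = wave_flow t x + wave_flow t y"
  "wave_flow t (x - y) = wave_flow t x - wave_flow t y" "wave_flow t (- x) = - wave_flow t x"
  "wave_flow t (c *\<^sub>R x) = c *\<^sub>R wave_flow t x"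
  by (rule state_eqI; simp add: riem_wave_flow1 riem_wave_flow2 algebra_simps)+

lemma wave_flow_tendsto:
  assumes "(f \<longlongrightarrow> z) F" "(c \<longlongrightarrow> t) F"
  shows "((\<lambda>x. wave_flow (c x) (f x)) \<longlongrightarrow> wave_flow t z) F"
proof (rule tendsto_state)
  show "((\<lambda>x. fmean (wave_flow (c x) (f x))) \<longlongrightarrow> fmean (wave_flow t z)) F"
    by (auto intro!: tendsto_intros assms bounded_linear.tendsto[OF bounded_linear_fmean] bounded_linear.tendsto[OF bounded_linear_mean])
qed (auto simp: riem_wave_flow1 riem_wave_flow2 intro!: l2_shift_tendsto tendsto_intros assms bounded_linear.tendsto[OF bounded_linear_riem])

lemma wave_flow_continuous_on [continuous_intros]:
  assumes "continuous_on S f" "continuous_on S c"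
  shows "continuous_on S (\<lambda>x. wave_flow (c x) (f x))"
  using assms by (auto simp: continuous_on_def intro: wave_flow_tendsto)

text \<open>The energy is half the sum of the squared norms of the two invariants, which the flow translates.\<close>

lemma norm_snd_wave_flow_le: "norm (snd (wave_flow t z)) \<le> norm z"
proof (rule power2_le_imp_le)
  have "(norm (snd (wave_flow t z)))\<^sup>2 + (norm (weak_deriv (fst (wave_flow t z))))\<^sup>2 = (1/2) * ((norm (riem 1 z))\<^sup>2 + (norm (riem (-1) z))\<^sup>2)"
  proof -
    have "(norm (snd y))\<^sup>2 + (norm (weak_deriv (fst y)))\<^sup>2 = (1/2) * ((norm (riem 1 y))\<^sup>2 + (norm (riem (-1) y))\<^sup>2)" for y
      unfolding riem_def power2_norm_eq_inner by (simp add: inner_simps inner_commute)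
    from this[of "wave_flow t z"] show ?thesis by (simp add: riem_wave_flow1 riem_wave_flow2)
  qed
  moreover have "(norm z)\<^sup>2 \<ge> (1/2) * ((norm (riem 1 z))\<^sup>2 + (norm (riem (-1) z))\<^sup>2)" by (simp add: norm_state_sq)
  moreover have "0 \<le> (norm (weak_deriv (fst (wave_flow t z))))\<^sup>2" by simp
  ultimately show "(norm (snd (wave_flow t z)))\<^sup>2 \<le> (norm z)\<^sup>2" by linarith
qed simp

lemma integral_reflect_shift:
  "integral {a..b} (\<lambda>s. l2_shift (- s) w) = integral {- b..- a} (\<lambda>s. l2_shift s w)"
proof -
  have "((\<lambda>s. l2_shift s w) has_integral integral {- b..- a} (\<lambda>s. l2_shift s w)) {- b..- a}"
    by (intro integrable_integral integrable_continuous_real l2_shift_continuous_real)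
  from has_integral_reflect_lemma_real[OF this]
  show ?thesis by (simp add: integral_unique)
qed

text \<open>Both sides have the same weak derivative, because integrating translates inverts
  differentiation, and the same mean.\<close>

lemma l2_fst_wave_flow_diff:
  assumes ab: "a \<le> b"
  shows "l2_of_h1 (fst (wave_flow b z)) - l2_of_h1 (fst (wave_flow a z)) = integral {a..b} (\<lambda>s. snd (wave_flow s z))"
proof -
  let ?p = "riem 1 z" and ?q = "riem (-1) z"
  let ?I = "integral {a..b} (\<lambda>s. snd (wave_flow s z))"
  have snd_eq: "snd (wave_flow s z) = (1/2) *\<^sub>R (l2_shift s ?p + l2_shift (- s) ?q)" for s
    by (simp add: snd_riem riem_wave_flow1 riem_wave_flow2)
  have I: "?I = (1/2) *\<^sub>R (integral {a..b} (\<lambda>s. l2_shift s ?p) + integral {- b..- a} (\<lambda>s. l2_shift s ?q))"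
    unfolding snd_eq integral_reflect_shift[symmetric]
    by (subst integral_cmul, subst integral_add) (auto intro!: integrable_continuous_real continuous_intros)
  have "has_weak_deriv ?I ((1/2) *\<^sub>R ((l2_shift b ?p - l2_shift a ?p) + (l2_shift (- a) ?q - l2_shift (- b) ?q)))"
    unfolding I by (intro has_weak_deriv_scaleR has_weak_deriv_add has_weak_deriv_integral_shift) (use ab in auto)
  moreover have "(1/2) *\<^sub>R ((l2_shift b ?p - l2_shift a ?p) + (l2_shift (- a) ?q - l2_shift (- b) ?q))
      = weak_deriv (fst (wave_flow b z) - fst (wave_flow a z))"
    by (simp add: weak_deriv_riem riem_wave_flow1 riem_wave_flow2 algebra_simps)
  ultimately have w: "has_weak_deriv ?I (weak_deriv (fst (wave_flow b z) - fst (wave_flow a z)))" by simp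
  have "mean ?I = integral {a..b} (\<lambda>s. mean (snd (wave_flow s z)))"
    by (rule integral_bounded_linear_image[OF _ bounded_linear_mean]) (intro continuous_intros)
  then have m: "mean ?I = (b - a) * mean (snd z)" using ab by simp
  have "h1_of_l2 ?I = fst (wave_flow b z) - fst (wave_flow a z)"
  proof (rule h1_eqI)
    show "weak_deriv (h1_of_l2 ?I) = weak_deriv (fst (wave_flow b z) - fst (wave_flow a z))"
      by (rule weak_deriv_h1_of_l2[OF w])
    show "mean (l2_of_h1 (h1_of_l2 ?I)) = mean (l2_of_h1 (fst (wave_flow b z) - fst (wave_flow a z)))"
      using fmean_wave_flow[of a z] fmean_wave_flow[of b z]
      by (simp add: l2_of_h1_of_l2[OF w] m fmean_def algebra_simps del: fmean_wave_flow)
  qed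
  then show ?thesis using l2_of_h1_of_l2[OF w] by simp
qed

text \<open>The energy is conserved, and only the \<open>L\<^sup>2\<close> norm of \<open>u\<close> grows, at the rate of the norm of \<open>v\<close>. The
  factor tends to one as \<open>t\<close> tends to zero, as the stability of the scheme over many short steps
  requires.\<close>

lemma norm_wave_flow_le: "norm (wave_flow t z) \<le> (1 + \<bar>t\<bar>) * norm z"
proof -
  let ?a = "norm (l2_of_h1 (fst z))" and ?a' = "norm (l2_of_h1 (fst (wave_flow t z)))"
  have "norm (l2_of_h1 (fst (wave_flow t z)) - l2_of_h1 (fst z)) \<le> norm z * \<bar>t\<bar>"
  proof (cases "0 \<le> t")
    case True
    have "norm (integral {0..t} (\<lambda>s. snd (wave_flow s z))) \<le> norm z * (t - 0)"
      by (rule integral_bound) (auto intro!: continuous_intros norm_snd_wave_flow_le True)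
    then show ?thesis using l2_fst_wave_flow_diff[OF True, of z] True by simp
  next
    case False
    have "norm (integral {t..0} (\<lambda>s. snd (wave_flow s z))) \<le> norm z * (0 - t)"
      by (rule integral_bound) (use False in \<open>auto intro!: continuous_intros norm_snd_wave_flow_le\<close>)
    then show ?thesis using l2_fst_wave_flow_diff[of t 0 z] False by (simp add: norm_minus_commute)
  qed
  then have "?a' \<le> ?a + norm z * \<bar>t\<bar>"
    using norm_triangle_sub[of "l2_of_h1 (fst (wave_flow t z))" "l2_of_h1 (fst z)"] by linarith
  then have "?a'\<^sup>2 \<le> (?a + norm z * \<bar>t\<bar>)\<^sup>2" by (intro power_mono) auto
  moreover have "?a * (norm z * \<bar>t\<bar>) \<le> norm z * (norm z * \<bar>t\<bar>)"
    using norm_l2_of_h1_le[of "fst z"] norm_fst_state_le[of z] by (intro mult_right_mono) (linarith, simp)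
  moreover have "(norm (wave_flow t z))\<^sup>2 - ?a'\<^sup>2 = (norm z)\<^sup>2 - ?a\<^sup>2"
    by (simp add: norm_state_sq riem_wave_flow1 riem_wave_flow2)
  ultimately have "(norm (wave_flow t z))\<^sup>2 \<le> (norm z + norm z * \<bar>t\<bar>)\<^sup>2"
    unfolding power2_sum by linarith
  then have "norm (wave_flow t z) \<le> norm z + norm z * \<bar>t\<bar>"
    by (rule power2_le_imp_le) simp
  then show ?thesis by (simp add: algebra_simps)
qed

lemma bounded_linear_wave_flow: "bounded_linear (wave_flow t)"
  by (rule bounded_linear_intro[of _ "1 + \<bar>t\<bar>"]) (use norm_wave_flow_le in \<open>auto simp: mult.commute\<close>)

section \<open>Solutions of the wave equation and Duhamel's formula\<close>

text \<open>The distributional derivative as an operator from \<open>L\<^sup>2\<close> to \<open>H\<^sup>-\<^sup>1\<close>.\<close>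

lift_definition hm1_dx :: "l2_torus \<Rightarrow> hm1_torus" is "\<lambda>w \<phi>. - inner w (weak_deriv \<phi>)"
  by (rule bounded_linear_minus[OF bounded_linear_compose[OF bounded_linear_inner_right bounded_linear_weak_deriv]])

lemma bounded_linear_hm1_dx: "bounded_linear hm1_dx"
proof (rule bounded_linear_intro[of _ 1])
  show "hm1_dx (x + y) = hm1_dx x + hm1_dx y" for x y
    by (rule blinfun_eqI) (simp add: hm1_dx.rep_eq inner_add_left plus_blinfun.rep_eq)
  show "hm1_dx (r *\<^sub>R x) = r *\<^sub>R hm1_dx x" for r x
    by (rule blinfun_eqI) (simp add: hm1_dx.rep_eq scaleR_blinfun.rep_eq)
  show "norm (hm1_dx x) \<le> norm x * 1" for x
  proof (rule norm_blinfun_bound)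
    fix \<phi>
    have "\<bar>inner x (weak_deriv \<phi>)\<bar> \<le> norm x * norm (weak_deriv \<phi>)" by (rule Cauchy_Schwarz_ineq2)
    also have "\<dots> \<le> norm x * norm \<phi>" by (intro mult_left_mono norm_weak_deriv_le) simp
    finally show "norm (blinfun_apply (hm1_dx x) \<phi>) \<le> norm x * 1 * norm \<phi>" by (simp add: hm1_dx.rep_eq)
  qed simp
qed

lemma dxx_eq: "dxx u = hm1_dx (weak_deriv u)"
  by (rule blinfun_eqI) (simp add: hm1_dx.rep_eq dxx.rep_eq)

lemma hm1_of_l2_diff: "hm1_of_l2 (x - y) = hm1_of_l2 x - hm1_of_l2 y"
  by (rule blinfun_eqI) (simp add: hm1_of_l2.rep_eq inner_diff_left minus_blinfun.rep_eq)

lemma hm1_of_l2_0: "hm1_of_l2 0 = 0"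
  by (rule blinfun_eqI) (simp add: hm1_of_l2.rep_eq)

lemma hm1_of_l2_weak_deriv:
  assumes "has_weak_deriv u w"
  shows "hm1_of_l2 w = hm1_dx u"
  by (rule blinfun_eqI)
     (use has_weak_deriv_inner[OF assms has_weak_deriv_weak_deriv] in \<open>simp add: hm1_of_l2.rep_eq hm1_dx.rep_eq\<close>)

lemma riem_zero_snd [simp]: "riem \<sigma> (0, f) = f" and fmean_zero_fst [simp]: "fmean (0, f) = 0"
  by (simp_all add: riem_def fmean_def)

lemma wave_flow_continuous_real: "continuous_on S (\<lambda>t. wave_flow t z)"
  by (intro continuous_intros)

lemma hm1_snd_wave_flow_diff:
  assumes ab: "a \<le> b"
  shows "hm1_of_l2 (snd (wave_flow b z)) - hm1_of_l2 (snd (wave_flow a z))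
    = integral {a..b} (\<lambda>s. hm1_dx (weak_deriv (fst (wave_flow s z))))"
proof -
  let ?p = "riem 1 z" and ?q = "riem (-1) z"
  let ?I = "integral {a..b} (\<lambda>s. weak_deriv (fst (wave_flow s z)))"
  have wd: "weak_deriv (fst (wave_flow s z)) = (1/2) *\<^sub>R (l2_shift s ?p - l2_shift (- s) ?q)" for s
    by (simp add: weak_deriv_riem riem_wave_flow1 riem_wave_flow2)
  have I: "?I = (1/2) *\<^sub>R (integral {a..b} (\<lambda>s. l2_shift s ?p) - integral {- b..- a} (\<lambda>s. l2_shift s ?q))"
    unfolding wd integral_reflect_shift[symmetric]
    by (subst integral_cmul, subst integral_diff) (auto intro!: integrable_continuous_real continuous_intros)
  have "has_weak_deriv ?I ((1/2) *\<^sub>R ((l2_shift b ?p - l2_shift a ?p) - (l2_shift (- a) ?q - l2_shift (- b) ?q)))"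
    unfolding I by (intro has_weak_deriv_scaleR has_weak_deriv_minus has_weak_deriv_integral_shift) (use ab in auto)
  moreover have "(1/2) *\<^sub>R ((l2_shift b ?p - l2_shift a ?p) - (l2_shift (- a) ?q - l2_shift (- b) ?q))
      = snd (wave_flow b z) - snd (wave_flow a z)"
    by (simp add: snd_riem riem_wave_flow1 riem_wave_flow2 algebra_simps)
  ultimately have "has_weak_deriv ?I (snd (wave_flow b z) - snd (wave_flow a z))" by simp
  then have "hm1_of_l2 (snd (wave_flow b z) - snd (wave_flow a z)) = hm1_dx ?I"
    by (rule hm1_of_l2_weak_deriv)
  also have "hm1_dx ?I = integral {a..b} (\<lambda>s. hm1_dx (weak_deriv (fst (wave_flow s z))))"
    by (rule integral_bounded_linear_image[OF _ bounded_linear_hm1_dx])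
       (intro continuous_on_compose2[OF linear_continuous_on[OF bounded_linear_weak_deriv] ] continuous_intros, auto)
  finally show ?thesis by (simp add: hm1_of_l2_diff)
qed

lemma wave_flow_solution:
  "wave_solution UNIV (\<lambda>_. 0) (\<lambda>t. fst (wave_flow t z)) (\<lambda>t. snd (wave_flow t z))"
proof -
  define w where "w t = (snd (wave_flow t z), hm1_dx (weak_deriv (fst (wave_flow t z))))" for t
  have cw: "continuous_on UNIV (\<lambda>t. hm1_dx (weak_deriv (fst (wave_flow t z))))"
    by (intro bounded_linear.continuous_on[OF bounded_linear_hm1_dx]
        bounded_linear.continuous_on[OF bounded_linear_weak_deriv] continuous_intros)
  have "((\<lambda>s. (l2_of_h1 (fst (wave_flow s z)), hm1_of_l2 (snd (wave_flow s z)))) has_vector_derivative w t) (at t)" for t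
    unfolding w_def
  proof (rule has_vector_derivative_Pair)
    show "((\<lambda>s. l2_of_h1 (fst (wave_flow s z))) has_vector_derivative snd (wave_flow t z)) (at t)"
      by (rule has_vector_derivative_of_integral[OF continuous_on_snd[OF wave_flow_continuous_real] l2_fst_wave_flow_diff])
    show "((\<lambda>s. hm1_of_l2 (snd (wave_flow s z))) has_vector_derivative hm1_dx (weak_deriv (fst (wave_flow t z)))) (at t)"
      by (rule has_vector_derivative_of_integral[OF cw hm1_snd_wave_flow_diff])
  qed
  moreover have "continuous_on UNIV w"
    unfolding w_def by (intro continuous_intros cw)
  ultimately show ?thesis
    unfolding wave_solution_def
    by (auto intro!: exI[of _ w] wave_flow_continuous_real simp: w_def dxx_eq hm1_of_l2_0)
qed

definition h1_shift :: "real \<Rightarrow> h1_torus \<Rightarrow> h1_torus" where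
  "h1_shift h u = h1_of_l2 (l2_shift h (l2_of_h1 u))"

lemma has_weak_deriv_shift:
  assumes "has_weak_deriv u w" shows "has_weak_deriv (l2_shift h u) (l2_shift h w)"
proof -
  have "((\<lambda>s. l2_shift h (l2_shift s u)) has_vector_derivative l2_shift h w) (at 0)"
    using assms by (intro bounded_linear.has_vector_derivative[OF bounded_linear_l2_shift])
      (simp add: has_weak_deriv_iff_shift_derivative)
  then show ?thesis by (simp add: has_weak_deriv_iff_shift_derivative add.commute)
qed

lemma l2_of_h1_shift [simp]: "l2_of_h1 (h1_shift h u) = l2_shift h (l2_of_h1 u)"
  unfolding h1_shift_def by (rule l2_of_h1_of_l2[OF has_weak_deriv_shift[OF has_weak_deriv_weak_deriv]])

lemma weak_deriv_h1_shift [simp]: "weak_deriv (h1_shift h u) = l2_shift h (weak_deriv u)"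
  unfolding h1_shift_def by (rule weak_deriv_h1_of_l2[OF has_weak_deriv_shift[OF has_weak_deriv_weak_deriv]])

lemma h1_shift_tendsto:
  assumes "(f \<longlongrightarrow> u) F" "(c \<longlongrightarrow> h) F"
  shows "((\<lambda>x. h1_shift (c x) (f x)) \<longlongrightarrow> h1_shift h u) F"
  by (rule tendsto_h1) (auto intro!: l2_shift_tendsto assms bounded_linear.tendsto[OF bounded_linear_l2_of_h1]
      bounded_linear.tendsto[OF bounded_linear_weak_deriv])

lemma h1_orthogonal_imp_0:
  assumes "\<And>\<phi>. inner z (l2_of_h1 \<phi>) = 0"
  shows "z = 0"
proof (rule smooth_l2_orthogonal_imp_0)
  fix \<phi> assume "smooth_periodic \<phi>"
  then have "has_weak_deriv (cls \<phi>) (cls (deriv \<phi>))"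
    by (simp add: has_weak_deriv_iff_shift_derivative smooth_shift_derivative_0)
  then show "inner z (cls \<phi>) = 0"
    using assms[of "h1_of_l2 (cls \<phi>)"] by (simp add: l2_of_h1_of_l2)
qed

lemma wave_solution_l2_derivative:
  assumes "wave_solution I G u v" "t \<in> I"
  shows "((\<lambda>s. l2_of_h1 (u s)) has_vector_derivative v t) (at t within I)"
proof -
  obtain w where w: "((\<lambda>s. (l2_of_h1 (u s), hm1_of_l2 (v s))) has_vector_derivative w t) (at t within I)" "fst (w t) = v t"
    using assms unfolding wave_solution_def by blast
  show ?thesis
    using bounded_linear.has_vector_derivative[OF bounded_linear_fst w(1)] w(2) by simp
qed

lemma wave_solution_hm1_derivative:
  assumes "wave_solution I G u v" "t \<in> I"
  shows "((\<lambda>s. hm1_of_l2 (v s)) has_vector_derivative dxx (u t) + hm1_of_l2 (G (u t))) (at t within I)"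
proof -
  obtain w where w: "((\<lambda>s. (l2_of_h1 (u s), hm1_of_l2 (v s))) has_vector_derivative w t) (at t within I)"
      "snd (w t) - dxx (u t) = hm1_of_l2 (G (u t))"
    using assms unfolding wave_solution_def by blast
  have "snd (w t) = dxx (u t) + hm1_of_l2 (G (u t))" using w(2) by (simp add: algebra_simps)
  then show ?thesis
    using bounded_linear.has_vector_derivative[OF bounded_linear_snd w(1)] by simp
qed

lemma wave_solution_continuous:
  assumes "wave_solution I G u v"
  shows "continuous_on I u" "continuous_on I v"
proof -
  have "continuous_on I (\<lambda>t. (u t, v t))" using assms by (simp add: wave_solution_def)
  from continuous_on_fst[OF this] continuous_on_snd[OF this]
  show "continuous_on I u" "continuous_on I v" by simp_all
qed

text \<open>Testing a Riemann invariant of a solution against a test function that moves with the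
  characteristic speed leaves only the source term. The invariant is differentiable in \<open>H\<^sup>-\<^sup>1\<close> only
  and the test function in \<open>L\<^sup>2\<close> only, but each difference quotient falls on a factor for which it
  converges.\<close>

lemma riem_tested_derivative:
  assumes sol: "wave_solution I G u v" and t: "t \<in> I" and \<sigma>: "\<sigma> = 1 \<or> \<sigma> = -1"
  shows "((\<lambda>s. inner (riem \<sigma> (u s, v s)) (l2_shift (\<sigma> * s) (l2_of_h1 \<phi>))) has_vector_derivative
     inner (G (u t)) (l2_shift (\<sigma> * t) (l2_of_h1 \<phi>))) (at t within I)"
proof -
  define \<Phi> where "\<Phi> s = l2_shift (\<sigma> * s) (l2_of_h1 \<phi>)" for s
  define \<Psi> where "\<Psi> s = l2_shift (\<sigma> * s) (weak_deriv \<phi>)" for s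
  define H where "H s = h1_shift (\<sigma> * s) \<phi>" for s
  have H: "l2_of_h1 (H s) = \<Phi> s" "weak_deriv (H s) = \<Psi> s" for s by (simp_all add: H_def \<Phi>_def \<Psi>_def)
  have dF: "(\<Phi> has_vector_derivative \<sigma> *\<^sub>R \<Psi> t) (at t within I)"
    unfolding \<Phi>_def [abs_def] \<Psi>_def by (rule weak_deriv_shift_derivative)
  have dv: "((\<lambda>s. inner (v s) (\<Phi> s)) has_vector_derivative
      blinfun_apply (dxx (u t) + hm1_of_l2 (G (u t))) (H t) + inner (v t) (\<sigma> *\<^sub>R \<Psi> t)) (at t within I)"
  proof -
    have "((\<lambda>s. blinfun_apply (hm1_of_l2 (v s) - hm1_of_l2 (v t)) (H s)) has_vector_derivative
        blinfun_apply (dxx (u t) + hm1_of_l2 (G (u t))) (H t)) (at t within I)"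
      by (intro bounded_bilinear.has_vector_derivative_increment[OF bounded_bilinear_blinfun_apply]
          wave_solution_hm1_derivative[OF sol t]) (auto simp: H_def intro!: h1_shift_tendsto tendsto_intros)
    moreover have "((\<lambda>s. inner (v t) (\<Phi> s)) has_vector_derivative inner (v t) (\<sigma> *\<^sub>R \<Psi> t)) (at t within I)"
      by (rule bounded_linear.has_vector_derivative[OF bounded_linear_inner_right dF])
    ultimately have "((\<lambda>s. blinfun_apply (hm1_of_l2 (v s) - hm1_of_l2 (v t)) (H s) + inner (v t) (\<Phi> s)) has_vector_derivative
        blinfun_apply (dxx (u t) + hm1_of_l2 (G (u t))) (H t) + inner (v t) (\<sigma> *\<^sub>R \<Psi> t)) (at t within I)"
      by (rule has_vector_derivative_add)
    then show ?thesis by (simp add: minus_blinfun.rep_eq hm1_of_l2.rep_eq H)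
  qed
  have du: "((\<lambda>s. inner (weak_deriv (u s)) (\<Phi> s)) has_vector_derivative
      inner (weak_deriv (u t)) (\<sigma> *\<^sub>R \<Psi> t) - inner (v t) (\<Psi> t)) (at t within I)"
  proof -
    have "((\<lambda>s. inner (l2_of_h1 (u s) - l2_of_h1 (u t)) (\<Psi> s)) has_vector_derivative inner (v t) (\<Psi> t)) (at t within I)"
      by (intro bounded_bilinear.has_vector_derivative_increment[OF bounded_bilinear_inner]
          wave_solution_l2_derivative[OF sol t]) (auto simp: \<Psi>_def intro!: l2_shift_tendsto tendsto_intros)
    moreover have "((\<lambda>s. inner (weak_deriv (u t)) (\<Phi> s)) has_vector_derivative inner (weak_deriv (u t)) (\<sigma> *\<^sub>R \<Psi> t)) (at t within I)"
      by (rule bounded_linear.has_vector_derivative[OF bounded_linear_inner_right dF])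
    ultimately have "((\<lambda>s. inner (weak_deriv (u t)) (\<Phi> s) - inner (l2_of_h1 (u s) - l2_of_h1 (u t)) (\<Psi> s)) has_vector_derivative
      inner (weak_deriv (u t)) (\<sigma> *\<^sub>R \<Psi> t) - inner (v t) (\<Psi> t)) (at t within I)"
      by (intro has_vector_derivative_diff)
    moreover have "inner (weak_deriv (u t)) (\<Phi> s) - inner (l2_of_h1 (u s) - l2_of_h1 (u t)) (\<Psi> s) = inner (weak_deriv (u s)) (\<Phi> s)" for s
      using inner_weak_deriv[of "u s" "H s"] inner_weak_deriv[of "u t" "H s"] by (simp add: H inner_diff_left)
    ultimately show ?thesis by simp
  qed
  have "((\<lambda>s. inner (v s) (\<Phi> s) + \<sigma> *\<^sub>R inner (weak_deriv (u s)) (\<Phi> s)) has_vector_derivative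
     (blinfun_apply (dxx (u t) + hm1_of_l2 (G (u t))) (H t) + inner (v t) (\<sigma> *\<^sub>R \<Psi> t)) +
     \<sigma> *\<^sub>R (inner (weak_deriv (u t)) (\<sigma> *\<^sub>R \<Psi> t) - inner (v t) (\<Psi> t))) (at t within I)"
    by (intro has_vector_derivative_add dv bounded_linear.has_vector_derivative[OF bounded_linear_scaleR_right du])
  moreover have "(blinfun_apply (dxx (u t) + hm1_of_l2 (G (u t))) (H t) + inner (v t) (\<sigma> *\<^sub>R \<Psi> t)) +
     \<sigma> *\<^sub>R (inner (weak_deriv (u t)) (\<sigma> *\<^sub>R \<Psi> t) - inner (v t) (\<Psi> t)) = inner (G (u t)) (\<Phi> t)"
    using \<sigma> by (auto simp: plus_blinfun.rep_eq dxx.rep_eq hm1_of_l2.rep_eq H)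
  ultimately show ?thesis
    by (simp add: riem_def \<Phi>_def inner_add_left)
qed

text \<open>Transported back to time zero by the linear flow, the solution has this mean in its first
  component; the mean of \<open>\<partial>\<^sub>x\<^sup>2u\<close> vanishes, so that only the source contributes to its derivative.\<close>

lemma fmean_tested_derivative:
  assumes sol: "wave_solution I G u v" and t: "t \<in> I"
  shows "((\<lambda>s. mean (l2_of_h1 (u s)) - s * mean (v s)) has_vector_derivative - (t * mean (G (u t)))) (at t within I)"
proof -
  let ?e = "h1_of_l2 one_l2"
  have e: "l2_of_h1 ?e = one_l2" "weak_deriv ?e = 0"
    by (simp_all add: l2_of_h1_of_l2[OF has_weak_deriv_one] weak_deriv_h1_of_l2[OF has_weak_deriv_one])
  have 1: "((\<lambda>s. mean (l2_of_h1 (u s))) has_real_derivative mean (v t)) (at t within I)"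
    unfolding has_real_derivative_iff_has_vector_derivative
    by (rule bounded_linear.has_vector_derivative[OF bounded_linear_mean wave_solution_l2_derivative[OF sol t]])
  have "((\<lambda>s. blinfun_apply (hm1_of_l2 (v s)) ?e) has_vector_derivative blinfun_apply (dxx (u t) + hm1_of_l2 (G (u t))) ?e) (at t within I)"
    by (rule bounded_linear.has_vector_derivative[OF bounded_bilinear.bounded_linear_left[OF bounded_bilinear_blinfun_apply]
          wave_solution_hm1_derivative[OF sol t]])
  then have 2: "((\<lambda>s. mean (v s)) has_real_derivative mean (G (u t))) (at t within I)"
    unfolding has_real_derivative_iff_has_vector_derivative
    by (simp add: plus_blinfun.rep_eq dxx.rep_eq hm1_of_l2.rep_eq e mean_def)
  have "((\<lambda>s. mean (l2_of_h1 (u s)) - s * mean (v s)) has_real_derivative - (t * mean (G (u t)))) (at t within I)"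
    using 1 2 by (auto intro!: derivative_eq_intros)
  then show ?thesis by (simp add: has_real_derivative_iff_has_vector_derivative)
qed

text \<open>Duhamel's formula for the solution transported back to time zero by the linear flow. The
  equation is only available in \<open>H\<^sup>-\<^sup>1\<close>, and the transported solution need not be differentiable in
  the energy space; its coordinates are differentiable when tested with functions in \<open>H\<^sup>1\<close>, which
  suffices to identify the integral.\<close>

lemma duhamel_backward:
  assumes sol: "wave_solution I G u v" and ab: "a \<le> b" "{a..b} \<subseteq> I"
    and cont: "continuous_on {a..b} (\<lambda>t. G (u t))"
  shows "wave_flow (- b) (u b, v b) - wave_flow (- a) (u a, v a)
     = integral {a..b} (\<lambda>s. wave_flow (- s) (0, G (u s)))" (is "?L = ?R")
proof -
  have c0: "continuous_on {a..b} (\<lambda>s. wave_flow (- s) (0, G (u s)))"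
    by (intro continuous_intros cont)
  have riem: "riem \<sigma> ?L = riem \<sigma> ?R" if \<sigma>: "\<sigma> = 1 \<or> \<sigma> = -1" for \<sigma>
  proof -
    have "inner (riem \<sigma> ?L - riem \<sigma> ?R) (l2_of_h1 \<phi>) = 0" for \<phi>
    proof -
      let ?P = "\<lambda>s. inner (riem \<sigma> (u s, v s)) (l2_shift (\<sigma> * s) (l2_of_h1 \<phi>))"
      have "((\<lambda>s. inner (G (u s)) (l2_shift (\<sigma> * s) (l2_of_h1 \<phi>))) has_integral ?P b - ?P a) {a..b}"
        by (rule fundamental_theorem_of_calculus[OF ab(1)])
           (use ab \<sigma> in \<open>auto intro!: has_vector_derivative_within_subset[OF riem_tested_derivative[OF sol]]\<close>)
      then have "integral {a..b} (\<lambda>s. inner (riem \<sigma> (wave_flow (- s) (0, G (u s)))) (l2_of_h1 \<phi>)) = ?P b - ?P a"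
        using \<sigma> by (simp add: riem_wave_flow inner_l2_shift integral_unique del: l2_shift_linear_simps)
      moreover have "integral {a..b} (\<lambda>s. inner (riem \<sigma> (wave_flow (- s) (0, G (u s)))) (l2_of_h1 \<phi>))
          = inner (riem \<sigma> ?R) (l2_of_h1 \<phi>)"
        unfolding integral_bounded_linear_image[OF c0 bounded_linear_riem]
        by (rule inner_integral_l2[symmetric]) (intro bounded_linear.continuous_on[OF bounded_linear_riem] c0)
      ultimately show ?thesis
        using \<sigma> by (simp add: inner_diff_left riem_wave_flow inner_l2_shift)
    qed
    from h1_orthogonal_imp_0[OF this] show ?thesis by (simp only: right_minus_eq)
  qed
  show ?thesis
  proof (rule state_eqI)
    let ?M = "\<lambda>s. mean (l2_of_h1 (u s)) - s * mean (v s)"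
    have "((\<lambda>s. - (s * mean (G (u s)))) has_integral ?M b - ?M a) {a..b}"
      by (rule fundamental_theorem_of_calculus[OF ab(1)])
         (use ab in \<open>auto intro!: has_vector_derivative_within_subset[OF fmean_tested_derivative[OF sol]]\<close>)
    from integral_unique[OF this]
    have "integral {a..b} (\<lambda>s. fmean (wave_flow (- s) (0, G (u s)))) = ?M b - ?M a" by simp
    then show "fmean ?L = fmean ?R"
      using integral_bounded_linear_image[OF c0 bounded_linear_fmean]
      by (simp add: fmean_def[of "(u _, _)"])
  qed (use riem in auto)
qed

text \<open>Existence is \<open>wave_flow_solution\<close>; uniqueness is Duhamel's formula without source.\<close>

lemma wave_group_eq: "wave_group t w = wave_flow t w"
proof -
  have "z = wave_flow t w" if "wave_solution UNIV (\<lambda>_. 0) \<phi> \<psi>" "(\<phi> 0, \<psi> 0) = w" "(\<phi> t, \<psi> t) = z" for z \<phi> \<psi>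
  proof -
    have eq: "wave_flow (- b) (\<phi> b, \<psi> b) = wave_flow (- a) (\<phi> a, \<psi> a)" if "a \<le> b" for a b
      using duhamel_backward[OF \<open>wave_solution UNIV (\<lambda>_. 0) \<phi> \<psi>\<close> that] by (simp add: zero_prod_def[symmetric])
    have "wave_flow (- t) (\<phi> t, \<psi> t) = wave_flow (- 0) (\<phi> 0, \<psi> 0)"
    proof (cases "t \<le> 0")
      case True
      then show ?thesis by (rule eq[symmetric])
    next
      case False
      then show ?thesis by (intro eq) simp
    qed
    then have "wave_flow t (wave_flow (- t) z) = wave_flow t w" using that by simp
    then show ?thesis by simp
  qed
  then show ?thesis
    unfolding wave_group_def
    by (intro the_equality) (auto intro!: exI[of _ "\<lambda>t. fst (wave_flow t w)"] exI[of _ "\<lambda>t. snd (wave_flow t w)"] wave_flow_solution)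
qed

lemma duhamel:
  assumes "wave_solution I G u v" "0 \<le> s" "{t..t + s} \<subseteq> I" "continuous_on {t..t + s} (\<lambda>t. G (u t))"
  shows "(u (t + s), v (t + s)) = wave_flow s ((u t, v t) + integral {0..s} (\<lambda>r. wave_flow (- r) (0, G (u (t + r)))))"
proof -
  let ?f = "\<lambda>r. wave_flow (- r) (0, G (u r))"
  have c: "continuous_on {t..t + s} ?f" by (intro continuous_intros assms)
  have I: "integral {0..s} (\<lambda>r. ?f (t + r)) = integral {t..t + s} ?f"
    using integral_shift_Icc_real[of 0 s ?f t] by (simp add: o_def add.commute)
  have c': "continuous_on {0..s} (\<lambda>r. wave_flow (- r) (0, G (u (t + r))))"
    by (intro continuous_intros continuous_on_compose2[OF assms(4)]) auto
  have "wave_flow (- (t + s)) (u (t + s), v (t + s)) = wave_flow (- t) (u t, v t) + integral {t..t + s} ?f"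
    using duhamel_backward[OF assms(1) _ assms(3,4)] assms(2) by (simp add: algebra_simps)
  then have "wave_flow (t + s) (wave_flow (- (t + s)) (u (t + s), v (t + s)))
      = wave_flow (t + s) (wave_flow (- t) (u t, v t) + integral {0..s} (\<lambda>r. ?f (t + r)))"
    by (simp only: I)
  then have "(u (t + s), v (t + s)) = wave_flow s (u t, v t) + wave_flow (s + t) (integral {0..s} (\<lambda>r. ?f (t + r)))"
    by (simp add: add.commute)
  also have "integral {0..s} (\<lambda>r. ?f (t + r)) = integral {0..s} (\<lambda>r. wave_flow (- t) (wave_flow (- r) (0, G (u (t + r)))))"
    by (simp add: add.commute)
  also have "\<dots> = wave_flow (- t) (integral {0..s} (\<lambda>r. wave_flow (- r) (0, G (u (t + r)))))"
    by (rule integral_bounded_linear_image[OF c' bounded_linear_wave_flow, symmetric])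
  finally show ?thesis by simp
qed

section \<open>Multiplication and composition in \<open>L\<^sup>2\<close>\<close>

lemma norm_l2_le_AE:
  assumes "AE x in torus. \<bar>rep u x\<bar> \<le> c * \<bar>rep v x\<bar>" "0 \<le> c"
  shows "norm u \<le> c * norm v"
proof -
  have "norm (cls (rep u)) \<le> norm (cls (\<lambda>x. c * rep v x))"
    using assms by (intro norm_le_of_AE sq_integrable_rep sq_integrable_scale) (auto simp: abs_mult)
  also have "cls (\<lambda>x. c * rep v x) = c *\<^sub>R v"
    using abs_l2_scaleR[OF sq_integrable_rep[of v], of c] by (simp add: abs_rep_l2)
  finally show ?thesis using assms(2) by (simp add: abs_rep_l2)
qed

lemma rep_l2_mult:
  assumes "ess_bd K a"
  shows "AE x in torus. rep (l2_mult a b) x = rep a x * rep b x"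
  unfolding l2_mult_def
proof (rule rep_abs_l2)
  show "sq_integrable (\<lambda>x. rep a x * rep b x)"
    unfolding sq_integrable_def
  proof (intro conjI allI)
    show "integrable torus (\<lambda>x. (rep a x * rep b x)\<^sup>2)"
    proof (rule Bochner_Integration.integrable_bound)
      show "integrable torus (\<lambda>x. K\<^sup>2 * (rep b x)\<^sup>2)" using integrable_rep_sq by simp
      show "(\<lambda>x. (rep a x * rep b x)\<^sup>2) \<in> borel_measurable torus"
        by (intro borel_measurable_torus) measurable
      show "AE x in torus. norm ((rep a x * rep b x)\<^sup>2) \<le> norm (K\<^sup>2 * (rep b x)\<^sup>2)"
        using assms unfolding ess_bd_def
      proof eventually_elim
        case (elim x)
        then have "(rep a x)\<^sup>2 \<le> K\<^sup>2" by (simp add: abs_le_square_iff[symmetric])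
        then show ?case by (simp add: power_mult_distrib mult_right_mono)
      qed
    qed
  qed (auto simp: rep_periodic)
qed

lemma norm_l2_mult_le:
  assumes "ess_bd K a" "0 \<le> K"
  shows "norm (l2_mult a b) \<le> K * norm b"
proof (rule norm_l2_le_AE[OF _ assms(2)])
  show "AE x in torus. \<bar>rep (l2_mult a b) x\<bar> \<le> K * \<bar>rep b x\<bar>"
    using rep_l2_mult[OF assms(1), of b] assms(1) unfolding ess_bd_def
    by eventually_elim (simp add: abs_mult mult_right_mono)
qed

lemma l2_mult_add_right:
  assumes "ess_bd K a" shows "l2_mult a (b + c) = l2_mult a b + l2_mult a c"
  unfolding l2_eq_iff
  using rep_l2_mult[OF assms, of "b + c"] rep_l2_mult[OF assms, of b] rep_l2_mult[OF assms, of c]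
    rep_l2_add[of b c] rep_l2_add[of "l2_mult a b" "l2_mult a c"]
  by eventually_elim (simp add: distrib_left)

lemma l2_mult_scaleR_right:
  assumes "ess_bd K a" shows "l2_mult a (r *\<^sub>R b) = r *\<^sub>R l2_mult a b"
  unfolding l2_eq_iff
  using rep_l2_mult[OF assms, of "r *\<^sub>R b"] rep_l2_mult[OF assms, of b]
    rep_l2_scaleR[of r b] rep_l2_scaleR[of r "l2_mult a b"]
  by eventually_elim simp

lemma bounded_linear_l2_mult:
  assumes "ess_bd K a" "0 \<le> K" shows "bounded_linear (l2_mult a)"
  by (rule bounded_linear_intro[of _ K])
     (use assms norm_l2_mult_le in \<open>auto simp: l2_mult_add_right l2_mult_scaleR_right mult.commute\<close>)

lemma l2_mult_diff_right:
  assumes "ess_bd K a" "0 \<le> K" shows "l2_mult a (b - c) = l2_mult a b - l2_mult a c"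
  using linear_diff[OF bounded_linear.linear[OF bounded_linear_l2_mult[OF assms]]] .

lemma l2_mult_diff_left:
  assumes "ess_bd K a" "ess_bd L b" shows "l2_mult (a - b) c = l2_mult a c - l2_mult b c"
  unfolding l2_eq_iff
  using rep_l2_mult[OF assms(1), of c] rep_l2_mult[OF assms(2), of c]
    rep_l2_mult[OF ess_bd_diff[OF assms], of c] rep_l2_minus[of a b] rep_l2_minus[of "l2_mult a c" "l2_mult b c"]
  by eventually_elim (simp add: left_diff_distrib)

lemma l2_shift_mult:
  assumes "ess_bd K a" shows "l2_shift h (l2_mult a b) = l2_mult (l2_shift h a) (l2_shift h b)"
  unfolding l2_eq_iff
proof -
  have "AE x in torus. rep (l2_mult a b) (x + h) = rep a (x + h) * rep b (x + h)"
    by (rule AE_torus_shift[of "\<lambda>x. rep (l2_mult a b) x = rep a x * rep b x"])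
       (use rep_l2_mult[OF assms] in \<open>auto simp: rep_periodic\<close>)
  then show "AE x in torus. rep (l2_shift h (l2_mult a b)) x = rep (l2_mult (l2_shift h a) (l2_shift h b)) x"
    using rep_l2_shift[of h "l2_mult a b"] rep_l2_shift[of h a] rep_l2_shift[of h b]
      rep_l2_mult[OF ess_bd_shift[OF assms, of h], of "l2_shift h b"]
    by eventually_elim simp
qed

lemma continuous_bounded_on_interval:
  fixes k :: "real \<Rightarrow> real"
  assumes "continuous_on UNIV k"
  obtains B where "0 \<le> B" "\<And>x. \<bar>x\<bar> \<le> R \<Longrightarrow> \<bar>k x\<bar> \<le> B"
proof -
  have "compact (k ` {- R..R})"
    by (intro compact_continuous_image continuous_on_subset[OF assms]) auto
  then obtain B where "\<forall>y\<in>k ` {- R..R}. norm y \<le> B"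
    using compact_imp_bounded bounded_iff by metis
  then have B: "\<And>x. x \<in> {- R..R} \<Longrightarrow> \<bar>k x\<bar> \<le> B" by auto
  have "\<bar>k x\<bar> \<le> max 0 B" if "\<bar>x\<bar> \<le> R" for x
    using B[of x] that by (simp add: abs_le_iff)
  then show ?thesis by (intro that[of "max 0 B"]) auto
qed

lemma rep_l2_comp:
  assumes k: "continuous_on UNIV k" and a: "ess_bd R a"
  shows "AE x in torus. rep (l2_comp k a) x = k (rep a x)"
  unfolding l2_comp_def
proof (rule rep_abs_l2)
  obtain B where B: "\<And>x. \<bar>x\<bar> \<le> R \<Longrightarrow> \<bar>k x\<bar> \<le> B"
    using continuous_bounded_on_interval[OF k] by metis
  show "sq_integrable (\<lambda>x. k (rep a x))"
  proof (rule sq_integrable_bounded)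
    show "(\<lambda>x. k (rep a x)) \<in> borel_measurable borel"
      using borel_measurable_continuous_onI[OF k] by (rule measurable_compose[rotated]) measurable
    show "AE x in torus. \<bar>k (rep a x)\<bar> \<le> B"
      using a unfolding ess_bd_def by eventually_elim (rule B)
  qed (simp add: rep_periodic)
qed

lemma ess_bd_comp:
  assumes k: "continuous_on UNIV k" and a: "ess_bd R a" and B: "\<And>x. \<bar>x\<bar> \<le> R \<Longrightarrow> \<bar>k x\<bar> \<le> B"
  shows "ess_bd B (l2_comp k a)"
  using rep_l2_comp[OF k a] a unfolding ess_bd_def by eventually_elim (simp add: B)

lemma l2_shift_comp:
  assumes k: "continuous_on UNIV k" and a: "ess_bd R a"
  shows "l2_shift h (l2_comp k a) = l2_comp k (l2_shift h a)"
  unfolding l2_eq_iff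
proof -
  have [measurable]: "k \<in> borel_measurable borel" by (rule borel_measurable_continuous_onI[OF k])
  have "AE x in torus. rep (l2_comp k a) (x + h) = k (rep a (x + h))"
    by (rule AE_torus_shift[of "\<lambda>x. rep (l2_comp k a) x = k (rep a x)"])
       (use rep_l2_comp[OF k a] in \<open>auto simp: rep_periodic\<close>)
  then show "AE x in torus. rep (l2_shift h (l2_comp k a)) x = rep (l2_comp k (l2_shift h a)) x"
    using rep_l2_shift[of h "l2_comp k a"] rep_l2_shift[of h a] rep_l2_comp[OF k ess_bd_shift[OF a, of h]]
    by eventually_elim simp
qed

lemma l2_comp_lipschitz:
  assumes k: "continuous_on UNIV k" and ab: "ess_bd R a" "ess_bd R b"
    and L: "\<And>x y. \<bar>x\<bar> \<le> R \<Longrightarrow> \<bar>y\<bar> \<le> R \<Longrightarrow> \<bar>k x - k y\<bar> \<le> L * \<bar>x - y\<bar>" and L0: "0 \<le> L"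
  shows "AE x in torus. \<bar>rep (l2_comp k a - l2_comp k b) x\<bar> \<le> L * \<bar>rep (a - b) x\<bar>"
    and "norm (l2_comp k a - l2_comp k b) \<le> L * norm (a - b)"
    and "ess_bd D (a - b) \<Longrightarrow> ess_bd (L * D) (l2_comp k a - l2_comp k b)"
proof -
  show *: "AE x in torus. \<bar>rep (l2_comp k a - l2_comp k b) x\<bar> \<le> L * \<bar>rep (a - b) x\<bar>"
    using rep_l2_comp[OF k ab(1)] rep_l2_comp[OF k ab(2)] rep_l2_minus[of a b]
      rep_l2_minus[of "l2_comp k a" "l2_comp k b"] ab unfolding ess_bd_def
    by eventually_elim (simp add: L)
  then show "norm (l2_comp k a - l2_comp k b) \<le> L * norm (a - b)"
    by (rule norm_l2_le_AE[OF _ L0])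
  assume "ess_bd D (a - b)"
  then show "ess_bd (L * D) (l2_comp k a - l2_comp k b)"
    using * unfolding ess_bd_def
  proof eventually_elim
    case (elim x)
    then show ?case using mult_left_mono[OF elim(1) L0] by linarith
  qed
qed

lemma real_C1_lipschitz:
  fixes k k' :: "real \<Rightarrow> real"
  assumes "\<And>x. (k has_real_derivative k' x) (at x)" "continuous_on UNIV k'"
  obtains L where "0 \<le> L" "\<And>x y. \<bar>x\<bar> \<le> R \<Longrightarrow> \<bar>y\<bar> \<le> R \<Longrightarrow> \<bar>k x - k y\<bar> \<le> L * \<bar>x - y\<bar>"
proof -
  obtain B where B: "0 \<le> B" "\<And>x. \<bar>x\<bar> \<le> R \<Longrightarrow> \<bar>k' x\<bar> \<le> B"
    using continuous_bounded_on_interval[OF assms(2)] by metis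
  have "\<bar>k x - k y\<bar> \<le> B * \<bar>x - y\<bar>" if "\<bar>x\<bar> \<le> R" "\<bar>y\<bar> \<le> R" for x y
    unfolding real_norm_def[symmetric]
    by (rule field_differentiable_bound[where S = "{- R..R}" and f' = k'])
       (use that B assms(1) in \<open>auto intro: has_field_derivative_at_within\<close>)
  with B(1) show ?thesis using that by blast
qed

lemma real_C1_linearization:
  fixes k k' :: "real \<Rightarrow> real"
  assumes d: "\<And>x. (k has_real_derivative k' x) (at x)" and c: "continuous_on UNIV k'" and e: "0 < e"
  obtains \<delta> where "0 < \<delta>" "\<And>x y. \<bar>x\<bar> \<le> R \<Longrightarrow> \<bar>y\<bar> \<le> R \<Longrightarrow> \<bar>x - y\<bar> \<le> \<delta> \<Longrightarrow> \<bar>k x - k y - k' y * (x - y)\<bar> \<le> e * \<bar>x - y\<bar>"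
proof -
  have "uniformly_continuous_on {- R..R} k'"
    by (rule compact_uniformly_continuous[OF continuous_on_subset[OF c]]) auto
  then obtain d1 where d1: "0 < d1" "\<And>x y. x \<in> {- R..R} \<Longrightarrow> y \<in> {- R..R} \<Longrightarrow> dist x y < d1 \<Longrightarrow> dist (k' x) (k' y) < e"
    using e unfolding uniformly_continuous_on_def by metis
  show ?thesis
  proof (rule that[of "d1 / 2"])
    fix x y assume xy: "\<bar>x\<bar> \<le> R" "\<bar>y\<bar> \<le> R" "\<bar>x - y\<bar> \<le> d1 / 2"
    let ?S = "closed_segment y x"
    have "norm ((k x - k' y * x) - (k y - k' y * y)) \<le> e * norm (x - y)"
    proof (rule field_differentiable_bound[where S = ?S and f' = "\<lambda>z. k' z - k' y"])
      show "((\<lambda>z. k z - k' y * z) has_field_derivative k' z - k' y) (at z within ?S)" for z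
        using d[of z] by (auto intro!: derivative_eq_intros intro: has_field_derivative_at_within)
      show "norm (k' z - k' y) \<le> e" if "z \<in> ?S" for z
      proof -
        have "z \<in> {- R..R}" "y \<in> {- R..R}" "\<bar>z - y\<bar> \<le> \<bar>x - y\<bar>"
          using that xy by (auto simp: closed_segment_eq_real_ivl split: if_splits)
        then show ?thesis using d1(2)[of z y] d1(1) xy by (simp add: dist_real_def)
      qed
    qed auto
    then show "\<bar>k x - k y - k' y * (x - y)\<bar> \<le> e * \<bar>x - y\<bar>" by (simp add: algebra_simps)
  qed (use d1 in simp)
qed

text \<open>The chain rule for a curve that is differentiable in \<open>L\<^sup>2\<close> and continuous in \<open>L\<^sup>\<infinity>\<close>. It yields both
  the weak derivative of a composition, along the curve of translates, and its time derivative
  along a solution.\<close>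

lemma l2_comp_chain:
  assumes d: "\<And>x. (k has_real_derivative k' x) (at x)" and c: "continuous_on UNIV k'"
    and bd: "\<And>s. s \<in> S \<Longrightarrow> ess_bd R (a s)" and t: "t \<in> S"
    and da: "(a has_vector_derivative w) (at t within S)"
    and unif: "\<And>e. 0 < e \<Longrightarrow> \<forall>\<^sub>F s in at t within S. ess_bd e (a s - a t)"
  shows "((\<lambda>s. l2_comp k (a s)) has_vector_derivative l2_mult (l2_comp k' (a t)) w) (at t within S)"
proof -
  have ck: "continuous_on UNIV k"
    using d by (meson DERIV_isCont continuous_at_imp_continuous_on)
  obtain B where B: "0 \<le> B" "\<And>x. \<bar>x\<bar> \<le> R \<Longrightarrow> \<bar>k' x\<bar> \<le> B"
    using continuous_bounded_on_interval[OF c] by metis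
  let ?m = "l2_comp k' (a t)"
  have m: "ess_bd B ?m" by (rule ess_bd_comp[OF c bd[OF t] B(2)])
  have lim: "((\<lambda>s. (a s - a t) /\<^sub>R (s - t)) \<longlongrightarrow> w) (at t within S)"
    using da by (simp add: has_vector_derivative_quotient)
  have main: "((\<lambda>s. (l2_comp k (a s) - l2_comp k (a t)) /\<^sub>R (s - t) - l2_mult ?m ((a s - a t) /\<^sub>R (s - t))) \<longlongrightarrow> 0) (at t within S)"
    unfolding tendsto_iff dist_norm diff_zero
  proof (intro allI impI)
    fix e :: real assume e: "0 < e"
    \<comment> \<open>Near \<open>t\<close> the difference quotients of \<open>a\<close> have norm at most \<open>norm w + 1\<close>.\<close>
    define e1 where "e1 = e / (2 * (norm w + 1))"
    have e1: "0 < e1" using e by (auto simp: e1_def intro!: divide_pos_pos add_nonneg_pos mult_pos_pos)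
    obtain \<delta> where \<delta>: "0 < \<delta>" "\<And>x y. \<bar>x\<bar> \<le> R \<Longrightarrow> \<bar>y\<bar> \<le> R \<Longrightarrow> \<bar>x - y\<bar> \<le> \<delta> \<Longrightarrow> \<bar>k x - k y - k' y * (x - y)\<bar> \<le> e1 * \<bar>x - y\<bar>"
      using real_C1_linearization[OF d c e1] by metis
    have "\<forall>\<^sub>F s in at t within S. norm ((a s - a t) /\<^sub>R (s - t)) < norm w + 1"
      by (rule order_tendstoD(2)[OF tendsto_norm[OF lim]]) simp
    moreover have "\<forall>\<^sub>F s in at t within S. s \<in> S \<and> s \<noteq> t"
      by (simp add: eventually_at_filter)
    ultimately show "\<forall>\<^sub>F s in at t within S. norm ((l2_comp k (a s) - l2_comp k (a t)) /\<^sub>R (s - t) - l2_mult ?m ((a s - a t) /\<^sub>R (s - t))) < e"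
      using unif[OF \<delta>(1)]
    proof eventually_elim
      case (elim s)
      have s: "ess_bd R (a s)" using elim(2) bd by blast
      let ?r = "l2_comp k (a s) - l2_comp k (a t) - l2_mult ?m (a s - a t)"
      have "norm ?r \<le> e1 * norm (a s - a t)"
      proof (rule norm_l2_le_AE)
        show "AE x in torus. \<bar>rep ?r x\<bar> \<le> e1 * \<bar>rep (a s - a t) x\<bar>"
          using rep_l2_minus[of "l2_comp k (a s) - l2_comp k (a t)" "l2_mult ?m (a s - a t)"]
            rep_l2_minus[of "l2_comp k (a s)" "l2_comp k (a t)"] rep_l2_mult[OF m, of "a s - a t"]
            rep_l2_minus[of "a s" "a t"] rep_l2_comp[OF ck bd[OF t]] rep_l2_comp[OF c bd[OF t]]
            rep_l2_comp[OF ck s] bd[OF t, unfolded ess_bd_def] s[unfolded ess_bd_def] elim(3)[unfolded ess_bd_def]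
          by eventually_elim (simp add: \<delta>(2))
      qed (use e1 in simp)
      moreover have "(l2_comp k (a s) - l2_comp k (a t)) /\<^sub>R (s - t) - l2_mult ?m ((a s - a t) /\<^sub>R (s - t)) = ?r /\<^sub>R (s - t)"
        unfolding l2_mult_scaleR_right[OF m] by (simp add: scaleR_diff_right)
      ultimately have "norm ((l2_comp k (a s) - l2_comp k (a t)) /\<^sub>R (s - t) - l2_mult ?m ((a s - a t) /\<^sub>R (s - t)))
          \<le> e1 * norm ((a s - a t) /\<^sub>R (s - t))"
        using mult_left_mono[of "norm ?r" "e1 * norm (a s - a t)" "inverse \<bar>s - t\<bar>"] by (simp add: mult_ac)
      also have "\<dots> \<le> e1 * (norm w + 1)" using elim(1) e1 by (intro mult_left_mono) auto
      also have "\<dots> = e / 2" by (simp add: e1_def field_simps add_nonneg_eq_0_iff)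
      also have "\<dots> < e" using e by simp
      finally show ?case .
    qed
  qed
  have "((\<lambda>s. l2_mult ?m ((a s - a t) /\<^sub>R (s - t))) \<longlongrightarrow> l2_mult ?m w) (at t within S)"
    by (rule bounded_linear.tendsto[OF bounded_linear_l2_mult[OF m B(1)] lim])
  from tendsto_add[OF main this] show ?thesis
    by (simp add: has_vector_derivative_quotient)
qed

section \<open>The nonlinearity on \<open>H\<^sup>1\<close>\<close>

lemma nonlin_time_derivative:
  assumes d: "\<And>x. (k has_real_derivative k' x) (at x)" and c: "continuous_on UNIV k'"
    and bd: "\<And>s. s \<in> S \<Longrightarrow> norm (u s) \<le> R" and t: "t \<in> S"
    and cont: "(u \<longlongrightarrow> u t) (at t within S)"
    and der: "((\<lambda>s. l2_of_h1 (u s)) has_vector_derivative w) (at t within S)"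
  shows "((\<lambda>s. nonlin k (u s)) has_vector_derivative l2_mult (nonlin k' (u t)) w) (at t within S)"
  unfolding nonlin_def
proof (rule l2_comp_chain[OF d c _ t der])
  show "ess_bd (2 * R) (l2_of_h1 (u s))" if "s \<in> S" for s
    by (rule ess_bd_mono[OF ess_bd_l2_of_h1]) (use bd[OF that] in simp)
  fix e :: real assume e: "0 < e"
  have "\<forall>\<^sub>F s in at t within S. dist (u s) (u t) < e / 2" using tendstoD[OF cont, of "e / 2"] e by simp
  then show "\<forall>\<^sub>F s in at t within S. ess_bd e (l2_of_h1 (u s) - l2_of_h1 (u t))"
  proof eventually_elim
    case (elim s)
    then show ?case using ess_bd_mono[OF ess_bd_l2_of_h1[of "u s - u t"], of e] by (simp add: dist_norm)
  qed
qed

text \<open>Composition commutes with translation, so that this is the chain rule along the translates of \<open>u\<close>.\<close>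

lemma has_weak_deriv_nonlin:
  assumes d: "\<And>x. (k has_real_derivative k' x) (at x)" and c: "continuous_on UNIV k'"
  shows "has_weak_deriv (nonlin k u) (l2_mult (nonlin k' u) (weak_deriv u))"
proof -
  have ck: "continuous_on UNIV k"
    using d by (meson DERIV_isCont continuous_at_imp_continuous_on)
  have n: "norm (h1_shift h u) = norm u" for h
    by (rule power2_eq_imp_eq) (simp_all add: norm_h1_sq)
  have [simp]: "h1_shift 0 u = u" by (simp add: h1_shift_def l2_of_h1_inverse)
  have "((\<lambda>h. nonlin k (h1_shift h u)) has_vector_derivative l2_mult (nonlin k' (h1_shift 0 u)) (weak_deriv u)) (at 0)"
    by (rule nonlin_time_derivative[OF d c, where R = "norm u"])
       (use weak_deriv_shift_derivative[of 1 u 0] h1_shift_tendsto[OF tendsto_const tendsto_ident_at, of u 0 UNIV]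
         in \<open>auto simp: n\<close>)
  moreover have "nonlin k (h1_shift h u) = l2_shift h (nonlin k u)" for h
    by (simp add: nonlin_def l2_shift_comp[OF ck ess_bd_l2_of_h1])
  ultimately show ?thesis by (simp add: has_weak_deriv_iff_shift_derivative)
qed

lemma C2_fun_derivs:
  assumes "C2_fun g"
  shows "(g has_real_derivative deriv g x) (at x)" "(deriv g has_real_derivative deriv (deriv g) x) (at x)"
    "continuous_on UNIV g" "continuous_on UNIV (deriv g)" "continuous_on UNIV (deriv (deriv g))"
  using assms
  by (auto simp: C2_fun_def differentiable_on_def DERIV_deriv_iff_real_differentiable
      intro: differentiable_imp_continuous_on)

locale C2_nonlinearity =
  fixes g :: "real \<Rightarrow> real"
  assumes C2: "C2_fun g"
begin

lemmas g_deriv = C2_fun_derivs(1)[OF C2] and g'_deriv = C2_fun_derivs(2)[OF C2]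
lemmas g_cont = C2_fun_derivs(3)[OF C2] and g'_cont = C2_fun_derivs(4)[OF C2] and g''_cont = C2_fun_derivs(5)[OF C2]

lemma l2_of_h1_nonlin_h1: "l2_of_h1 (nonlin_h1 g u) = nonlin g u"
  unfolding nonlin_h1_def by (rule l2_of_h1_of_l2[OF has_weak_deriv_nonlin[OF g_deriv g'_cont]])

lemma weak_deriv_nonlin_h1: "weak_deriv (nonlin_h1 g u) = l2_mult (nonlin (deriv g) u) (weak_deriv u)"
  unfolding nonlin_h1_def by (rule weak_deriv_h1_of_l2[OF has_weak_deriv_nonlin[OF g_deriv g'_cont]])

text \<open>Transported by the linear flow to a fixed time, the source \<open>(0, g(u))\<close> has the transported
  \<open>source_rate\<close> as its time derivative: the first component \<open>-g(u)\<close> comes from the flow and the second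
  one, \<open>g'(u) v\<close>, from the time derivative of \<open>u\<close>.\<close>

definition source_rate :: "state \<Rightarrow> state" where
  "source_rate z = (- nonlin_h1 g (fst z), l2_mult (nonlin (deriv g) (fst z)) (snd z))"

text \<open>One constant \<open>K\<close> for the size and the Lipschitz constants of \<open>g\<close> and \<open>g'\<close> on a ball of radius \<open>M\<close>.
  The last bound is pointwise, since it will be applied to increments of \<open>u\<close> along characteristics,
  which are not small in \<open>H\<^sup>1\<close>. The radius \<open>2 M\<close> is the bound in \<open>L\<^sup>\<infinity>\<close> of the Sobolev embedding.\<close>

definition nonlin_bounds :: "real \<Rightarrow> real \<Rightarrow> bool" where
  "nonlin_bounds M K \<longleftrightarrow> 0 \<le> K \<and> (\<forall>u. norm u \<le> M \<longrightarrow> norm (nonlin g u) \<le> K \<and> ess_bd K (nonlin (deriv g) u) \<and>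
     (\<forall>u'. norm u' \<le> M \<longrightarrow> norm (nonlin g u - nonlin g u') \<le> K * norm (l2_of_h1 u - l2_of_h1 u'))) \<and>
     (\<forall>a b. ess_bd (2 * M) a \<longrightarrow> ess_bd (2 * M) b \<longrightarrow>
        (AE x in torus. \<bar>rep (l2_comp (deriv g) a - l2_comp (deriv g) b) x\<bar> \<le> K * \<bar>rep (a - b) x\<bar>))"

lemma nonlin_bounds_exist: "\<exists>K. nonlin_bounds M K"
proof -
  let ?R = "2 * M"
  obtain B0 where B0: "0 \<le> B0" "\<And>x. \<bar>x\<bar> \<le> ?R \<Longrightarrow> \<bar>g x\<bar> \<le> B0"
    using continuous_bounded_on_interval[OF g_cont] by metis
  obtain B1 where B1: "0 \<le> B1" "\<And>x. \<bar>x\<bar> \<le> ?R \<Longrightarrow> \<bar>deriv g x\<bar> \<le> B1"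
    using continuous_bounded_on_interval[OF g'_cont] by metis
  obtain L1 where L1: "0 \<le> L1" "\<And>x y. \<bar>x\<bar> \<le> ?R \<Longrightarrow> \<bar>y\<bar> \<le> ?R \<Longrightarrow> \<bar>g x - g y\<bar> \<le> L1 * \<bar>x - y\<bar>"
    using real_C1_lipschitz[OF g_deriv g'_cont] by metis
  obtain L2 where L2: "0 \<le> L2" "\<And>x y. \<bar>x\<bar> \<le> ?R \<Longrightarrow> \<bar>y\<bar> \<le> ?R \<Longrightarrow> \<bar>deriv g x - deriv g y\<bar> \<le> L2 * \<bar>x - y\<bar>"
    using real_C1_lipschitz[OF g'_deriv g''_cont] by metis
  define K where "K = B0 + B1 + L1 + L2"
  have K: "0 \<le> K" "B0 \<le> K" "B1 \<le> K" "L1 \<le> K" "L2 \<le> K" using B0(1) B1(1) L1(1) L2(1) by (auto simp: K_def)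
  have e: "ess_bd ?R (l2_of_h1 u)" if "norm u \<le> M" for u
    by (rule ess_bd_mono[OF ess_bd_l2_of_h1]) (use that in simp)
  have "nonlin_bounds M K"
    unfolding nonlin_bounds_def nonlin_def
  proof (intro conjI allI impI K)
    fix u :: h1_torus assume u: "norm u \<le> M"
    have "norm (l2_comp g (l2_of_h1 u)) \<le> B0"
      by (rule ess_bd_norm[OF ess_bd_comp[OF g_cont e[OF u] B0(2)] B0(1)])
    then show "norm (l2_comp g (l2_of_h1 u)) \<le> K" using K by simp
    show "ess_bd K (l2_comp (deriv g) (l2_of_h1 u))"
      by (rule ess_bd_mono[OF ess_bd_comp[OF g'_cont e[OF u] B1(2)] K(3)])
    fix u' :: h1_torus assume u': "norm u' \<le> M"
    have "norm (l2_comp g (l2_of_h1 u) - l2_comp g (l2_of_h1 u')) \<le> L1 * norm (l2_of_h1 u - l2_of_h1 u')"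
      by (rule l2_comp_lipschitz(2)[OF g_cont e[OF u] e[OF u'] L1(2) L1(1)])
    also have "\<dots> \<le> K * norm (l2_of_h1 u - l2_of_h1 u')" by (rule mult_right_mono[OF K(4)]) simp
    finally show "norm (l2_comp g (l2_of_h1 u) - l2_comp g (l2_of_h1 u')) \<le> K * norm (l2_of_h1 u - l2_of_h1 u')" .
  next
    fix a b assume ab: "ess_bd ?R a" "ess_bd ?R b"
    have "AE x in torus. \<bar>rep (l2_comp (deriv g) a - l2_comp (deriv g) b) x\<bar> \<le> L2 * \<bar>rep (a - b) x\<bar>"
      by (rule l2_comp_lipschitz(1)[OF g'_cont ab L2(2) L2(1)])
    then show "AE x in torus. \<bar>rep (l2_comp (deriv g) a - l2_comp (deriv g) b) x\<bar> \<le> K * \<bar>rep (a - b) x\<bar>"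
    proof eventually_elim
      case (elim x)
      then show ?case using mult_right_mono[OF K(5), of "\<bar>rep (a - b) x\<bar>"] by linarith
    qed
  qed
  then show ?thesis ..
qed

context
  fixes M K :: real
  assumes K: "nonlin_bounds M K"
begin

lemma K_nonneg: "0 \<le> K" using K by (simp add: nonlin_bounds_def)

lemma norm_nonlin_le: "norm u \<le> M \<Longrightarrow> norm (nonlin g u) \<le> K"
  using K by (simp add: nonlin_bounds_def)

lemma ess_bd_nonlin_deriv: "norm u \<le> M \<Longrightarrow> ess_bd K (nonlin (deriv g) u)"
  using K by (simp add: nonlin_bounds_def)

lemma nonlin_lipschitz_l2:
  "norm u \<le> M \<Longrightarrow> norm u' \<le> M \<Longrightarrow> norm (nonlin g u - nonlin g u') \<le> K * norm (l2_of_h1 u - l2_of_h1 u')"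
  using K by (simp add: nonlin_bounds_def)

lemma nonlin_lipschitz:
  assumes "norm u \<le> M" "norm u' \<le> M" shows "norm (nonlin g u - nonlin g u') \<le> K * norm (u - u')"
  using nonlin_lipschitz_l2[OF assms] mult_left_mono[OF norm_l2_of_h1_le[of "u - u'"] K_nonneg] by simp

lemma comp_deriv_lipschitz:
  "ess_bd (2 * M) a \<Longrightarrow> ess_bd (2 * M) b \<Longrightarrow>
   AE x in torus. \<bar>rep (l2_comp (deriv g) a - l2_comp (deriv g) b) x\<bar> \<le> K * \<bar>rep (a - b) x\<bar>"
  using K by (simp add: nonlin_bounds_def)

lemma ess_bd_2M: "norm u \<le> M \<Longrightarrow> ess_bd (2 * M) (l2_of_h1 u)"
  by (rule ess_bd_mono[OF ess_bd_l2_of_h1]) simp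

lemma ess_bd_nonlin_deriv_diff:
  assumes "norm u \<le> M" "norm u' \<le> M"
  shows "ess_bd (K * (2 * norm (u - u'))) (nonlin (deriv g) u - nonlin (deriv g) u')"
  using comp_deriv_lipschitz[OF ess_bd_2M[OF assms(1)] ess_bd_2M[OF assms(2)]] ess_bd_l2_of_h1[of "u - u'"]
  unfolding ess_bd_def nonlin_def l2_of_h1_simps
proof eventually_elim
  case (elim x)
  then show ?case using mult_left_mono[OF elim(2) K_nonneg] by linarith
qed

lemma l2_mult_nonlin_lipschitz:
  assumes "norm u \<le> M" "norm u' \<le> M" "norm a \<le> M"
  shows "norm (l2_mult (nonlin (deriv g) u) a - l2_mult (nonlin (deriv g) u') a') \<le> K * (2 * M * norm (u - u') + norm (a - a'))"
proof -
  note e = ess_bd_nonlin_deriv[OF assms(1)] and e' = ess_bd_nonlin_deriv[OF assms(2)]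
  have "l2_mult (nonlin (deriv g) u) a - l2_mult (nonlin (deriv g) u') a'
     = l2_mult (nonlin (deriv g) u - nonlin (deriv g) u') a + l2_mult (nonlin (deriv g) u') (a - a')"
    by (simp add: l2_mult_diff_left[OF e e'] l2_mult_diff_right[OF e' K_nonneg])
  also have "norm \<dots> \<le> K * (2 * norm (u - u')) * norm a + K * norm (a - a')"
    by (intro norm_triangle_le add_mono norm_l2_mult_le[OF ess_bd_nonlin_deriv_diff[OF assms(1,2)]] norm_l2_mult_le[OF e'])
       (simp_all add: K_nonneg)
  also have "\<dots> \<le> K * (2 * norm (u - u')) * M + K * norm (a - a')"
    using assms(3) K_nonneg by (intro add_right_mono mult_left_mono) auto
  finally show ?thesis by (simp add: algebra_simps)
qed

lemma nonlin_h1_lipschitz: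
  assumes "norm u \<le> M" "norm u' \<le> M"
  shows "norm (nonlin_h1 g u - nonlin_h1 g u') \<le> K * (2 + 2 * M) * norm (u - u')"
proof -
  have "norm (weak_deriv u) \<le> M" using assms(1) norm_weak_deriv_le[of u] by simp
  from l2_mult_nonlin_lipschitz[OF assms this, of "weak_deriv u'"]
  have "norm (weak_deriv (nonlin_h1 g u - nonlin_h1 g u')) \<le> K * (2 * M * norm (u - u') + norm (weak_deriv u - weak_deriv u'))"
    by (simp add: weak_deriv_nonlin_h1)
  also have "\<dots> \<le> K * (2 * M * norm (u - u') + norm (u - u'))"
    using norm_weak_deriv_le[of "u - u'"] K_nonneg by (intro mult_left_mono add_left_mono) auto
  finally have "norm (weak_deriv (nonlin_h1 g u - nonlin_h1 g u')) \<le> K * (2 * M * norm (u - u') + norm (u - u'))" .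
  moreover have "norm (l2_of_h1 (nonlin_h1 g u - nonlin_h1 g u')) \<le> K * norm (u - u')"
    using nonlin_lipschitz[OF assms] by (simp add: l2_of_h1_nonlin_h1)
  ultimately show ?thesis
    using norm_h1_le[of "nonlin_h1 g u - nonlin_h1 g u'"] by (simp add: algebra_simps)
qed

lemma norm_nonlin_h1_le:
  assumes "norm u \<le> M" shows "norm (nonlin_h1 g u) \<le> K * (1 + M)"
proof -
  have "norm (weak_deriv (nonlin_h1 g u)) \<le> K * norm (weak_deriv u)"
    unfolding weak_deriv_nonlin_h1 by (rule norm_l2_mult_le[OF ess_bd_nonlin_deriv[OF assms] K_nonneg])
  also have "\<dots> \<le> K * M" using assms norm_weak_deriv_le[of u] K_nonneg by (intro mult_left_mono) auto
  finally show ?thesis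
    using norm_h1_le[of "nonlin_h1 g u"] norm_nonlin_le[OF assms] by (simp add: l2_of_h1_nonlin_h1 algebra_simps)
qed

lemma source_rate_lipschitz:
  assumes "norm z \<le> M" "norm z' \<le> M"
  shows "norm (source_rate z - source_rate z') \<le> K * (3 + 4 * M) * norm (z - z')"
proof -
  have M: "norm (fst z) \<le> M" "norm (snd z) \<le> M" "norm (fst z') \<le> M" "norm (snd z') \<le> M" and M0: "0 \<le> M"
    using assms norm_fst_state_le[of z] norm_snd_state_le[of z] norm_fst_state_le[of z'] norm_snd_state_le[of z']
      norm_ge_zero[of z] by linarith+
  let ?d = "norm (z - z')"
  have d: "norm (fst z - fst z') \<le> ?d" "norm (snd z - snd z') \<le> ?d"
    using norm_fst_state_le[of "z - z'"] norm_snd_state_le[of "z - z'"] by simp_all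
  have "norm (source_rate z - source_rate z') \<le> norm (nonlin_h1 g (fst z) - nonlin_h1 g (fst z')) +
      norm (l2_mult (nonlin (deriv g) (fst z)) (snd z) - l2_mult (nonlin (deriv g) (fst z')) (snd z'))"
    unfolding norm_minus_commute[of "nonlin_h1 g (fst z)"]
    using norm_Pair_le[of "nonlin_h1 g (fst z') - nonlin_h1 g (fst z)"
        "l2_mult (nonlin (deriv g) (fst z)) (snd z) - l2_mult (nonlin (deriv g) (fst z')) (snd z')"]
    by (simp add: source_rate_def)
  also have "\<dots> \<le> K * (2 + 2 * M) * norm (fst z - fst z') + K * (2 * M * norm (fst z - fst z') + norm (snd z - snd z'))"
    by (intro add_mono nonlin_h1_lipschitz l2_mult_nonlin_lipschitz M)
  also have "\<dots> \<le> K * (2 + 2 * M) * ?d + K * (2 * M * ?d + ?d)"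
    using d K_nonneg M0 by (intro add_mono mult_left_mono) auto
  finally show ?thesis by (simp add: algebra_simps)
qed

end

end

section \<open>The null form along characteristics\<close>

text \<open>Relative to its starting point, a characteristic that carries \<open>riem (- \<sigma>)\<close> meets within time \<open>s\<close>
  those characteristics of the other family that start in \<open>{lo \<sigma> s..hi \<sigma> s}\<close>.\<close>

definition lo :: "real \<Rightarrow> real \<Rightarrow> real" where "lo \<sigma> s = min 0 (2 * \<sigma> * s)"
definition hi :: "real \<Rightarrow> real \<Rightarrow> real" where "hi \<sigma> s = max 0 (2 * \<sigma> * s)"

lemma lo_hi:
  assumes "\<sigma> = 1 \<or> \<sigma> = -1" "0 \<le> s"
  shows "lo \<sigma> s \<le> hi \<sigma> s" "hi \<sigma> s - lo \<sigma> s = 2 * s"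
    "s \<le> \<tau> \<Longrightarrow> lo \<sigma> \<tau> \<le> lo \<sigma> s" "s \<le> \<tau> \<Longrightarrow> hi \<sigma> s \<le> hi \<sigma> \<tau>"
  using assms by (auto simp: lo_def hi_def)

text \<open>The derivative of \<open>u\<close> along a characteristic that carries \<open>riem (- \<sigma>)\<close> is \<open>riem \<sigma>\<close>, and the factor
  one half comes from the relative speed of the two families. For states of finite energy the
  identity holds because both sides have the same weak derivative and the same mean.\<close>

lemma wave_flow_along_characteristic:
  assumes \<sigma>: "\<sigma> = 1 \<or> \<sigma> = -1" and s: "0 \<le> s"
  shows "l2_shift (\<sigma> * s) (l2_of_h1 (fst (wave_flow s z))) - l2_of_h1 (fst z)
    = (1/2) *\<^sub>R integral {lo \<sigma> s..hi \<sigma> s} (\<lambda>r. l2_shift r (riem \<sigma> z))" (is "?L = ?R")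
proof -
  let ?p = "riem \<sigma> z"
  let ?d = "h1_shift (\<sigma> * s) (fst (wave_flow s z)) - fst z"
  note lh = lo_hi[OF \<sigma> s]
  have "has_weak_deriv ?R ((1/2) *\<^sub>R (l2_shift (hi \<sigma> s) ?p - l2_shift (lo \<sigma> s) ?p))"
    by (intro has_weak_deriv_scaleR has_weak_deriv_integral_shift lh)
  moreover have "(1/2) *\<^sub>R (l2_shift (hi \<sigma> s) ?p - l2_shift (lo \<sigma> s) ?p) = weak_deriv ?d"
    using \<sigma> s by (auto simp: lo_def hi_def weak_deriv_riem riem_wave_flow1 riem_wave_flow2 algebra_simps mult_2)
  ultimately have w: "has_weak_deriv ?R (weak_deriv ?d)" by simp
  have "mean (integral {lo \<sigma> s..hi \<sigma> s} (\<lambda>r. l2_shift r ?p)) = integral {lo \<sigma> s..hi \<sigma> s} (\<lambda>r. mean (l2_shift r ?p))"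
    by (intro integral_bounded_linear_image bounded_linear_mean continuous_intros)
  then have m: "mean ?R = s * mean (snd z)"
    using lh by (simp add: mean_riem)
  have "h1_of_l2 ?R = ?d"
  proof (rule h1_eqI)
    show "weak_deriv (h1_of_l2 ?R) = weak_deriv ?d" by (rule weak_deriv_h1_of_l2[OF w])
    show "mean (l2_of_h1 (h1_of_l2 ?R)) = mean (l2_of_h1 ?d)"
      using fmean_wave_flow[of s z] unfolding l2_of_h1_of_l2[OF w] m by (simp add: fmean_def)
  qed
  then show ?thesis using l2_of_h1_of_l2[OF w] by simp
qed

text \<open>The square of the product of the two Riemann invariants, integrated over the pairs of points
  on opposite characteristics that meet within time \<open>s\<close>. At a fixed time it is a substitute for the
  space-time integral of \<open>(v\<^sup>2 - (\<partial>\<^sub>xu)\<^sup>2)\<^sup>2\<close>, whose integrand need not be integrable in \<open>x\<close> at a fixed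
  time.\<close>

definition null_form :: "real \<Rightarrow> real \<Rightarrow> state \<Rightarrow> real" where
  "null_form \<sigma> s z = (\<integral>x. (rep (riem (- \<sigma>) z) x)\<^sup>2 *
     window (lo \<sigma> s) (hi \<sigma> s) (\<lambda>y. (rep (riem \<sigma> z) y)\<^sup>2) x \<partial>torus)"

lemma sq_integrable_bounded_mult:
  assumes "f \<in> borel_measurable borel" "\<And>x. f (x + 1) = f x" "\<And>x. \<bar>f x\<bar> \<le> B" "sq_integrable h"
  shows "sq_integrable (\<lambda>x. f x * h x)"
  unfolding sq_integrable_def
proof (intro conjI allI)
  show "integrable torus (\<lambda>x. (f x * h x)\<^sup>2)"
  proof (rule Bochner_Integration.integrable_bound)
    show "integrable torus (\<lambda>x. B\<^sup>2 * (h x)\<^sup>2)" using assms(4) by (simp add: sq_integrable_def)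
    show "(\<lambda>x. (f x * h x)\<^sup>2) \<in> borel_measurable torus"
      using assms by (intro borel_measurable_torus borel_measurable_power borel_measurable_times) (auto simp: sq_integrable_def)
    have "(f x)\<^sup>2 \<le> B\<^sup>2" for x
    proof -
      have "\<bar>f x\<bar> \<le> \<bar>B\<bar>" using assms(3)[of x] by linarith
      then show ?thesis by (simp add: abs_le_square_iff[symmetric])
    qed
    then show "AE x in torus. norm ((f x * h x)\<^sup>2) \<le> norm (B\<^sup>2 * (h x)\<^sup>2)"
      by (intro AE_I2) (simp add: power_mult_distrib mult_right_mono)
  qed
qed (use assms in \<open>auto simp: sq_integrable_def\<close>)

lemma window_bounded:
  assumes "periodic_L1 f" "\<And>x. 0 \<le> f x" "a \<le> b"
  obtains B where "\<And>x. \<bar>window a b f x\<bar> \<le> B"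
proof -
  obtain N :: nat where N: "b - a \<le> real N" using real_arch_simple by blast
  have "\<bar>window a b f x\<bar> \<le> real N * (\<integral>x. f x \<partial>torus)" for x
    using window_le[OF assms(1), of b a N x] window_nonneg[OF assms(1), of a b x] N assms by simp
  then show ?thesis by (rule that)
qed

lemma window_widen:
  assumes "periodic_L1 f" "\<And>x. 0 \<le> f x" "c \<le> a" "a \<le> b" "b \<le> d"
  shows "window a b f x \<le> window c d f x"
proof -
  have "window c d f x = window c a f x + (window a b f x + window b d f x)"
    using window_combine[OF assms(1), of c a d x] window_combine[OF assms(1), of a b d x] assms by simp
  then show ?thesis
    using window_nonneg[OF assms(1), of c a x] window_nonneg[OF assms(1), of b d x] assms(2) by simp
qed

lemma integrable_null_form:
  assumes "a \<le> b"
  shows "integrable torus (\<lambda>x. (rep q x)\<^sup>2 * window a b (\<lambda>y. (rep p y)\<^sup>2) x)"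
proof -
  obtain B where "\<And>x. \<bar>window a b (\<lambda>y. (rep p y)\<^sup>2) x\<bar> \<le> B"
    using window_bounded[OF periodic_L1_rep(2) _ assms] by (metis zero_le_power2)
  then show ?thesis
    by (intro integrable_torus_bounded_mult[where B = B] integrable_rep_sq window_measurable) auto
qed

lemma null_form_mono:
  assumes "\<sigma> = 1 \<or> \<sigma> = -1" "0 \<le> s" "s \<le> \<tau>"
  shows "null_form \<sigma> s z \<le> null_form \<sigma> \<tau> z"
  unfolding null_form_def
  by (intro integral_mono integrable_null_form mult_left_mono window_widen periodic_L1_rep lo_hi assms)
     (use assms lo_hi(1)[OF assms(1), of \<tau>] in auto)

lemma null_form_nonneg: "0 \<le> null_form \<sigma> s z"
  unfolding null_form_def
  by (intro integral_nonneg_AE AE_I2 mult_nonneg_nonneg window_nonneg periodic_L1_rep) auto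

lemma norm_window_mult_le:
  fixes p q :: l2_torus
  assumes ab: "a \<le> b"
  defines "W \<equiv> window a b (\<lambda>y. \<bar>rep p y\<bar>)"
  shows "sq_integrable (\<lambda>x. W x * \<bar>rep q x\<bar>)"
    and "norm (cls (\<lambda>x. W x * \<bar>rep q x\<bar>))
       \<le> sqrt ((b - a) * (\<integral>x. (rep q x)\<^sup>2 * window a b (\<lambda>y. (rep p y)\<^sup>2) x \<partial>torus))"
proof -
  obtain B where B: "\<And>x. \<bar>W x\<bar> \<le> B"
    unfolding W_def using window_bounded[OF periodic_L1_rep(3) _ ab] by (metis abs_ge_zero)
  have Wm: "W \<in> borel_measurable borel" unfolding W_def by (rule window_measurable) measurable
  have Wp: "W (x + 1) = W x" for x unfolding W_def by (rule window_periodic) (simp add: rep_periodic)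
  show sq: "sq_integrable (\<lambda>x. W x * \<bar>rep q x\<bar>)"
    by (rule sq_integrable_bounded_mult[OF Wm Wp B sq_integrable_abs[OF sq_integrable_rep]])
  have "(norm (cls (\<lambda>x. W x * \<bar>rep q x\<bar>)))\<^sup>2 = (\<integral>x. (W x * \<bar>rep q x\<bar>)\<^sup>2 \<partial>torus)"
    by (rule norm_l2_abs[OF sq])
  also have "\<dots> \<le> (\<integral>x. (b - a) * ((rep q x)\<^sup>2 * window a b (\<lambda>y. (rep p y)\<^sup>2) x) \<partial>torus)"
  proof (rule integral_mono)
    show "integrable torus (\<lambda>x. (W x * \<bar>rep q x\<bar>)\<^sup>2)" using sq by (simp add: sq_integrable_def)
    show "integrable torus (\<lambda>x. (b - a) * ((rep q x)\<^sup>2 * window a b (\<lambda>y. (rep p y)\<^sup>2) x))"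
      using integrable_null_form[OF ab, of q p] by simp
    fix x
    have "(W x)\<^sup>2 \<le> (b - a) * window a b (\<lambda>y. (rep p y)\<^sup>2) x"
      unfolding W_def by (rule window_abs_sq_le[OF sq_integrable_rep ab])
    then have "(W x)\<^sup>2 * (rep q x)\<^sup>2 \<le> (b - a) * window a b (\<lambda>y. (rep p y)\<^sup>2) x * (rep q x)\<^sup>2"
      by (rule mult_right_mono) simp
    then show "(W x * \<bar>rep q x\<bar>)\<^sup>2 \<le> (b - a) * ((rep q x)\<^sup>2 * window a b (\<lambda>y. (rep p y)\<^sup>2) x)"
      by (simp add: power_mult_distrib mult_ac)
  qed
  finally show "norm (cls (\<lambda>x. W x * \<bar>rep q x\<bar>))
       \<le> sqrt ((b - a) * (\<integral>x. (rep q x)\<^sup>2 * window a b (\<lambda>y. (rep p y)\<^sup>2) x \<partial>torus))"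
    by (intro real_le_rsqrt) simp
qed

context C2_nonlinearity
begin

text \<open>The invariants of the source rate are \<open>g'(u)\<close> times the invariants of \<open>(u, v)\<close> with the two
  families exchanged. They therefore move with the opposite characteristic speed: forward in time
  the source rate evolves, to leading order, by the backward linear flow. This is why the scheme
  contains the operator \<open>\<phi>\<^sub>2(-2\<tau>A)\<close>.\<close>

lemma riem_source_rate:
  assumes "nonlin_bounds M K" "norm (fst z) \<le> M"
  shows "riem \<sigma> (source_rate z) = l2_mult (nonlin (deriv g) (fst z)) (riem (- \<sigma>) z)"
  using l2_mult_diff_right[OF ess_bd_nonlin_deriv[OF assms] K_nonneg[OF assms(1)]]
    l2_mult_scaleR_right[OF ess_bd_nonlin_deriv[OF assms]]
  by (simp add: source_rate_def riem_def weak_deriv_nonlin_h1)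

text \<open>Put \<open>q\<close> for the invariant \<open>riem (- \<sigma>) z\<close> and \<open>p\<close> for \<open>riem \<sigma> z\<close>. Along the characteristic that
  transports \<open>q\<close>, the product \<open>g'(u) q\<close> changes for two reasons: \<open>q\<close> is not exactly transported, which
  costs a multiple of \<open>\<rho>\<close>, and \<open>u\<close> changes by half the integral of \<open>p\<close> over the interval that is swept
  over, up to \<open>2 \<rho>\<close>. The second effect is estimated by the Cauchy--Schwarz inequality on that
  interval and leaves the null form.\<close>

lemma riem_source_rate_increment:
  assumes K: "nonlin_bounds M K" and \<sigma>: "\<sigma> = 1 \<or> \<sigma> = -1" and s: "0 \<le> s"
    and z: "norm z \<le> M" "norm z' \<le> M" and \<rho>: "norm (z' - wave_flow s z) \<le> \<rho>"
  shows "norm (riem \<sigma> (source_rate z' - wave_flow (- s) (source_rate z)))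
    \<le> K * (sqrt (2 * s * null_form \<sigma> s z) + (4 * M + 2) * \<rho>)"
proof -
  note lh = lo_hi[OF \<sigma> s]
  have \<sigma>': "- \<sigma> = 1 \<or> - \<sigma> = -1" using \<sigma> by auto
  note K0 = K_nonneg[OF K]
  have fz: "norm (fst z) \<le> M" "norm (fst z') \<le> M" using z norm_fst_state_le order_trans by blast+
  have \<rho>0: "0 \<le> \<rho>" using \<rho> norm_ge_zero order_trans by blast
  define R where "R = z' - wave_flow s z"
  have z': "z' = wave_flow s z + R" by (simp add: R_def)
  define p q where "p = riem \<sigma> z" and "q = riem (- \<sigma>) z"
  define a a' where "a = l2_of_h1 (fst z)" and "a' = l2_shift (\<sigma> * s) (l2_of_h1 (fst z'))"
  let ?c = "l2_comp (deriv g)"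
  have ea: "ess_bd (2 * M) a" "ess_bd (2 * M) a'"
    unfolding a_def a'_def by (intro ess_bd_shift ess_bd_2M[OF K] fz)+
  have ca: "ess_bd K (?c a)" using ess_bd_nonlin_deriv[OF K fz(1)] by (simp add: a_def nonlin_def)
  have ca'0: "ess_bd K (nonlin (deriv g) (fst z'))" by (rule ess_bd_nonlin_deriv[OF K fz(2)])
  have ca'_eq: "l2_shift (\<sigma> * s) (nonlin (deriv g) (fst z')) = ?c a'"
    unfolding a'_def nonlin_def by (rule l2_shift_comp[OF g'_cont ess_bd_l2_of_h1])
  have ca': "ess_bd K (?c a')" using ess_bd_shift[OF ca'0, of "\<sigma> * s"] by (simp add: ca'_eq)
  have q': "l2_shift (\<sigma> * s) (riem (- \<sigma>) z') = q + l2_shift (\<sigma> * s) (riem (- \<sigma>) R)"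
    by (simp add: z' q_def riem_wave_flow[OF \<sigma>'])
  have nq: "norm q \<le> 2 * M" unfolding q_def using norm_riem_le[OF \<sigma>', of z] z(1) by simp
  have M0: "0 \<le> M" using z(1) norm_ge_zero order_trans by blast
  let ?X = "riem \<sigma> (source_rate z' - wave_flow (- s) (source_rate z))"
  \<comment> \<open>Following the characteristic amounts to a translation by \<open>\<sigma> s\<close>, which preserves the norm.\<close>
  have "l2_shift (\<sigma> * s) ?X = l2_shift (\<sigma> * s) (riem \<sigma> (source_rate z')) - riem \<sigma> (source_rate z)"
    by (simp add: riem_wave_flow[OF \<sigma>])
  also have "riem \<sigma> (source_rate z) = l2_mult (?c a) q"
    by (simp add: riem_source_rate[OF K fz(1)] a_def q_def nonlin_def)
  also have "l2_shift (\<sigma> * s) (riem \<sigma> (source_rate z')) = l2_mult (?c a') (q + l2_shift (\<sigma> * s) (riem (- \<sigma>) R))"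
    by (simp add: riem_source_rate[OF K fz(2)] l2_shift_mult[OF ca'0] ca'_eq q' del: l2_shift_linear_simps)
  finally have X: "l2_shift (\<sigma> * s) ?X = l2_mult (?c a' - ?c a) q + l2_mult (?c a') (l2_shift (\<sigma> * s) (riem (- \<sigma>) R))"
    by (simp add: l2_mult_add_right[OF ca'] l2_mult_diff_left[OF ca' ca])
  have 2: "norm (l2_mult (?c a') (l2_shift (\<sigma> * s) (riem (- \<sigma>) R))) \<le> K * (2 * \<rho>)"
  proof -
    have "norm (l2_shift (\<sigma> * s) (riem (- \<sigma>) R)) \<le> 2 * \<rho>"
      using norm_riem_le[OF \<sigma>', of R] \<rho> by (simp add: R_def del: riem_simps)
    then show ?thesis
      using norm_l2_mult_le[OF ca' K0] mult_left_mono[OF _ K0] order_trans by blast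
  qed
  define W where "W = window (lo \<sigma> s) (hi \<sigma> s) (\<lambda>y. \<bar>rep p y\<bar>)"
  note Wq = norm_window_mult_le[OF lh(1), of p q, folded W_def]
  have inc: "AE x in torus. \<bar>rep (a' - a) x\<bar> \<le> (1/2) * W x + 2 * \<rho>"
  proof -
    let ?I = "integral {lo \<sigma> s..hi \<sigma> s} (\<lambda>r. l2_shift r p)"
    let ?e = "l2_shift (\<sigma> * s) (l2_of_h1 (fst R))"
    have "a' - a = (1/2) *\<^sub>R ?I + ?e"
      using wave_flow_along_characteristic[OF \<sigma> s, of z] by (simp add: a'_def a_def z' p_def)
    moreover have "ess_bd (2 * \<rho>) ?e"
      using \<rho> norm_fst_state_le[of R] by (intro ess_bd_shift ess_bd_mono[OF ess_bd_l2_of_h1]) (simp add: R_def)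
    moreover have "?I = cls (window (lo \<sigma> s) (hi \<sigma> s) (rep p))"
      using integral_shift_eq_window[OF sq_integrable_rep[of p] lh(1)] by (simp add: abs_rep_l2)
    moreover have "\<bar>window (lo \<sigma> s) (hi \<sigma> s) (rep p) x\<bar> \<le> W x" for x
      using set_integral_norm_bound[OF window_integrable[OF periodic_L1_rep(1)[of p], of "lo \<sigma> s" "hi \<sigma> s" x]]
      by (simp add: window_def W_def)
    ultimately have I: "AE x in torus. \<bar>rep ?I x\<bar> \<le> W x" and e: "ess_bd (2 * \<rho>) ?e" and d: "a' - a = (1/2) *\<^sub>R ?I + ?e"
      using rep_abs_l2[OF sq_integrable_window[OF sq_integrable_rep[of p] lh(1)]]
      by (auto elim!: eventually_mono)
    show ?thesis
      using I e rep_l2_add[of "(1/2) *\<^sub>R ?I" ?e] rep_l2_scaleR[of "1/2" ?I] unfolding ess_bd_def d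
      by eventually_elim linarith
  qed
  let ?f = "\<lambda>x. K * (W x * \<bar>rep q x\<bar>) + K * (2 * \<rho>) * \<bar>rep q x\<bar>"
  have nn: "0 \<le> W x" for x unfolding W_def by (intro window_nonneg periodic_L1_rep) auto
  have aq: "sq_integrable (\<lambda>x. \<bar>rep q x\<bar>)" by (intro sq_integrable_abs sq_integrable_rep)
  have sf: "sq_integrable ?f" by (intro sq_integrable_add sq_integrable_scale Wq aq)
  have "norm (l2_mult (?c a' - ?c a) q) = norm (cls (rep (l2_mult (?c a' - ?c a) q)))"
    by (simp add: abs_rep_l2)
  also have "\<dots> \<le> norm (cls ?f)"
  proof (rule norm_le_of_AE[OF sq_integrable_rep sf])
    show "AE x in torus. \<bar>rep (l2_mult (?c a' - ?c a) q) x\<bar> \<le> \<bar>?f x\<bar>"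
      using rep_l2_mult[OF ess_bd_diff[OF ca' ca], of q] comp_deriv_lipschitz[OF K ea(2,1)] inc
    proof eventually_elim
      case (elim x)
      have "\<bar>rep (a' - a) x\<bar> \<le> W x + 2 * \<rho>" using elim(3) nn[of x] by linarith
      then have "\<bar>rep (?c a' - ?c a) x\<bar> \<le> K * (W x + 2 * \<rho>)"
        using elim(2) mult_left_mono[OF _ K0] order_trans by blast
      then have "\<bar>rep (?c a' - ?c a) x\<bar> * \<bar>rep q x\<bar> \<le> K * (W x + 2 * \<rho>) * \<bar>rep q x\<bar>"
        by (rule mult_right_mono) simp
      also have "\<dots> = ?f x" by (simp add: algebra_simps)
      finally show ?case using elim(1) by (simp add: abs_mult)
    qed
  qed
  also have "cls ?f = K *\<^sub>R cls (\<lambda>x. W x * \<bar>rep q x\<bar>) + (K * (2 * \<rho>)) *\<^sub>R cls (\<lambda>x. \<bar>rep q x\<bar>)"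
    using aq Wq(1) by (simp add: abs_l2_add abs_l2_scaleR sq_integrable_scale)
  also have "norm \<dots> \<le> K * norm (cls (\<lambda>x. W x * \<bar>rep q x\<bar>)) + K * (2 * \<rho>) * norm q"
  proof (rule norm_triangle_le)
    have "norm (cls (\<lambda>x. \<bar>rep q x\<bar>)) \<le> norm (cls (rep q))"
      by (rule norm_le_of_AE[OF aq sq_integrable_rep]) simp
    then show "norm (K *\<^sub>R cls (\<lambda>x. W x * \<bar>rep q x\<bar>)) + norm ((K * (2 * \<rho>)) *\<^sub>R cls (\<lambda>x. \<bar>rep q x\<bar>))
      \<le> K * norm (cls (\<lambda>x. W x * \<bar>rep q x\<bar>)) + K * (2 * \<rho>) * norm q"
      using K0 \<rho>0 by (simp add: abs_rep_l2 mult_left_mono)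
  qed
  also have "\<dots> \<le> K * sqrt (2 * s * null_form \<sigma> s z) + K * (2 * \<rho>) * (2 * M)"
    using Wq(2) nq K0 \<rho>0 lh(2) by (intro add_mono mult_left_mono) (simp_all add: null_form_def p_def q_def)
  finally have 1: "norm (l2_mult (?c a' - ?c a) q) \<le> K * sqrt (2 * s * null_form \<sigma> s z) + K * (2 * \<rho>) * (2 * M)" .
  have "norm ?X = norm (l2_shift (\<sigma> * s) ?X)" by (rule norm_l2_shift[symmetric])
  also have "\<dots> \<le> (K * sqrt (2 * s * null_form \<sigma> s z) + K * (2 * \<rho>) * (2 * M)) + K * (2 * \<rho>)"
    unfolding X by (rule norm_triangle_le[OF add_mono[OF 1 2]])
  finally show ?thesis by (simp add: algebra_simps)
qed

end

section \<open>The local error\<close>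

text \<open>The increment of \<open>f\<close> is differentiated in \<open>L\<^sup>2\<close> and its value at \<open>t\<close>, which lies in \<open>H\<^sup>1\<close>, along the
  translations.\<close>

lemma shift_moving_derivative:
  assumes "(f has_vector_derivative f') (at t within S)" "f t = l2_of_h1 \<phi>"
  shows "((\<lambda>s. l2_shift (c * s) (f s)) has_vector_derivative l2_shift (c * t) (f' + c *\<^sub>R weak_deriv \<phi>)) (at t within S)"
proof -
  have "((\<lambda>s. l2_shift (c * s) ((f s - f t) /\<^sub>R (s - t))) \<longlongrightarrow> l2_shift (c * t) f') (at t within S)"
    using assms(1) by (intro l2_shift_tendsto tendsto_intros) (simp add: has_vector_derivative_quotient)
  then have "((\<lambda>s. l2_shift (c * s) (f s - f t)) has_vector_derivative l2_shift (c * t) f') (at t within S)"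
    by (simp add: has_vector_derivative_quotient)
  from has_vector_derivative_add[OF this weak_deriv_shift_derivative[of c \<phi> t S]]
  show ?thesis by (simp add: assms(2))
qed

context C2_nonlinearity
begin

definition step :: "real \<Rightarrow> state \<Rightarrow> state" where
  "step \<tau> z = wave_flow \<tau> (z + \<tau> *\<^sub>R (0, nonlin g (fst z)) +
      integral {0..\<tau>} (\<lambda>s. (\<tau> - s) *\<^sub>R wave_flow (- 2 * s) (source_rate z)))"

lemma scheme_step_eq:
  assumes "0 < \<tau>"
  shows "scheme_step g \<tau> z = step \<tau> z"
proof -
  obtain u v where z: "z = (u, v)" by (cases z)
  have "\<tau>\<^sup>2 *\<^sub>R (1 / \<tau>\<^sup>2) *\<^sub>R x = x" for x :: state using assms by simp
  then show ?thesis
    unfolding z scheme_step_def step_def phi2_def source_rate_def wave_group_eq by simp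
qed

end

locale bounded_solution = C2_nonlinearity +
  fixes T M K :: real and u :: "real \<Rightarrow> h1_torus" and v :: "real \<Rightarrow> l2_torus"
  assumes sol: "wave_solution {0..T} (nonlin g) u v"
    and bound: "\<And>t. t \<in> {0..T} \<Longrightarrow> norm (u t, v t) \<le> M"
    and K: "nonlin_bounds M K"
begin

abbreviation U :: "real \<Rightarrow> state" where "U t \<equiv> (u t, v t)"

lemmas K0 = K_nonneg[OF K]

lemma norm_u: "t \<in> {0..T} \<Longrightarrow> norm (u t) \<le> M" and norm_v: "t \<in> {0..T} \<Longrightarrow> norm (v t) \<le> M"
  using bound[of t] norm_fst_state_le[of "U t"] norm_snd_state_le[of "U t"] by simp_all

lemma u_cont: "continuous_on {0..T} u" and v_cont: "continuous_on {0..T} v"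
  using wave_solution_continuous[OF sol] by simp_all

lemma lipschitz_continuous:
  assumes "\<And>x y. norm x \<le> M \<Longrightarrow> norm y \<le> M \<Longrightarrow> norm (F x - F y) \<le> L * norm (x - y)"
    and "continuous_on S f" "\<And>s. s \<in> S \<Longrightarrow> norm (f s) \<le> M"
  shows "continuous_on S (\<lambda>s. F (f s))"
  unfolding continuous_on_def
proof
  fix t assume t: "t \<in> S"
  have "((\<lambda>s. L * norm (f s - f t)) \<longlongrightarrow> L * norm (f t - f t)) (at t within S)"
    using assms(2) t by (intro tendsto_intros) (auto simp: continuous_on_def)
  then have "((\<lambda>s. L * norm (f s - f t)) \<longlongrightarrow> 0) (at t within S)" by simp
  then have "((\<lambda>s. F (f s) - F (f t)) \<longlongrightarrow> 0) (at t within S)"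
  proof (rule Lim_null_comparison[rotated])
    show "\<forall>\<^sub>F s in at t within S. norm (F (f s) - F (f t)) \<le> L * norm (f s - f t)"
      using assms(1,3) t by (simp add: eventually_at_filter)
  qed
  then show "((\<lambda>s. F (f s)) \<longlongrightarrow> F (f t)) (at t within S)" by (simp add: LIM_zero_iff)
qed

lemma nonlin_h1_cont: "continuous_on {0..T} (\<lambda>t. nonlin_h1 g (u t))"
  by (rule lipschitz_continuous[OF nonlin_h1_lipschitz[OF K] u_cont norm_u])

lemma nonlin_cont: "continuous_on {0..T} (\<lambda>t. nonlin g (u t))"
  using bounded_linear.continuous_on[OF bounded_linear_l2_of_h1 nonlin_h1_cont]
  by (simp add: l2_of_h1_nonlin_h1)

lemma source_rate_cont: "continuous_on {0..T} (\<lambda>t. source_rate (U t))"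
  by (rule lipschitz_continuous[OF source_rate_lipschitz[OF K] continuous_on_Pair[OF u_cont v_cont] bound])

lemma norm_source_le:
  assumes "t \<in> {0..T}" "0 \<le> r" "r \<le> 1"
  shows "norm (wave_flow (- r) (0, nonlin g (u t))) \<le> 2 * K"
proof -
  have "norm (wave_flow (- r) (0, nonlin g (u t))) \<le> (1 + \<bar>- r\<bar>) * norm (0 :: h1_torus, nonlin g (u t))"
    by (rule norm_wave_flow_le)
  also have "\<dots> \<le> 2 * K"
    using assms norm_nonlin_le[OF K norm_u[OF assms(1)]] by (intro mult_mono) (auto simp: norm_Pair)
  finally show ?thesis .
qed

lemma U_increment:
  assumes "0 \<le> t" "0 \<le> s" "s \<le> 1" "t + s \<le> T"
  shows "norm (U (t + s) - wave_flow s (U t)) \<le> 4 * K * s"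
proof -
  let ?I = "integral {0..s} (\<lambda>r. wave_flow (- r) (0, nonlin g (u (t + r))))"
  have sub: "{t..t + s} \<subseteq> {0..T}" using assms by auto
  have "U (t + s) = wave_flow s (U t + ?I)"
    by (rule duhamel[OF sol assms(2) sub continuous_on_subset[OF nonlin_cont sub]])
  then have "norm (U (t + s) - wave_flow s (U t)) = norm (wave_flow s ?I)" by simp
  also have "\<dots> \<le> (1 + \<bar>s\<bar>) * norm ?I" by (rule norm_wave_flow_le)
  also have "\<dots> \<le> 2 * (2 * K * (s - 0))"
  proof (intro mult_mono integral_bound)
    show "continuous_on {0..s} (\<lambda>r. wave_flow (- r) (0, nonlin g (u (t + r))))"
      using assms by (intro continuous_intros continuous_on_compose2[OF nonlin_cont]) auto
    show "norm (wave_flow (- r) (0, nonlin g (u (t + r)))) \<le> 2 * K" if "r \<in> {0..s}" for r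
      using that assms by (intro norm_source_le) auto
  qed (use assms K0 in auto)
  finally show ?thesis by simp
qed

lemma l2_u_increment:
  assumes "0 \<le> t" "0 \<le> s" "t + s \<le> T"
  shows "norm (l2_of_h1 (u (t + s)) - l2_of_h1 (u t)) \<le> M * s"
proof -
  have sub: "{t..t + s} \<subseteq> {0..T}" using assms by auto
  have "(v has_integral l2_of_h1 (u (t + s)) - l2_of_h1 (u t)) {t..t + s}"
    by (rule fundamental_theorem_of_calculus)
       (use assms sub in \<open>auto intro!: has_vector_derivative_within_subset[OF wave_solution_l2_derivative[OF sol] sub]\<close>)
  then have "l2_of_h1 (u (t + s)) - l2_of_h1 (u t) = integral {t..t + s} v" by (simp add: integral_unique)
  also have "norm \<dots> \<le> M * (t + s - t)"
    by (rule integral_bound) (use assms sub norm_v in \<open>auto intro: continuous_on_subset[OF v_cont]\<close>)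
  finally show ?thesis by simp
qed

lemma moving_source_derivative:
  assumes "0 \<le> t" "t + \<tau> \<le> T" "s \<in> {0..\<tau>}"
  shows "((\<lambda>s. wave_flow (- s) (0, nonlin g (u (t + s)))) has_vector_derivative
     wave_flow (- s) (source_rate (U (t + s)))) (at s within {0..\<tau>})"
proof -
  define f where "f s = nonlin g (u (t + s))" for s
  define f' where "f' = l2_mult (nonlin (deriv g) (u (t + s))) (v (t + s))"
  define \<phi> where "\<phi> = nonlin_h1 g (u (t + s))"
  have fphi: "f s = l2_of_h1 \<phi>" by (simp add: f_def \<phi>_def l2_of_h1_nonlin_h1)
  have ts: "t + s \<in> {0..T}" using assms by auto
  have im: "(+) t ` {0..\<tau>} \<subseteq> {0..T}" using assms by auto
  have "((\<lambda>s. nonlin g (u s)) has_vector_derivative f') (at (t + s) within {0..T})"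
    unfolding f'_def
    by (rule nonlin_time_derivative[OF g_deriv g'_cont norm_u ts])
       (use u_cont ts wave_solution_l2_derivative[OF sol ts] in \<open>auto simp: continuous_on_def\<close>)
  then have "((\<lambda>s. nonlin g (u s)) has_vector_derivative f') (at (t + s) within (+) t ` {0..\<tau>})"
    by (rule has_vector_derivative_within_subset[OF _ im])
  moreover have "((+) t has_vector_derivative 1) (at s within {0..\<tau>})"
    by (auto intro!: derivative_eq_intros)
  ultimately have df: "(f has_vector_derivative f') (at s within {0..\<tau>})"
    using vector_diff_chain_within[of "(+) t" 1 s "{0..\<tau>}" "\<lambda>s. nonlin g (u s)" f'] by (simp add: o_def f_def [abs_def])
  have sr: "source_rate (U (t + s)) = (- \<phi>, f')" by (simp add: source_rate_def \<phi>_def f'_def)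
  show ?thesis
    unfolding sr f_def[symmetric]
  proof (rule state_has_vector_derivative)
    have "((\<lambda>s. mean (f s)) has_real_derivative mean f') (at s within {0..\<tau>})"
      unfolding has_real_derivative_iff_has_vector_derivative
      by (rule bounded_linear.has_vector_derivative[OF bounded_linear_mean df])
    then have "((\<lambda>s. - (s * mean (f s))) has_real_derivative - mean (f s) - s * mean f') (at s within {0..\<tau>})"
      by (auto intro!: derivative_eq_intros)
    then show "((\<lambda>s. fmean (wave_flow (- s) (0, f s))) has_vector_derivative fmean (wave_flow (- s) (- \<phi>, f'))) (at s within {0..\<tau>})"
      by (simp add: has_real_derivative_iff_has_vector_derivative fmean_def[of "(- \<phi>, f')"] fphi)
    have "((\<lambda>s. l2_shift (- 1 * s) (f s)) has_vector_derivative l2_shift (- 1 * s) (f' + (-1) *\<^sub>R weak_deriv \<phi>)) (at s within {0..\<tau>})"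
      by (rule shift_moving_derivative[OF df fphi])
    then show "((\<lambda>s. riem 1 (wave_flow (- s) (0, f s))) has_vector_derivative riem 1 (wave_flow (- s) (- \<phi>, f'))) (at s within {0..\<tau>})"
      by (simp add: riem_wave_flow1 riem_def[of 1 "(- \<phi>, f')"])
    have "((\<lambda>s. l2_shift (1 * s) (f s)) has_vector_derivative l2_shift (1 * s) (f' + 1 *\<^sub>R weak_deriv \<phi>)) (at s within {0..\<tau>})"
      by (rule shift_moving_derivative[OF df fphi])
    then show "((\<lambda>s. riem (-1) (wave_flow (- s) (0, f s))) has_vector_derivative riem (-1) (wave_flow (- s) (- \<phi>, f'))) (at s within {0..\<tau>})"
      by (simp add: riem_wave_flow2 riem_def[of "-1" "(- \<phi>, f')"])
  qed
qed

text \<open>Integration by parts of \<open>\<tau> - s\<close> times the transported source: a Taylor expansion of Duhamel's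
  integral whose remainder contains the source rate along the solution.\<close>

lemma source_integral_expansion:
  assumes "0 \<le> t" "0 \<le> \<tau>" "t + \<tau> \<le> T"
  shows "integral {0..\<tau>} (\<lambda>s. wave_flow (- s) (0, nonlin g (u (t + s)))) = \<tau> *\<^sub>R (0, nonlin g (u t)) +
     integral {0..\<tau>} (\<lambda>s. (\<tau> - s) *\<^sub>R wave_flow (- s) (source_rate (U (t + s))))" (is "integral _ ?F = _ + integral _ ?G")
proof -
  have cF: "continuous_on {0..\<tau>} ?F"
    using assms by (intro continuous_intros continuous_on_compose2[OF nonlin_cont]) auto
  have cG: "continuous_on {0..\<tau>} ?G"
    using assms by (intro continuous_intros continuous_on_compose2[OF source_rate_cont]) auto
  have "((\<lambda>s. ?G s - ?F s) has_integral (\<tau> - \<tau>) *\<^sub>R ?F \<tau> - (\<tau> - 0) *\<^sub>R ?F 0) {0..\<tau>}"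
  proof (rule fundamental_theorem_of_calculus[OF assms(2)])
    fix s assume s: "s \<in> {0..\<tau>}"
    have "((\<lambda>s. (\<tau> - s) *\<^sub>R ?F s) has_vector_derivative (\<tau> - s) *\<^sub>R wave_flow (- s) (source_rate (U (t + s))) + (-1) *\<^sub>R ?F s) (at s within {0..\<tau>})"
      by (rule has_vector_derivative_scaleR[OF _ moving_source_derivative[OF assms(1,3) s]])
         (auto intro!: derivative_eq_intros)
    then show "((\<lambda>s. (\<tau> - s) *\<^sub>R ?F s) has_vector_derivative ?G s - ?F s) (at s within {0..\<tau>})" by simp
  qed
  then have "integral {0..\<tau>} (\<lambda>s. ?G s - ?F s) = - (\<tau> *\<^sub>R (0, nonlin g (u t)))"
    by (simp add: integral_unique)
  moreover have "integral {0..\<tau>} (\<lambda>s. ?G s - ?F s) = integral {0..\<tau>} ?G - integral {0..\<tau>} ?F"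
    by (intro integral_diff integrable_continuous_real cF cG)
  ultimately have "integral {0..\<tau>} ?G - integral {0..\<tau>} ?F = - (\<tau> *\<^sub>R (0, nonlin g (u t)))" by simp
  moreover have "y = w + x" if h: "x - y = - w" for x y w :: state
  proof -
    have "y = w + (y + (x - y))" unfolding h by simp
    then show ?thesis by simp
  qed
  ultimately show ?thesis by blast
qed

text \<open>The scheme replaces the source rate along the solution by its backward linear evolution.\<close>

definition defect :: "real \<Rightarrow> real \<Rightarrow> state" where
  "defect t s = source_rate (U (t + s)) - wave_flow (- s) (source_rate (U t))"

text \<open>The defect is of order \<open>\<tau>\<close>, apart from the null forms. These are of order \<open>\<tau>\<close> only on average
  over the time steps.\<close>

lemma norm_defect_le:
  assumes "0 \<le> t" "0 \<le> s" "s \<le> \<tau>" "\<tau> \<le> 1" "t + \<tau> \<le> T"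
  shows "norm (defect t s) \<le> K * (2 * M + 16 * K * (4 * M + 2)) * \<tau>
     + 2 * K * sqrt (2 * \<tau>) * (sqrt (null_form 1 \<tau> (U t)) + sqrt (null_form (-1) \<tau> (U t)))"
proof -
  have t: "t \<in> {0..T}" "t + s \<in> {0..T}" using assms by auto
  have M0: "0 \<le> M" using bound[OF t(1)] norm_ge_zero order_trans by blast
  have r: "norm (riem \<sigma> (defect t s)) \<le> K * (sqrt (2 * \<tau>) * sqrt (null_form \<sigma> \<tau> (U t)) + (4 * M + 2) * (4 * K * \<tau>))"
    if \<sigma>: "\<sigma> = 1 \<or> \<sigma> = -1" for \<sigma>
  proof -
    have "norm (riem \<sigma> (defect t s)) \<le> K * (sqrt (2 * s * null_form \<sigma> s (U t)) + (4 * M + 2) * (4 * K * s))"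
      unfolding defect_def
      by (rule riem_source_rate_increment[OF K \<sigma> assms(2) bound[OF t(1)] bound[OF t(2)]])
         (use assms in \<open>auto intro!: U_increment\<close>)
    also have "\<dots> \<le> K * (sqrt (2 * \<tau> * null_form \<sigma> \<tau> (U t)) + (4 * M + 2) * (4 * K * \<tau>))"
      using assms K0 M0 null_form_mono[OF \<sigma> assms(2,3)] null_form_nonneg
      by (intro mult_left_mono add_mono real_sqrt_le_mono mult_mono) auto
    finally show ?thesis by (simp add: real_sqrt_mult)
  qed
  have "\<bar>fmean (defect t s)\<bar> \<le> K * (M * s) + s * (K * M)"
  proof -
    have "fmean (defect t s) = - mean (nonlin g (u (t + s)) - nonlin g (u t)) + s * mean (l2_mult (nonlin (deriv g) (u t)) (v t))"
      by (simp add: defect_def source_rate_def fmean_def l2_of_h1_nonlin_h1 fmean_wave_flow[unfolded fmean_def])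
    moreover have "\<bar>mean (nonlin g (u (t + s)) - nonlin g (u t))\<bar> \<le> K * (M * s)"
    proof -
      have "\<bar>mean (nonlin g (u (t + s)) - nonlin g (u t))\<bar> \<le> norm (nonlin g (u (t + s)) - nonlin g (u t))" by (rule abs_mean_le)
      also have "\<dots> \<le> K * norm (l2_of_h1 (u (t + s)) - l2_of_h1 (u t))"
        by (rule nonlin_lipschitz_l2[OF K norm_u[OF t(2)] norm_u[OF t(1)]])
      also have "\<dots> \<le> K * (M * s)" using assms K0 by (intro mult_left_mono l2_u_increment) auto
      finally show ?thesis .
    qed
    moreover have "\<bar>s * mean (l2_mult (nonlin (deriv g) (u t)) (v t))\<bar> \<le> s * (K * M)"
    proof -
      have "\<bar>mean (l2_mult (nonlin (deriv g) (u t)) (v t))\<bar> \<le> K * norm (v t)"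
        using abs_mean_le norm_l2_mult_le[OF ess_bd_nonlin_deriv[OF K norm_u[OF t(1)]] K0] order_trans by blast
      also have "\<dots> \<le> K * M" using norm_v[OF t(1)] K0 by (rule mult_left_mono)
      finally show ?thesis using assms(2) by (simp add: abs_mult mult_left_mono)
    qed
    ultimately show ?thesis by linarith
  qed
  also have "\<dots> \<le> K * (2 * M) * \<tau>"
    using mult_left_mono[OF assms(3), of "K * M"] K0 M0 by (simp add: algebra_simps)
  finally have m: "\<bar>fmean (defect t s)\<bar> \<le> K * (2 * M) * \<tau>" .
  have "norm (defect t s) \<le> \<bar>fmean (defect t s)\<bar> + 2 * (norm (riem 1 (defect t s)) + norm (riem (-1) (defect t s)))"
    by (rule norm_state_le)
  also have "\<dots> \<le> K * (2 * M) * \<tau> + 2 * (K * (sqrt (2 * \<tau>) * sqrt (null_form 1 \<tau> (U t)) + (4 * M + 2) * (4 * K * \<tau>))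
      + K * (sqrt (2 * \<tau>) * sqrt (null_form (-1) \<tau> (U t)) + (4 * M + 2) * (4 * K * \<tau>)))"
    using m r by (intro add_mono mult_left_mono) auto
  finally show ?thesis by (simp add: algebra_simps)
qed

lemma local_error:
  assumes "0 \<le> t" "0 \<le> \<tau>" "\<tau> \<le> 1" "t + \<tau> \<le> T" and E: "\<And>s. 0 \<le> s \<Longrightarrow> s \<le> \<tau> \<Longrightarrow> norm (defect t s) \<le> E"
  shows "norm (U (t + \<tau>) - step \<tau> (U t)) \<le> 4 * \<tau>\<^sup>2 * E"
proof -
  have E0: "0 \<le> E" using E[of 0] assms(2) norm_ge_zero order_trans by blast
  let ?F = "\<lambda>s. wave_flow (- s) (0, nonlin g (u (t + s)))"
  let ?G = "\<lambda>s. (\<tau> - s) *\<^sub>R wave_flow (- s) (source_rate (U (t + s)))"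
  let ?H = "\<lambda>s. (\<tau> - s) *\<^sub>R wave_flow (- 2 * s) (source_rate (U t))"
  let ?D = "\<lambda>s. (\<tau> - s) *\<^sub>R wave_flow (- s) (defect t s)"
  have sub: "{t..t + \<tau>} \<subseteq> {0..T}" using assms by auto
  have cG: "continuous_on {0..\<tau>} ?G"
    using assms by (intro continuous_intros continuous_on_compose2[OF source_rate_cont]) auto
  have cH: "continuous_on {0..\<tau>} ?H" by (intro continuous_intros)
  have D_eq: "?D s = ?G s - ?H s" for s by (simp add: defect_def scaleR_diff_right)
  have "U (t + \<tau>) = wave_flow \<tau> (U t + integral {0..\<tau>} ?F)"
    by (rule duhamel[OF sol assms(2) sub continuous_on_subset[OF nonlin_cont sub]])
  also have "integral {0..\<tau>} ?F = \<tau> *\<^sub>R (0, nonlin g (u t)) + integral {0..\<tau>} ?G"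
    by (rule source_integral_expansion[OF assms(1,2,4)])
  finally have "U (t + \<tau>) - step \<tau> (U t) = wave_flow \<tau> (integral {0..\<tau>} ?G - integral {0..\<tau>} ?H)"
    by (simp add: step_def del: add_Pair scaleR_Pair)
  also have "integral {0..\<tau>} ?G - integral {0..\<tau>} ?H = integral {0..\<tau>} ?D"
    unfolding D_eq by (intro integral_diff[symmetric] integrable_continuous_real cG cH)
  finally have "norm (U (t + \<tau>) - step \<tau> (U t)) = norm (wave_flow \<tau> (integral {0..\<tau>} ?D))" by simp
  also have "\<dots> \<le> (1 + \<bar>\<tau>\<bar>) * norm (integral {0..\<tau>} ?D)" by (rule norm_wave_flow_le)
  also have "\<dots> \<le> 2 * (\<tau> * (2 * E) * (\<tau> - 0))"
  proof (intro mult_mono integral_bound)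
    show "continuous_on {0..\<tau>} ?D" unfolding D_eq by (intro continuous_on_diff cG cH)
    fix s assume s: "s \<in> {0..\<tau>}"
    have "norm (wave_flow (- s) (defect t s)) \<le> (1 + \<bar>- s\<bar>) * norm (defect t s)" by (rule norm_wave_flow_le)
    also have "\<dots> \<le> 2 * E" using s assms E by (intro mult_mono) auto
    finally have "\<bar>\<tau> - s\<bar> * norm (wave_flow (- s) (defect t s)) \<le> \<tau> * (2 * E)"
      using s assms E0 by (intro mult_mono) auto
    then show "norm (?D s) \<le> \<tau> * (2 * E)" by simp
  qed (use assms E0 in auto)
  finally show ?thesis by (simp add: power2_eq_square mult_ac)
qed

end

section \<open>The constants of the error bound\<close>

text \<open>They depend on the final time, on the radius \<open>M\<close> of a ball that contains the solution, and on a
  bound \<open>K\<close> for the nonlinearity on that ball, but not on the solution itself.\<close>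

definition null_const :: "real \<Rightarrow> real \<Rightarrow> real \<Rightarrow> real" where
  "null_const T M K = 2 * (T + 1) * (8 * M\<^sup>2 + 2 * (2 * K * (1 + M) * T)\<^sup>2)\<^sup>2"

definition defect_const :: "real \<Rightarrow> real \<Rightarrow> real \<Rightarrow> real" where
  "defect_const T M K = K * (2 * M + 16 * K * (4 * M + 2)) * T + 4 * K * sqrt (2 * T * null_const T M K)"

definition stab_const :: "real \<Rightarrow> real \<Rightarrow> real" where
  "stab_const M K = 1 + 2 * (K + 3 * (K * (3 + 4 * M)))"

definition error_const :: "real \<Rightarrow> real \<Rightarrow> real \<Rightarrow> real" where
  "error_const T M K = exp (stab_const M K * T) * (4 * defect_const T M K)"

lemma null_const_nonneg: "0 \<le> T \<Longrightarrow> 0 \<le> null_const T M K"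
  by (simp add: null_const_def)

lemma defect_const_nonneg: "0 \<le> T \<Longrightarrow> 0 \<le> M \<Longrightarrow> 0 \<le> K \<Longrightarrow> 0 \<le> defect_const T M K"
  using null_const_nonneg by (simp add: defect_const_def)

lemma error_const_nonneg: "0 \<le> T \<Longrightarrow> 0 \<le> M \<Longrightarrow> 0 \<le> K \<Longrightarrow> 0 \<le> error_const T M K"
  using defect_const_nonneg by (simp add: error_const_def)

section \<open>Summing the null forms\<close>

lemma lo_hi_pos: "0 \<le> s \<Longrightarrow> lo 1 s = 0" "0 \<le> s \<Longrightarrow> hi 1 s = 2 * s"
  and lo_hi_neg: "0 \<le> s \<Longrightarrow> lo (-1) s = - 2 * s" "0 \<le> s \<Longrightarrow> hi (-1) s = 0"
  by (auto simp: lo_def hi_def)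

text \<open>In time \<open>\<tau>\<close> the two families of characteristics move by \<open>2 \<tau>\<close> relative to each other, which is
  the length of the interval swept over in one step. Hence the intervals of successive steps are
  adjacent.\<close>

lemma window_telescope:
  assumes f: "periodic_L1 f" and \<sigma>: "\<sigma> = 1 \<or> \<sigma> = -1" and \<tau>: "0 \<le> \<tau>"
  shows "(\<Sum>n<N. window (lo \<sigma> \<tau> + 2 * \<sigma> * (real n * \<tau>)) (hi \<sigma> \<tau> + 2 * \<sigma> * (real n * \<tau>)) f x)
    = window (lo \<sigma> (real N * \<tau>)) (hi \<sigma> (real N * \<tau>)) f x"
proof (induction N)
  case 0
  then show ?case by (simp add: lo_def hi_def)
next
  case (Suc N)
  have N: "0 \<le> real N * \<tau>" "0 \<le> real (Suc N) * \<tau>" "real N * \<tau> \<le> real (Suc N) * \<tau>"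
    using \<tau> by (auto simp: algebra_simps)
  from \<sigma> show ?case
  proof
    assume [simp]: "\<sigma> = 1"
    show ?thesis
      using Suc window_combine[OF f, of 0 "2 * (real N * \<tau>)" "2 * (real (Suc N) * \<tau>)" x] N
      unfolding \<open>\<sigma> = 1\<close> lo_hi_pos[OF \<tau>] lo_hi_pos[OF N(1)] lo_hi_pos[OF N(2)]
      by (simp add: algebra_simps)
  next
    assume [simp]: "\<sigma> = -1"
    show ?thesis
      using Suc window_combine[OF f, of "- 2 * (real (Suc N) * \<tau>)" "- 2 * (real N * \<tau>)" 0 x] N
      unfolding \<open>\<sigma> = -1\<close> lo_hi_neg[OF \<tau>] lo_hi_neg[OF N(1)] lo_hi_neg[OF N(2)]
      by (simp add: algebra_simps)
  qed
qed

text \<open>At any time an invariant of the solution is a translate of its initial value \<open>w\<close> plus a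
  function bounded by \<open>\<kappa>\<close>. The majorant of its square is translated exactly, which allows the
  windows of different time steps to be added.\<close>

definition majorant :: "real \<Rightarrow> l2_torus \<Rightarrow> real \<Rightarrow> real" where
  "majorant \<kappa> w x = 2 * (rep w x)\<^sup>2 + 2 * \<kappa>\<^sup>2"

lemma periodic_L1_majorant: "periodic_L1 (majorant \<kappa> w)"
  unfolding majorant_def by (intro periodic_L1_add periodic_L1_scale periodic_L1_rep periodic_L1_const)

lemma majorant_nonneg: "0 \<le> majorant \<kappa> w x"
  by (simp add: majorant_def)

lemma integral_majorant: "(\<integral>x. majorant \<kappa> w x \<partial>torus) = 2 * (norm w)\<^sup>2 + 2 * \<kappa>\<^sup>2"
proof -
  have "measure torus {0..<1} = 1"
    by (subst measure_restrict_space) auto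
  then show ?thesis
    unfolding majorant_def norm_l2_rep
    by (subst Bochner_Integration.integral_add) (auto simp: integrable_rep_sq finite_measure.integrable_const)
qed

lemma sq_le_majorant:
  assumes "ess_bd \<kappa> (y - l2_shift h w)"
  shows "AE x in torus. (rep y x)\<^sup>2 \<le> majorant \<kappa> w (x + h)"
  using assms rep_l2_minus[of y "l2_shift h w"] rep_l2_shift[of h w] unfolding ess_bd_def
proof eventually_elim
  case (elim x)
  let ?d = "rep y x - rep w (x + h)" and ?w = "rep w (x + h)"
  have "\<bar>?d\<bar> \<le> \<kappa>" using elim by simp
  then have "?d\<^sup>2 \<le> \<kappa>\<^sup>2" by (metis abs_ge_zero power2_abs power_mono)
  moreover have "(rep y x)\<^sup>2 \<le> 2 * ?w\<^sup>2 + 2 * ?d\<^sup>2"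
  proof -
    have "0 \<le> (?w - ?d)\<^sup>2" by simp
    moreover have "rep y x = ?w + ?d" by simp
    ultimately show ?thesis by (simp add: power2_eq_square algebra_simps)
  qed
  ultimately show ?case by (simp add: majorant_def)
qed

lemma integrable_mult_window:
  assumes f: "periodic_L1 f" and p: "periodic_L1 p" "\<And>x. 0 \<le> p x" and "a \<le> b"
  shows "integrable torus (\<lambda>x. f x * window a b p x)"
proof -
  obtain B where "\<And>x. \<bar>window a b p x\<bar> \<le> B"
    using window_bounded[OF p assms(4)] by metis
  moreover have "window a b p \<in> borel_measurable borel"
    using p(1) by (intro window_measurable) (simp add: periodic_L1_def)
  ultimately show ?thesis
    using f by (intro integrable_torus_bounded_mult[where B = B]) (auto simp: periodic_L1_def)
qed

text \<open>The windows move to the right by \<open>2 \<sigma> t\<close> because the two majorants are translated in opposite directions.\<close>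

lemma null_form_le_majorant:
  assumes \<sigma>: "\<sigma> = 1 \<or> \<sigma> = -1" and \<tau>: "0 \<le> \<tau>"
    and q: "ess_bd \<kappa> (riem (- \<sigma>) z - l2_shift (- \<sigma> * t) q)" and p: "ess_bd \<kappa> (riem \<sigma> z - l2_shift (\<sigma> * t) p)"
  shows "null_form \<sigma> \<tau> z \<le> (\<integral>x. majorant \<kappa> q x *
     window (lo \<sigma> \<tau> + 2 * \<sigma> * t) (hi \<sigma> \<tau> + 2 * \<sigma> * t) (majorant \<kappa> p) x \<partial>torus)"
proof -
  note lh = lo_hi(1)[OF \<sigma> \<tau>]
  let ?A = "majorant \<kappa> q" and ?B = "majorant \<kappa> p"
  let ?F = "\<lambda>x. ?A x * window (lo \<sigma> \<tau> + 2 * \<sigma> * t) (hi \<sigma> \<tau> + 2 * \<sigma> * t) ?B x"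
  have sh: "?A (x + - \<sigma> * t) * window (lo \<sigma> \<tau>) (hi \<sigma> \<tau>) (\<lambda>y. ?B (y + \<sigma> * t)) x = ?F (x + - \<sigma> * t)" for x
  proof -
    have "window (lo \<sigma> \<tau> + 2 * \<sigma> * t) (hi \<sigma> \<tau> + 2 * \<sigma> * t) ?B (x + - \<sigma> * t) = window (lo \<sigma> \<tau>) (hi \<sigma> \<tau>) ?B (x + \<sigma> * t)"
      unfolding window_shift by (simp add: algebra_simps)
    also have "\<dots> = window (lo \<sigma> \<tau>) (hi \<sigma> \<tau>) (\<lambda>y. ?B (y + \<sigma> * t)) x"
      by (simp add: window_def add_ac)
    finally show ?thesis by simp
  qed
  have "null_form \<sigma> \<tau> z \<le> (\<integral>x. ?A (x + - \<sigma> * t) * window (lo \<sigma> \<tau>) (hi \<sigma> \<tau>) (\<lambda>y. ?B (y + \<sigma> * t)) x \<partial>torus)"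
    unfolding null_form_def
  proof (rule integral_mono_AE)
    show "integrable torus (\<lambda>x. (rep (riem (- \<sigma>) z) x)\<^sup>2 * window (lo \<sigma> \<tau>) (hi \<sigma> \<tau>) (\<lambda>y. (rep (riem \<sigma> z) y)\<^sup>2) x)"
      by (rule integrable_null_form[OF lh])
    show "integrable torus (\<lambda>x. ?A (x + - \<sigma> * t) * window (lo \<sigma> \<tau>) (hi \<sigma> \<tau>) (\<lambda>y. ?B (y + \<sigma> * t)) x)"
      by (intro integrable_mult_window periodic_L1_shift periodic_L1_majorant majorant_nonneg lh)
    have W: "window (lo \<sigma> \<tau>) (hi \<sigma> \<tau>) (\<lambda>y. (rep (riem \<sigma> z) y)\<^sup>2) x \<le> window (lo \<sigma> \<tau>) (hi \<sigma> \<tau>) (\<lambda>y. ?B (y + \<sigma> * t)) x" for x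
      by (intro window_mono periodic_L1_rep periodic_L1_shift periodic_L1_majorant sq_le_majorant p)
    have W0: "0 \<le> window (lo \<sigma> \<tau>) (hi \<sigma> \<tau>) (\<lambda>y. (rep (riem \<sigma> z) y)\<^sup>2) x" for x
      by (intro window_nonneg periodic_L1_rep) auto
    show "AE x in torus. (rep (riem (- \<sigma>) z) x)\<^sup>2 * window (lo \<sigma> \<tau>) (hi \<sigma> \<tau>) (\<lambda>y. (rep (riem \<sigma> z) y)\<^sup>2) x
        \<le> ?A (x + - \<sigma> * t) * window (lo \<sigma> \<tau>) (hi \<sigma> \<tau>) (\<lambda>y. ?B (y + \<sigma> * t)) x"
      using sq_le_majorant[OF q] by eventually_elim (intro mult_mono W W0 majorant_nonneg)
  qed
  also have "\<dots> = (\<integral>x. ?F (x + - \<sigma> * t) \<partial>torus)" by (simp only: sh)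
  also have "\<dots> = (\<integral>x. ?F x \<partial>torus)"
  proof (rule integral_torus_shift)
    have "?A \<in> borel_measurable borel" "?B \<in> borel_measurable borel"
      using periodic_L1_majorant by (auto simp: periodic_L1_def)
    then show "?F \<in> borel_measurable borel"
      by (intro borel_measurable_times window_measurable)
    show "?F (x + 1) = ?F x" for x
      using periodic_L1_majorant[of \<kappa> p] periodic_L1_majorant[of \<kappa> q] by (simp add: window_periodic periodic_L1_def)
  qed
  finally show ?thesis .
qed

text \<open>The sum of the windows is a single window of length \<open>2 N \<tau>\<close>, which covers the torus at most \<open>m\<close> times.\<close>

lemma sum_majorant_le:
  assumes \<sigma>: "\<sigma> = 1 \<or> \<sigma> = -1" and \<tau>: "0 \<le> \<tau>" and m: "2 * (real N * \<tau>) \<le> real m"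
  shows "(\<Sum>n<N. \<integral>x. majorant \<kappa> q x *
     window (lo \<sigma> \<tau> + 2 * \<sigma> * (real n * \<tau>)) (hi \<sigma> \<tau> + 2 * \<sigma> * (real n * \<tau>)) (majorant \<kappa> p) x \<partial>torus)
     \<le> real m * (2 * (norm p)\<^sup>2 + 2 * \<kappa>\<^sup>2) * (2 * (norm q)\<^sup>2 + 2 * \<kappa>\<^sup>2)"
proof -
  let ?A = "majorant \<kappa> q" and ?B = "majorant \<kappa> p"
  let ?w = "\<lambda>n. window (lo \<sigma> \<tau> + 2 * \<sigma> * (real n * \<tau>)) (hi \<sigma> \<tau> + 2 * \<sigma> * (real n * \<tau>)) ?B"
  let ?b = "2 * (norm p)\<^sup>2 + 2 * \<kappa>\<^sup>2"
  have int: "integrable torus (\<lambda>x. ?A x * ?w n x)" for n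
    using lo_hi(1)[OF \<sigma> \<tau>] by (intro integrable_mult_window periodic_L1_majorant majorant_nonneg) auto
  have iA: "integrable torus ?A" using periodic_L1_majorant by (simp add: periodic_L1_def)
  have N: "0 \<le> real N * \<tau>" using \<tau> by simp
  note lhN = lo_hi[OF \<sigma> N]
  have "(\<Sum>n<N. \<integral>x. ?A x * ?w n x \<partial>torus) = (\<integral>x. (\<Sum>n<N. ?A x * ?w n x) \<partial>torus)"
    by (rule Bochner_Integration.integral_sum[symmetric]) (rule int)
  also have "\<dots> \<le> (\<integral>x. ?A x * (real m * ?b) \<partial>torus)"
  proof (rule integral_mono)
    show "integrable torus (\<lambda>x. \<Sum>n<N. ?A x * ?w n x)" by (intro Bochner_Integration.integrable_sum int)
    show "integrable torus (\<lambda>x. ?A x * (real m * ?b))" using iA by simp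
    fix x
    have "(\<Sum>n<N. ?A x * ?w n x) = ?A x * window (lo \<sigma> (real N * \<tau>)) (hi \<sigma> (real N * \<tau>)) ?B x"
      by (simp add: sum_distrib_left[symmetric] window_telescope[OF periodic_L1_majorant \<sigma> \<tau>])
    also have "\<dots> \<le> ?A x * (real m * ?b)"
    proof (rule mult_left_mono[OF _ majorant_nonneg])
      show "window (lo \<sigma> (real N * \<tau>)) (hi \<sigma> (real N * \<tau>)) ?B x \<le> real m * ?b"
        unfolding integral_majorant[symmetric]
        by (rule window_le) (use periodic_L1_majorant majorant_nonneg lhN m in auto)
    qed
    finally show "(\<Sum>n<N. ?A x * ?w n x) \<le> ?A x * (real m * ?b)" .
  qed
  also have "\<dots> = real m * ?b * (2 * (norm q)\<^sup>2 + 2 * \<kappa>\<^sup>2)"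
    by (simp add: integral_majorant mult.commute)
  finally show ?thesis .
qed

context bounded_solution
begin

lemma M_nonneg: "0 \<le> T \<Longrightarrow> 0 \<le> M"
  using order_trans[OF norm_ge_zero bound[of 0]] by simp

text \<open>The deviation from free transport is an integral of translates of \<open>g(u)\<close>, and \<open>g(u)\<close> is bounded
  by the Sobolev embedding.\<close>

lemma ess_bd_riem_deviation:
  assumes \<sigma>: "\<sigma> = 1 \<or> \<sigma> = -1" and t: "0 \<le> t" "t \<le> T"
  shows "ess_bd (2 * K * (1 + M) * T) (riem \<sigma> (U t) - l2_shift (\<sigma> * t) (riem \<sigma> (U 0)))"
proof -
  let ?f = "\<lambda>r. wave_flow (- r) (0, nonlin g (u (0 + r)))"
  have sub: "{0..0 + t} \<subseteq> {0..T}" using t by auto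
  have M0: "0 \<le> M" using M_nonneg t by simp
  have c: "continuous_on {0..t} ?f"
    using t by (intro continuous_intros continuous_on_compose2[OF nonlin_cont]) auto
  have "U (0 + t) = wave_flow t (U 0 + integral {0..t} ?f)"
    by (rule duhamel[OF sol t(1) sub continuous_on_subset[OF nonlin_cont sub]])
  then have "riem \<sigma> (U t) - l2_shift (\<sigma> * t) (riem \<sigma> (U 0)) = l2_shift (\<sigma> * t) (riem \<sigma> (integral {0..t} ?f))"
    by (simp add: riem_wave_flow[OF \<sigma>])
  also have "riem \<sigma> (integral {0..t} ?f) = integral {0..t} (\<lambda>r. riem \<sigma> (?f r))"
    by (rule integral_bounded_linear_image[OF c bounded_linear_riem])
  finally have eq: "riem \<sigma> (U t) - l2_shift (\<sigma> * t) (riem \<sigma> (U 0)) = l2_shift (\<sigma> * t) (integral {0..t} (\<lambda>r. riem \<sigma> (?f r)))" .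
  have "ess_bd (2 * K * (1 + M) * (t - 0)) (integral {0..t} (\<lambda>r. riem \<sigma> (?f r)))"
  proof (rule ess_bd_integral[OF _ t(1)])
    show "continuous_on {0..t} (\<lambda>r. riem \<sigma> (?f r))" by (rule bounded_linear.continuous_on[OF bounded_linear_riem c])
    fix r assume r: "r \<in> {0..t}"
    then have "r \<in> {0..T}" using t by auto
    then have "2 * norm (nonlin_h1 g (u r)) \<le> 2 * K * (1 + M)"
      using norm_nonlin_h1_le[OF K norm_u] by simp
    then have "ess_bd (2 * K * (1 + M)) (nonlin g (u r))"
      using ess_bd_mono[OF ess_bd_l2_of_h1[of "nonlin_h1 g (u r)"]] by (simp add: l2_of_h1_nonlin_h1)
    then show "ess_bd (2 * K * (1 + M)) (riem \<sigma> (?f r))"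
      by (simp add: riem_wave_flow[OF \<sigma>] ess_bd_shift)
  qed
  moreover have "2 * K * (1 + M) * (t - 0) \<le> 2 * K * (1 + M) * T"
    using t K0 M0 by (intro mult_left_mono) auto
  ultimately show ?thesis unfolding eq by (intro ess_bd_shift) (rule ess_bd_mono)
qed

lemma sum_null_form_le:
  assumes \<sigma>: "\<sigma> = 1 \<or> \<sigma> = -1" and \<tau>: "0 \<le> \<tau>" and N: "real N * \<tau> \<le> T" and T: "0 \<le> T"
  shows "(\<Sum>n<N. null_form \<sigma> \<tau> (U (real n * \<tau>))) \<le> null_const T M K"
proof -
  let ?\<kappa> = "2 * K * (1 + M) * T" and ?p = "riem \<sigma> (U 0)" and ?q = "riem (- \<sigma>) (U 0)"
  have \<sigma>': "- \<sigma> = 1 \<or> - \<sigma> = -1" using \<sigma> by auto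
  define m where "m = nat \<lceil>2 * T\<rceil>"
  have m: "2 * T \<le> real m" "real m \<le> 2 * (T + 1)" using T by (auto simp: m_def of_nat_ceiling) linarith
  have tn: "0 \<le> real n * \<tau>" "real n * \<tau> \<le> T" if "n < N" for n
  proof -
    have "real n * \<tau> \<le> real N * \<tau>" using that \<tau> by (intro mult_right_mono) auto
    then show "real n * \<tau> \<le> T" using N by linarith
  qed (use \<tau> in simp)
  have "(\<Sum>n<N. null_form \<sigma> \<tau> (U (real n * \<tau>))) \<le> (\<Sum>n<N. \<integral>x. majorant ?\<kappa> ?q x *
     window (lo \<sigma> \<tau> + 2 * \<sigma> * (real n * \<tau>)) (hi \<sigma> \<tau> + 2 * \<sigma> * (real n * \<tau>)) (majorant ?\<kappa> ?p) x \<partial>torus)"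
    by (intro sum_mono null_form_le_majorant[OF \<sigma> \<tau>] ess_bd_riem_deviation \<sigma> \<sigma>' tn) auto
  also have "\<dots> \<le> real m * (2 * (norm ?p)\<^sup>2 + 2 * ?\<kappa>\<^sup>2) * (2 * (norm ?q)\<^sup>2 + 2 * ?\<kappa>\<^sup>2)"
    by (rule sum_majorant_le[OF \<sigma> \<tau>]) (use N m in linarith)
  also have "\<dots> \<le> 2 * (T + 1) * (8 * M\<^sup>2 + 2 * ?\<kappa>\<^sup>2) * (8 * M\<^sup>2 + 2 * ?\<kappa>\<^sup>2)"
  proof -
    have "2 * (norm (riem \<sigma>' (U 0)))\<^sup>2 + 2 * ?\<kappa>\<^sup>2 \<le> 8 * M\<^sup>2 + 2 * ?\<kappa>\<^sup>2" if "\<sigma>' = 1 \<or> \<sigma>' = -1" for \<sigma>'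
    proof -
      have "norm (riem \<sigma>' (U 0)) \<le> 2 * M"
        using norm_riem_le[OF that, of "U 0"] bound[of 0] T by simp
      then have "(norm (riem \<sigma>' (U 0)))\<^sup>2 \<le> (2 * M)\<^sup>2" by (intro power_mono) auto
      then show ?thesis by (simp add: power_mult_distrib)
    qed
    from this[OF \<sigma>] this[OF \<sigma>'] show ?thesis
      using m T by (intro mult_mono) auto
  qed
  finally show ?thesis by (simp add: null_const_def power2_eq_square mult.assoc)
qed

text \<open>The Cauchy--Schwarz inequality for the sum over the \<open>N\<close> steps: since \<open>N \<tau> \<le> T\<close>, it loses a factor
  of order \<open>1 / sqrt \<tau>\<close>, which the factor \<open>sqrt (2 \<tau>)\<close> from the single steps makes up for.\<close>

lemma sum_sqrt_null_form_le:
  assumes \<sigma>: "\<sigma> = 1 \<or> \<sigma> = -1" and \<tau>: "0 \<le> \<tau>" and N: "real N * \<tau> \<le> T" and T: "0 \<le> T"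
  shows "sqrt (2 * \<tau>) * (\<Sum>n<N. sqrt (null_form \<sigma> \<tau> (U (real n * \<tau>)))) \<le> sqrt (2 * T * null_const T M K)"
proof (rule real_le_rsqrt)
  let ?a = "\<lambda>n. null_form \<sigma> \<tau> (U (real n * \<tau>))"
  have "(\<Sum>n<N. sqrt (?a n))\<^sup>2 \<le> (\<Sum>n<N. (sqrt (?a n))\<^sup>2) * real (card {..<N})"
    by (rule sum_squared_le_sum_of_squares)
  also have "(\<Sum>n<N. (sqrt (?a n))\<^sup>2) = (\<Sum>n<N. ?a n)" by (simp add: null_form_nonneg)
  finally have "(\<Sum>n<N. sqrt (?a n))\<^sup>2 \<le> (\<Sum>n<N. ?a n) * real N" by simp
  also have "\<dots> \<le> null_const T M K * real N"
    by (rule mult_right_mono[OF sum_null_form_le[OF assms]]) simp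
  finally have "(2 * \<tau>) * (\<Sum>n<N. sqrt (?a n))\<^sup>2 \<le> (2 * \<tau>) * (null_const T M K * real N)"
    using \<tau> by (intro mult_left_mono) auto
  also have "\<dots> = 2 * (real N * \<tau>) * null_const T M K" by simp
  also have "\<dots> \<le> 2 * T * null_const T M K"
    using N null_const_nonneg[OF T] by (intro mult_right_mono) auto
  finally show "(sqrt (2 * \<tau>) * (\<Sum>n<N. sqrt (?a n)))\<^sup>2 \<le> 2 * T * null_const T M K"
    using \<tau> by (simp add: power_mult_distrib)
qed

lemma sum_local_error_le:
  assumes \<tau>: "0 < \<tau>" "\<tau> \<le> 1" and N: "real N * \<tau> \<le> T"
  shows "(\<Sum>n<N. norm (U (real n * \<tau> + \<tau>) - step \<tau> (U (real n * \<tau>)))) \<le> 4 * defect_const T M K * \<tau>\<^sup>2"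
proof -
  have T: "0 \<le> T" using \<tau> N by (meson mult_nonneg_nonneg of_nat_0_le_iff less_imp_le order_trans)
  have \<tau>0: "0 \<le> \<tau>" using \<tau> by simp
  let ?c = "K * (2 * M + 16 * K * (4 * M + 2))"
  let ?s = "\<lambda>\<sigma> n. sqrt (null_form \<sigma> \<tau> (U (real n * \<tau>)))"
  have M0: "0 \<le> M" by (rule M_nonneg[OF T])
  have "norm (U (real n * \<tau> + \<tau>) - step \<tau> (U (real n * \<tau>))) \<le> 4 * \<tau>\<^sup>2 * (?c * \<tau> + 2 * K * sqrt (2 * \<tau>) * (?s 1 n + ?s (-1) n))"
    if "n < N" for n
  proof -
    have "(real n + 1) * \<tau> \<le> real N * \<tau>" using that \<tau> by (intro mult_right_mono) auto
    then have nT: "real n * \<tau> + \<tau> \<le> T" using N by (simp add: algebra_simps)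
    show ?thesis
      by (rule local_error) (use \<tau> nT in \<open>auto intro!: norm_defect_le\<close>)
  qed
  then have "(\<Sum>n<N. norm (U (real n * \<tau> + \<tau>) - step \<tau> (U (real n * \<tau>))))
     \<le> (\<Sum>n<N. 4 * \<tau>\<^sup>2 * (?c * \<tau> + 2 * K * sqrt (2 * \<tau>) * (?s 1 n + ?s (-1) n)))"
    by (intro sum_mono) auto
  also have "\<dots> = 4 * \<tau>\<^sup>2 * (\<Sum>n<N. ?c * \<tau> + 2 * K * sqrt (2 * \<tau>) * (?s 1 n + ?s (-1) n))"
    by (rule sum_distrib_left[symmetric])
  also have "(\<Sum>n<N. ?c * \<tau> + 2 * K * sqrt (2 * \<tau>) * (?s 1 n + ?s (-1) n))
      = ?c * (real N * \<tau>) + 2 * K * (sqrt (2 * \<tau>) * (\<Sum>n<N. ?s 1 n) + sqrt (2 * \<tau>) * (\<Sum>n<N. ?s (-1) n))"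
    by (simp add: sum.distrib sum_distrib_left[symmetric] algebra_simps)
  also have "4 * \<tau>\<^sup>2 * \<dots> \<le> 4 * \<tau>\<^sup>2 * (?c * T + 2 * K * (sqrt (2 * T * null_const T M K) + sqrt (2 * T * null_const T M K)))"
    using K0 M0 N by (intro mult_left_mono add_mono sum_sqrt_null_form_le \<tau>0 T) auto
  also have "\<dots> = 4 * defect_const T M K * \<tau>\<^sup>2" by (simp add: defect_const_def algebra_simps)
  finally show ?thesis .
qed

end

section \<open>Stability and convergence\<close>

context C2_nonlinearity
begin

lemma step_lipschitz:
  assumes K: "nonlin_bounds M K" and \<tau>: "0 \<le> \<tau>" "\<tau> \<le> 1" and z: "norm z \<le> M" "norm z' \<le> M"
  shows "norm (step \<tau> z - step \<tau> z') \<le> (1 + stab_const M K * \<tau>) * norm (z - z')"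
proof -
  note K0 = K_nonneg[OF K]
  have M0: "0 \<le> M" using z(1) norm_ge_zero order_trans by blast
  define L where "L = K * (3 + 4 * M)"
  have L0: "0 \<le> L" using K0 M0 by (simp add: L_def)
  let ?d = "norm (z - z')"
  have fz: "norm (fst z) \<le> M" "norm (fst z') \<le> M" using z norm_fst_state_le order_trans by blast+
  let ?I = "\<lambda>z. integral {0..\<tau>} (\<lambda>s. (\<tau> - s) *\<^sub>R wave_flow (- 2 * s) (source_rate z))"
  have "?I z - ?I z' = integral {0..\<tau>} (\<lambda>s. (\<tau> - s) *\<^sub>R wave_flow (- 2 * s) (source_rate z - source_rate z'))"
    unfolding wave_flow_simps(3) scaleR_diff_right
    by (intro integral_diff[symmetric] integrable_continuous_real continuous_intros)
  also have "norm \<dots> \<le> \<tau> * (3 * (L * ?d)) * (\<tau> - 0)"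
  proof (intro integral_bound)
    show "continuous_on {0..\<tau>} (\<lambda>s. (\<tau> - s) *\<^sub>R wave_flow (- 2 * s) (source_rate z - source_rate z'))"
      by (intro continuous_intros)
    fix s assume s: "s \<in> {0..\<tau>}"
    have "norm (wave_flow (- 2 * s) (source_rate z - source_rate z')) \<le> (1 + \<bar>- 2 * s\<bar>) * norm (source_rate z - source_rate z')"
      by (rule norm_wave_flow_le)
    also have "\<dots> \<le> 3 * (L * ?d)"
      using s \<tau> source_rate_lipschitz[OF K z] by (intro mult_mono) (auto simp: L_def)
    finally have "\<bar>\<tau> - s\<bar> * norm (wave_flow (- 2 * s) (source_rate z - source_rate z')) \<le> \<tau> * (3 * (L * ?d))"
      using s L0 by (intro mult_mono) auto
    then show "norm ((\<tau> - s) *\<^sub>R wave_flow (- 2 * s) (source_rate z - source_rate z')) \<le> \<tau> * (3 * (L * ?d))"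
      by simp
  qed (use \<tau> in auto)
  also have "\<dots> \<le> \<tau> * (3 * (L * ?d)) * 1" using \<tau> L0 by (intro mult_left_mono) auto
  finally have I: "norm (?I z - ?I z') \<le> \<tau> * (3 * (L * ?d))" by simp
  have G: "norm (\<tau> *\<^sub>R (0 :: h1_torus, nonlin g (fst z) - nonlin g (fst z'))) \<le> \<tau> * (K * ?d)"
  proof -
    have "norm (nonlin g (fst z) - nonlin g (fst z')) \<le> K * norm (fst z - fst z')"
      by (rule nonlin_lipschitz[OF K fz])
    also have "\<dots> \<le> K * ?d" using norm_fst_state_le[of "z - z'"] K0 by (intro mult_left_mono) auto
    finally show ?thesis using \<tau> by (simp add: norm_Pair mult_left_mono)
  qed
  define S where "S = (z - z') + \<tau> *\<^sub>R (0, nonlin g (fst z) - nonlin g (fst z')) + (?I z - ?I z')"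
  have "step \<tau> z - step \<tau> z' = wave_flow \<tau> ((z - z') + \<tau> *\<^sub>R (0, nonlin g (fst z) - nonlin g (fst z')) + (?I z - ?I z'))"
  proof -
    have "(0 :: h1_torus, nonlin g (fst z) - nonlin g (fst z')) = (0, nonlin g (fst z)) - (0, nonlin g (fst z'))" by simp
    then show ?thesis
      unfolding step_def wave_flow_simps(3)[symmetric]
      by (simp only: scaleR_diff_right) (rule arg_cong[where f = "wave_flow \<tau>"], simp add: algebra_simps del: add_Pair scaleR_Pair diff_Pair)
  qed
  then have "norm (step \<tau> z - step \<tau> z') \<le> (1 + \<bar>\<tau>\<bar>) * norm S"
    using norm_wave_flow_le[of \<tau> S] by (simp only: S_def)
  also have "\<dots> \<le> (1 + \<tau>) * (?d + \<tau> * (K * ?d) + \<tau> * (3 * (L * ?d)))"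
  proof (rule mult_mono)
    have "norm ((z - z') + \<tau> *\<^sub>R (0, nonlin g (fst z) - nonlin g (fst z'))) \<le> ?d + \<tau> * (K * ?d)"
      by (rule norm_triangle_le[OF add_mono[OF order_refl G]])
    then show "norm S \<le> ?d + \<tau> * (K * ?d) + \<tau> * (3 * (L * ?d))"
      unfolding S_def by (rule norm_triangle_le[OF add_mono[OF _ I]])
  qed (use \<tau> in auto)
  also have "\<dots> = (1 + \<tau> + \<tau> * (K + 3 * L) + \<tau> * \<tau> * (K + 3 * L)) * ?d" by (simp add: algebra_simps)
  also have "\<dots> \<le> (1 + \<tau> + \<tau> * (K + 3 * L) + \<tau> * (K + 3 * L)) * ?d"
  proof -
    have "\<tau> * \<tau> * (K + 3 * L) \<le> \<tau> * (K + 3 * L)"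
      using \<tau> K0 L0 mult_left_mono[OF \<tau>(2,1)] by (intro mult_right_mono) auto
    then show ?thesis by (intro mult_right_mono) auto
  qed
  also have "\<dots> = (1 + stab_const M K * \<tau>) * ?d" by (simp add: stab_const_def L_def algebra_simps)
  finally show ?thesis .
qed

end

context bounded_solution
begin

text \<open>Lady Windermere's fan: as long as the numerical solution stays in the ball of radius \<open>M\<close>, the
  error is controlled by the sum of the local errors, and this sum is small enough to keep it
  there.\<close>

lemma global_error:
  assumes inner_bound: "\<And>t. t \<in> {0..T} \<Longrightarrow> norm (U t) \<le> M - 1"
    and \<tau>: "0 < \<tau>" "\<tau> \<le> 1" and small: "error_const T M K * \<tau>\<^sup>2 \<le> 1" and n: "real n * \<tau> \<le> T"
  shows "norm (U (real n * \<tau>) - (step \<tau> ^^ n) (U 0)) \<le> error_const T M K * \<tau>\<^sup>2"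
proof -
  define d where "d k = norm (U (real k * \<tau> + \<tau>) - step \<tau> (U (real k * \<tau>)))" for k
  define \<Lambda> where "\<Lambda> = stab_const M K"
  have T: "0 \<le> T" using \<tau> n by (meson mult_nonneg_nonneg of_nat_0_le_iff less_imp_le order_trans)
  have M0: "0 \<le> M" by (rule M_nonneg[OF T])
  have \<Lambda>0: "0 \<le> \<Lambda>" using K0 M0 by (simp add: \<Lambda>_def stab_const_def)
  have d0: "0 \<le> d k" for k by (simp add: d_def)
  have gen: "norm (U (real n * \<tau>) - (step \<tau> ^^ n) (U 0)) \<le> exp (\<Lambda> * (real n * \<tau>)) * (\<Sum>k<n. d k)
     \<and> exp (\<Lambda> * (real n * \<tau>)) * (\<Sum>k<n. d k) \<le> error_const T M K * \<tau>\<^sup>2"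
    if "real n * \<tau> \<le> T" for n
    using that
  proof (induction n)
    case 0
    have "0 \<le> error_const T M K * \<tau>\<^sup>2" using error_const_nonneg[OF T M0 K0] by simp
    then show ?case by simp
  next
    case (Suc n)
    let ?t = "real n * \<tau>" and ?z = "(step \<tau> ^^ n) (U 0)"
    have eqt: "real (Suc n) * \<tau> = ?t + \<tau>" by (simp add: algebra_simps)
    have tT: "?t + \<tau> \<le> T" "?t \<le> T" "0 \<le> ?t" using Suc.prems \<tau> unfolding eqt by auto
    note IH = Suc.IH[OF tT(2)]
    have Ut: "norm (U ?t) \<le> M - 1" using inner_bound tT by auto
    have "norm (U ?t - ?z) \<le> 1" using IH small by linarith
    then have zM: "norm ?z \<le> M" using Ut norm_triangle_sub[of ?z "U ?t"] by (simp add: norm_minus_commute)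
    have UM: "norm (U ?t) \<le> M" using Ut by simp
    have "U (?t + \<tau>) - step \<tau> ?z = (U (?t + \<tau>) - step \<tau> (U ?t)) + (step \<tau> (U ?t) - step \<tau> ?z)" by simp
    also have "norm \<dots> \<le> d n + (1 + \<Lambda> * \<tau>) * norm (U ?t - ?z)"
      unfolding d_def \<Lambda>_def
      by (rule norm_triangle_le[OF add_mono[OF order_refl step_lipschitz[OF K _ \<tau>(2) UM zM]]]) (use \<tau> in simp)
    also have "\<dots> \<le> exp (\<Lambda> * (?t + \<tau>)) * d n + exp (\<Lambda> * \<tau>) * (exp (\<Lambda> * ?t) * (\<Sum>k<n. d k))"
    proof (intro add_mono mult_mono)
      have "1 \<le> exp (\<Lambda> * (?t + \<tau>))" using \<Lambda>0 tT \<tau> by simp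
      then show "d n \<le> exp (\<Lambda> * (?t + \<tau>)) * d n" using mult_right_mono[OF _ d0[of n]] by fastforce
      show "norm (U ?t - ?z) \<le> exp (\<Lambda> * ?t) * (\<Sum>k<n. d k)" using IH by blast
    qed (use exp_ge_add_one_self in auto)
    also have "\<dots> = exp (\<Lambda> * (?t + \<tau>)) * (\<Sum>k<Suc n. d k)"
      by (simp add: distrib_left exp_add)
    finally have 1: "norm (U (?t + \<tau>) - step \<tau> ?z) \<le> exp (\<Lambda> * (?t + \<tau>)) * (\<Sum>k<Suc n. d k)" .
    have 2: "exp (\<Lambda> * (?t + \<tau>)) * (\<Sum>k<Suc n. d k) \<le> error_const T M K * \<tau>\<^sup>2"
    proof -
      have "exp (\<Lambda> * (?t + \<tau>)) * (\<Sum>k<Suc n. d k) \<le> exp (\<Lambda> * T) * (4 * defect_const T M K * \<tau>\<^sup>2)"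
      proof (rule mult_mono)
        show "exp (\<Lambda> * (?t + \<tau>)) \<le> exp (\<Lambda> * T)"
          using mult_left_mono[OF tT(1) \<Lambda>0] by simp
        show "(\<Sum>k<Suc n. d k) \<le> 4 * defect_const T M K * \<tau>\<^sup>2"
          unfolding d_def by (rule sum_local_error_le[OF \<tau> Suc.prems])
        show "0 \<le> (\<Sum>k<Suc n. d k)" by (intro sum_nonneg d0)
      qed simp
      then show ?thesis by (simp add: error_const_def \<Lambda>_def mult.assoc)
    qed
    show ?case using 1 2 unfolding eqt by simp
  qed
  show ?thesis using gen[OF n] by linarith
qed

end

section \<open>Suprema of continuous curves and the error bound\<close>

text \<open>A value above the essential supremum would, by continuity, be exceeded on an interval of
  positive length.\<close>

lemma norm_le_Linf_norm:
  fixes f :: "real \<Rightarrow> 'a::real_normed_vector"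
  assumes T: "0 < T" and f: "continuous_on {0..T} f" and t: "t \<in> {0..T}"
  shows "norm (f t) \<le> Linf_norm T f"
proof -
  let ?M = "restrict_space lborel {0..T}" and ?e = "esssup (restrict_space lborel {0..T}) (\<lambda>t. ereal (norm (f t)))"
  have cn: "continuous_on {0..T} (\<lambda>t. norm (f t))" by (intro continuous_intros f)
  have "(\<lambda>t. norm (f t)) \<in> borel_measurable (restrict_space borel {0..T})"
    by (rule borel_measurable_continuous_on_restrict[OF cn])
  then have m: "(\<lambda>t. ereal (norm (f t))) \<in> borel_measurable ?M"
    by (intro borel_measurable_ereal) (simp cong: measurable_cong_sets sets_restrict_space_cong)
  have "compact ((\<lambda>t. norm (f t)) ` {0..T})" by (intro compact_continuous_image cn) simp
  then obtain B where "\<forall>y\<in>(\<lambda>t. norm (f t)) ` {0..T}. norm y \<le> B"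
    using compact_imp_bounded bounded_iff by metis
  then have B: "norm (f t) \<le> B" if "t \<in> {0..T}" for t using that by simp
  have "?e \<le> ereal B"
    by (rule esssup_I[OF m]) (intro AE_I2, simp add: B space_restrict_space)
  have AE0: "AE t in lborel. t \<in> {0..T} \<longrightarrow> ereal (norm (f t)) \<le> ?e"
    using esssup_AE[of "\<lambda>t. ereal (norm (f t))" ?M] by (subst (asm) AE_restrict_space_iff) auto
  have everywhere: "ereal (norm (f s)) \<le> ?e" if s: "s \<in> {0..T}" for s
  proof (rule ccontr)
    assume "\<not> ereal (norm (f s)) \<le> ?e"
    then obtain r where r: "?e < ereal r" "r < norm (f s)"
      using ereal_dense2[of ?e "ereal (norm (f s))"] by (auto simp: not_le)
    have "((\<lambda>t. norm (f t)) \<longlongrightarrow> norm (f s)) (at s within {0..T})"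
      using cn s by (auto simp: continuous_on_def)
    from order_tendstoD(1)[OF this r(2)]
    obtain \<delta> where \<delta>: "0 < \<delta>" "\<And>t. t \<in> {0..T} \<Longrightarrow> dist t s < \<delta> \<Longrightarrow> r < norm (f t)"
      using r(2) unfolding eventually_at by (metis dist_self)
    let ?J = "{max 0 (s - \<delta> / 2)..min T (s + \<delta> / 2)}"
    have "AE t in lborel. t \<notin> ?J"
      using AE0
    proof eventually_elim
      case (elim t)
      show ?case
      proof
        assume "t \<in> ?J"
        then have "t \<in> {0..T}" "dist t s < \<delta>" using \<delta>(1) by (auto simp: dist_real_def abs_if)
        then have "ereal r < ereal (norm (f t))" "ereal (norm (f t)) \<le> ?e" using \<delta>(2) elim by auto
        then show False using r(1) by (meson less_asym less_le_trans)
      qed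
    qed
    moreover have "?J \<in> sets lborel" by simp
    ultimately have "?J \<in> null_sets lborel" using AE_iff_null_sets by blast
    then have "emeasure lborel ?J = 0" by (rule null_setsD1)
    moreover have lt: "max 0 (s - \<delta> / 2) < min T (s + \<delta> / 2)" using s \<delta>(1) T by auto
    have "emeasure lborel ?J = ennreal (min T (s + \<delta> / 2) - max 0 (s - \<delta> / 2))"
      by (rule emeasure_lborel_Icc[OF less_imp_le[OF lt]])
    ultimately show False using lt by (simp only: ennreal_eq_0_iff)
  qed
  have "ereal (norm (f t)) \<le> ?e" by (rule everywhere[OF t])
  moreover have "?e \<noteq> \<infinity>" using \<open>?e \<le> ereal B\<close> by auto
  ultimately show ?thesis
    unfolding Linf_norm_def by (cases ?e) auto
qed

theorem theorem1p3:
  fixes T :: real and g :: "real \<Rightarrow> real"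
  assumes "0 < T" and "C2_fun g"
  shows "\<exists>C \<tau>0 :: real \<Rightarrow> real \<Rightarrow> real.
    (\<forall>M1 M2. 0 < C M1 M2 \<and> 0 < \<tau>0 M1 M2) \<and>
    (\<forall>(u0 :: h1_torus) (v0 :: l2_torus) (u :: real \<Rightarrow> h1_torus) (v :: real \<Rightarrow> l2_torus).
       wave_solution {0..T} (nonlin g) u v \<and> u 0 = u0 \<and> v 0 = v0 \<longrightarrow>
       (\<forall>(\<tau> :: real) (n :: nat).
          0 < \<tau> \<and> \<tau> \<le> \<tau>0 (Linf_norm T u) (Linf_norm T v) \<and> real n * \<tau> \<le> T \<longrightarrow>
          norm (u (real n * \<tau>) - fst (scheme g \<tau> u0 v0 n))
          + norm (v (real n * \<tau>) - snd (scheme g \<tau> u0 v0 n))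
          \<le> C (Linf_norm T u) (Linf_norm T v) * \<tau>\<^sup>2))"
proof -
  interpret C2_nonlinearity g by unfold_locales (rule assms(2))
  have T0: "0 \<le> T" using assms(1) by simp
  obtain K where K: "\<And>M. nonlin_bounds M (K M)" using nonlin_bounds_exist by metis
  \<comment> \<open>The radius exceeds the bound for the solution by one, which leaves room for the numerical solution.\<close>
  define R where "R M1 M2 = \<bar>M1\<bar> + \<bar>M2\<bar> + (1::real)" for M1 M2
  define X where "X M1 M2 = error_const T (R M1 M2) (K (R M1 M2))" for M1 M2
  have X0: "0 \<le> X M1 M2" for M1 M2
    unfolding X_def using K_nonneg[OF K] by (intro error_const_nonneg T0) (auto simp: R_def)
  define C where "C M1 M2 = 2 * X M1 M2 + 1" for M1 M2
  define \<tau>0 where "\<tau>0 M1 M2 = 1 / (1 + X M1 M2)" for M1 M2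
  show ?thesis
  proof (rule exI[of _ C], rule exI[of _ \<tau>0], intro conjI allI impI)
    fix M1 M2 :: real
    show "0 < C M1 M2" "0 < \<tau>0 M1 M2" using X0[of M1 M2] by (auto simp: C_def \<tau>0_def)
  next
    fix u0 :: h1_torus and v0 :: l2_torus and u v and \<tau> :: real and n :: nat
    assume *: "wave_solution {0..T} (nonlin g) u v \<and> u 0 = u0 \<and> v 0 = v0"
      and **: "0 < \<tau> \<and> \<tau> \<le> \<tau>0 (Linf_norm T u) (Linf_norm T v) \<and> real n * \<tau> \<le> T"
    let ?M1 = "Linf_norm T u" and ?M2 = "Linf_norm T v"
    note sol = conjunct1[OF *]
    have bd: "norm (u t, v t) \<le> R ?M1 ?M2 - 1" if "t \<in> {0..T}" for t
      using norm_Pair_le[of "u t" "v t"] norm_le_Linf_norm[OF assms(1) wave_solution_continuous(1)[OF sol] that]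
        norm_le_Linf_norm[OF assms(1) wave_solution_continuous(2)[OF sol] that] by (simp add: R_def)
    interpret bounded_solution g T "R ?M1 ?M2" "K (R ?M1 ?M2)" u v
    proof unfold_locales
      show "norm (u t, v t) \<le> R ?M1 ?M2" if "t \<in> {0..T}" for t using bd[OF that] by simp
    qed (rule sol K)+
    have \<tau>: "0 < \<tau>" "\<tau> * (1 + X ?M1 ?M2) \<le> 1"
      using ** X0[of ?M1 ?M2] by (auto simp: \<tau>0_def pos_le_divide_eq)
    have "\<tau> * 1 \<le> \<tau> * (1 + X ?M1 ?M2)" using \<tau>(1) X0[of ?M1 ?M2] by (intro mult_left_mono) auto
    then have \<tau>1: "\<tau> \<le> 1" using \<tau>(2) by simp
    have "X ?M1 ?M2 * \<tau>\<^sup>2 \<le> X ?M1 ?M2 * \<tau>"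
      using \<tau>(1) \<tau>1 X0[of ?M1 ?M2] by (intro mult_left_mono) (auto simp: power2_eq_square mult_left_le)
    also have "\<dots> \<le> 1" using \<tau> by (simp add: algebra_simps)
    finally have small: "error_const T (R ?M1 ?M2) (K (R ?M1 ?M2)) * \<tau>\<^sup>2 \<le> 1" by (simp add: X_def)
    have sch: "scheme g \<tau> u0 v0 n = (step \<tau> ^^ n) (u 0, v 0)"
    proof -
      have "scheme_step g \<tau> = step \<tau>" using scheme_step_eq[OF \<tau>(1)] by (intro ext)
      then show ?thesis using * by (simp add: scheme_def)
    qed
    let ?e = "(u (real n * \<tau>), v (real n * \<tau>)) - scheme g \<tau> u0 v0 n"
    have "norm ?e \<le> X ?M1 ?M2 * \<tau>\<^sup>2"
      unfolding sch X_def using ** by (intro global_error[OF bd \<tau>(1) \<tau>1 small]) auto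
    moreover have "norm (fst ?e) \<le> norm ?e" "norm (snd ?e) \<le> norm ?e"
      by (rule norm_fst_state_le norm_snd_state_le)+
    ultimately have "norm (fst ?e) + norm (snd ?e) \<le> 2 * (X ?M1 ?M2 * \<tau>\<^sup>2)" by linarith
    also have "\<dots> \<le> C ?M1 ?M2 * \<tau>\<^sup>2" by (simp add: C_def algebra_simps)
    finally show "norm (u (real n * \<tau>) - fst (scheme g \<tau> u0 v0 n)) + norm (v (real n * \<tau>) - snd (scheme g \<tau> u0 v0 n))
        \<le> C ?M1 ?M2 * \<tau>\<^sup>2" by simp
  qed
qed

end
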